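(* Let $(\Sigma_A,\theta)$ be a topological Markov chain with the big images and preimages (b.i.p.) property, let $G$ be a countable discrete group, let $\psi:\Sigma_A\to G$ be constant on cylinders of length one, and assume that the $G$-extension $(X,T)$, $X=\Sigma_A\times G$, $T(x,g)=(\theta x,g\psi(x))$, is topologically transitive. Let $\varphi:\Sigma_A\to(0,\infty)$ be a potential such that $\log\varphi$ is locally Hölder continuous and $\|L_\varphi(1)\|_\infty<\infty$. If $P_G(T,\varphi)=P_G(\theta,\varphi)$, then the group $G$ is amenable.
   Context: Topological Markov chain: let $I$ be a countable alphabet and $A=(a_{ij})_{i,j\in I}$ a matrix with entries in $\{0,1\}$ and $\sum_j a_{ij}>0$ for all $i$. Then $\Sigma_A=\{(w_k)_{k\ge 0}: w_k\in I,\ a_{w_kw_{k+1}}=1\ \forall k\}$ with the topology generated by cylinders, and $\theta$ is the one-sided (left) shift. A word of length $n$ is $w=(w_1\ldots w_n)\in I^n$ with $a_{w_kw_{k+1}}=1$ for $1\le k<n$; such words are called admissible, $\mathcal W^n$ is the set of words of length $n$, and $[w]\subset\Sigma_A$ is the cylinder of sequences beginning with $w$. A topological Markov chain is topologically transitive if for all states $a,b$ there is $n$ such that there is an admissible word $w$ of length $n$ starting with $a$ with $wb$ admissible; it is topologically mixing if for all $a,b$ such a word exists for all sufficiently large $n$. It has the b.i.p. property if it is topologically mixing and there is a finite set $\mathcal I_{\mathrm{bip}}\subset\mathcal W^1$ such that for every $v\in\mathcal W^1$ there are $\beta,\beta'\in\mathcal I_{\mathrm{bip}}$ with $(v\beta)\in\mathcal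 W^2$ and $(\beta'v)\in\mathcal W^2$. The extension $(X,T)$ is itself a topological Markov chain with cylinders $[w]\times\{g\}$ and states $(a,g)$, $a\in\mathcal W^1$, $g\in G$; transitivity of $T$ is understood in this sense. A function $f:\Sigma_A\to\mathbb R$ is locally Hölder continuous if there are $0<r<1$ and $C\ge1$ with $V_n(f):=\sup\{|f(x)-f(y)|: x,y \text{ agree in their first } n \text{ coordinates}\}\le Cr^n$ for all $n\ge1$. Put $\Phi_n=\prod_{k=0}^{n-1}\varphi\circ\theta^k$. For $v\in\mathcal W^1$ let $\tau_v:\theta([v])\to[v]$ be the inverse of $\theta|_{[v]}$. The Ruelle operator is $L_\varphi(f)(x)=\sum_{v\in\mathcal W^1:\ x\in\theta([v])}\varphi(\tau_v(x))f(\tau_v(x))$. The potential is lifted to $X$ by $\varphi(x,g)=\varphi(x)$. Gurevič pressure: for $a\in\mathcal W^1$, $$P_G(\theta,\varphi)=\limsup_{n\to\infty}\frac1n\log\sum_{\theta^n(x)=x,\ x\in[a]}\Phi_n(x),\qquad P_G(T,\varphi)=\limsup_{n\to\infty}\frac1n\log\sum_{T^n(x,\mathrm{id})=(x,\mathrm{id}),\ x\in[a]}\Phi_n(x),$$ where $\mathrm{id}$ is the identity of $G$ and $\log 0=-\infty$; under the present assumptions these values do not depend on $a$. Amenable: $G$ is amenable if there is a sequence $(K_n)$ of finite nonempty subsets of $G$ with $\bigcup_nK_n=G$ and $\lim_n|gK_n\triangle K_n|/|K_n|=0$ for all $g\in G$. *)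

theory Defs
  imports "HOL-Analysis.Analysis" "HOL-Algebra.Coset"
begin

text \<open>The alphabet is a set \<open>S\<close>; the transition matrix is the relation \<open>A\<close>, with
  \<open>A i j\<close> for \<open>a_ij = 1\<close>. Only its values on \<open>S\<close> matter.\<close>

definition tmc :: "'s set \<Rightarrow> ('s \<Rightarrow> 's \<Rightarrow> bool) \<Rightarrow> bool" where
  "tmc S A \<longleftrightarrow> countable S \<and> (\<forall>i\<in>S. \<exists>j\<in>S. A i j)"

definition shift_space :: "'s set \<Rightarrow> ('s \<Rightarrow> 's \<Rightarrow> bool) \<Rightarrow> (nat \<Rightarrow> 's) set" where
  "shift_space S A = {w. \<forall>k. w k \<in> S \<and> A (w k) (w (Suc k))}"

definition shift :: "(nat \<Rightarrow> 's) \<Rightarrow> (nat \<Rightarrow> 's)" where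
  "shift w = (\<lambda>k. w (Suc k))"

definition admissible_words :: "'s set \<Rightarrow> ('s \<Rightarrow> 's \<Rightarrow> bool) \<Rightarrow> nat \<Rightarrow> 's list set" where
  "admissible_words S A n = {w. length w = n \<and> set w \<subseteq> S \<and> successively A w}"

definition cylinder :: "'s set \<Rightarrow> ('s \<Rightarrow> 's \<Rightarrow> bool) \<Rightarrow> 's list \<Rightarrow> (nat \<Rightarrow> 's) set" where
  "cylinder S A w = {x \<in> shift_space S A. \<forall>k<length w. x k = w ! k}"

definition connected_by :: "'s set \<Rightarrow> ('s \<Rightarrow> 's \<Rightarrow> bool) \<Rightarrow> nat \<Rightarrow> 's \<Rightarrow> 's \<Rightarrow> bool" where
  "connected_by S A n a b \<longleftrightarrow>
     (\<exists>w \<in> admissible_words S A n. w \<noteq> [] \<and> hd w = a \<and> w @ [b] \<in> admissible_words S A (Suc n))"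

definition top_transitive :: "'s set \<Rightarrow> ('s \<Rightarrow> 's \<Rightarrow> bool) \<Rightarrow> bool" where
  "top_transitive S A \<longleftrightarrow> (\<forall>a\<in>S. \<forall>b\<in>S. \<exists>n. connected_by S A n a b)"

definition top_mixing :: "'s set \<Rightarrow> ('s \<Rightarrow> 's \<Rightarrow> bool) \<Rightarrow> bool" where
  "top_mixing S A \<longleftrightarrow> (\<forall>a\<in>S. \<forall>b\<in>S. \<exists>N. \<forall>n\<ge>N. connected_by S A n a b)"

definition bip :: "'s set \<Rightarrow> ('s \<Rightarrow> 's \<Rightarrow> bool) \<Rightarrow> bool" where
  "bip S A \<longleftrightarrow> top_mixing S A \<and>
     (\<exists>J\<subseteq>S. finite J \<and>
        (\<forall>v\<in>S. \<exists>\<beta>\<in>J. \<exists>\<beta>'\<in>J.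
           [v, \<beta>] \<in> admissible_words S A 2 \<and> [\<beta>', v] \<in> admissible_words S A 2))"

text \<open>Suprema are taken in the extended reals, since \<open>Sup\<close> on the reals is
  unspecified for unbounded sets.\<close>

definition variation ::
  "'s set \<Rightarrow> ('s \<Rightarrow> 's \<Rightarrow> bool) \<Rightarrow> ((nat \<Rightarrow> 's) \<Rightarrow> real) \<Rightarrow> nat \<Rightarrow> ereal" where
  "variation S A f n =
     (SUP (x, y) \<in> {(x, y). x \<in> shift_space S A \<and> y \<in> shift_space S A \<and> (\<forall>k<n. x k = y k)}.
        ereal \<bar>f x - f y\<bar>)"

definition locally_hoelder ::
  "'s set \<Rightarrow> ('s \<Rightarrow> 's \<Rightarrow> bool) \<Rightarrow> ((nat \<Rightarrow> 's) \<Rightarrow> real) \<Rightarrow> bool" where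
  "locally_hoelder S A f \<longleftrightarrow>
     (\<exists>r C. 0 < r \<and> r < 1 \<and> C \<ge> 1 \<and> (\<forall>n\<ge>1. variation S A f n \<le> ereal (C * r ^ n)))"

definition birkhoff_prod :: "((nat \<Rightarrow> 's) \<Rightarrow> real) \<Rightarrow> nat \<Rightarrow> (nat \<Rightarrow> 's) \<Rightarrow> real" where
  "birkhoff_prod \<phi> n x = (\<Prod>k<n. \<phi> ((shift ^^ k) x))"

definition inv_branch :: "'s set \<Rightarrow> ('s \<Rightarrow> 's \<Rightarrow> bool) \<Rightarrow> 's \<Rightarrow> (nat \<Rightarrow> 's) \<Rightarrow> (nat \<Rightarrow> 's)" where
  "inv_branch S A v = the_inv_into (cylinder S A [v]) shift"

text \<open>The Ruelle operator of a positive potential, on functions with values in \<open>[0, \<infinity>]\<close>.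
  Extended values keep a divergent sum from being read as \<open>0\<close>.\<close>

definition ruelle_op ::
  "'s set \<Rightarrow> ('s \<Rightarrow> 's \<Rightarrow> bool) \<Rightarrow> ((nat \<Rightarrow> 's) \<Rightarrow> real) \<Rightarrow>
   ((nat \<Rightarrow> 's) \<Rightarrow> ennreal) \<Rightarrow> (nat \<Rightarrow> 's) \<Rightarrow> ennreal" where
  "ruelle_op S A \<phi> f x =
     (\<Sum>\<^sub>\<infinity>v \<in> {v \<in> S. x \<in> shift ` cylinder S A [v]}.
        ennreal (\<phi> (inv_branch S A v x)) * f (inv_branch S A v x))"

definition sup_norm :: "'s set \<Rightarrow> ('s \<Rightarrow> 's \<Rightarrow> bool) \<Rightarrow> ((nat \<Rightarrow> 's) \<Rightarrow> ennreal) \<Rightarrow> ennreal" where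
  "sup_norm S A f = (SUP x \<in> shift_space S A. f x)"

definition ext_map ::
  "('g, 'm) monoid_scheme \<Rightarrow> ((nat \<Rightarrow> 's) \<Rightarrow> 'g) \<Rightarrow> (nat \<Rightarrow> 's) \<times> 'g \<Rightarrow> (nat \<Rightarrow> 's) \<times> 'g" where
  "ext_map G \<psi> = (\<lambda>(x, g). (shift x, g \<otimes>\<^bsub>G\<^esub> \<psi> x))"

text \<open>The extension as a topological Markov chain with states \<open>(a, g)\<close>: there is a transition
  from \<open>(a, g)\<close> to \<open>(b, h)\<close> iff the image of \<open>[a] \<times> {g}\<close> meets \<open>[b] \<times> {h}\<close>.\<close>

definition ext_states :: "('g, 'm) monoid_scheme \<Rightarrow> 's set \<Rightarrow> ('s \<times> 'g) set" where
  "ext_states G S = S \<times> carrier G"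

definition ext_matrix ::
  "('g, 'm) monoid_scheme \<Rightarrow> 's set \<Rightarrow> ('s \<Rightarrow> 's \<Rightarrow> bool) \<Rightarrow> ((nat \<Rightarrow> 's) \<Rightarrow> 'g) \<Rightarrow>
   's \<times> 'g \<Rightarrow> 's \<times> 'g \<Rightarrow> bool" where
  "ext_matrix G S A \<psi> = (\<lambda>(a, g) (b, h).
     ext_map G \<psi> ` (cylinder S A [a] \<times> {g}) \<inter> (cylinder S A [b] \<times> {h}) \<noteq> {})"

definition ext_log :: "ennreal \<Rightarrow> ereal" where
  "ext_log s = (if s = 0 then -\<infinity> else if s = \<infinity> then \<infinity> else ereal (ln (enn2real s)))"

definition pressure ::
  "'s set \<Rightarrow> ('s \<Rightarrow> 's \<Rightarrow> bool) \<Rightarrow> ((nat \<Rightarrow> 's) \<Rightarrow> real) \<Rightarrow> 's \<Rightarrow> ereal" where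
  "pressure S A \<phi> a =
     limsup (\<lambda>n. ereal (1 / real n) *
       ext_log (\<Sum>\<^sub>\<infinity>x \<in> {x \<in> cylinder S A [a]. (shift ^^ n) x = x}.
         ennreal (birkhoff_prod \<phi> n x)))"

definition ext_pressure ::
  "('g, 'm) monoid_scheme \<Rightarrow> 's set \<Rightarrow> ('s \<Rightarrow> 's \<Rightarrow> bool) \<Rightarrow> ((nat \<Rightarrow> 's) \<Rightarrow> 'g) \<Rightarrow>
   ((nat \<Rightarrow> 's) \<Rightarrow> real) \<Rightarrow> 's \<Rightarrow> ereal" where
  "ext_pressure G S A \<psi> \<phi> a =
     limsup (\<lambda>n. ereal (1 / real n) *
       ext_log (\<Sum>\<^sub>\<infinity>x \<in> {x \<in> cylinder S A [a].
                       (ext_map G \<psi> ^^ n) (x, \<one>\<^bsub>G\<^esub>) = (x, \<one>\<^bsub>G\<^esub>)}.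
         ennreal (birkhoff_prod \<phi> n x)))"

definition amenable :: "('g, 'm) monoid_scheme \<Rightarrow> bool" where
  "amenable G \<longleftrightarrow>
     (\<exists>K :: nat \<Rightarrow> 'g set.
        (\<forall>n. finite (K n) \<and> K n \<noteq> {} \<and> K n \<subseteq> carrier G) \<and>
        (\<Union>n. K n) = carrier G \<and>
        (\<forall>g \<in> carrier G.
           (\<lambda>n. real (card (sym_diff (g <#\<^bsub>G\<^esub> K n) (K n))) / real (card (K n))) \<longlonglongrightarrow> 0))"

lemma cylinder_nonempty:
  assumes "tmc S A" "a \<in> S"
  shows "\<exists>x \<in> shift_space S A. x 0 = a"
proof -
  from assms obtain s where s: "\<And>i. i \<in> S \<Longrightarrow> s i \<in> S \<and> A i (s i)"
    unfolding tmc_def by metis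
  define x where "x k = (s ^^ k) a" for k
  have "x k \<in> S" for k
    by (induction k) (use assms s in \<open>auto simp: x_def\<close>)
  moreover have "A (x k) (x (Suc k))" for k
    using s[OF \<open>x k \<in> S\<close>] by (simp add: x_def)
  ultimately have "x \<in> shift_space S A"
    by (simp add: shift_space_def)
  moreover have "x 0 = a" by (simp add: x_def)
  ultimately show ?thesis by blast
qed

lemma inj_on_shift_cylinder: "inj_on shift (cylinder S A [v])"
proof (rule inj_onI, rule ext)
  fix x y k
  assume "x \<in> cylinder S A [v]" "y \<in> cylinder S A [v]" "shift x = shift y"
  then show "x k = y k"
    by (cases k) (auto simp: cylinder_def shift_def fun_eq_iff)
qed

lemma ext_matrix_iff:
  assumes "tmc S A" "a \<in> S" "b \<in> S"
    and x: "x \<in> shift_space S A" "x 0 = a"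
    and const: "\<And>x y. x \<in> shift_space S A \<Longrightarrow> y \<in> shift_space S A \<Longrightarrow> x 0 = y 0 \<Longrightarrow> \<psi> x = \<psi> y"
  shows "ext_matrix G S A \<psi> (a, g) (b, h) \<longleftrightarrow> A a b \<and> h = g \<otimes>\<^bsub>G\<^esub> \<psi> x"
proof
  assume "ext_matrix G S A \<psi> (a, g) (b, h)"
  then obtain y where y: "y \<in> shift_space S A" "y 0 = a" "y (Suc 0) = b" "h = g \<otimes>\<^bsub>G\<^esub> \<psi> y"
    by (auto simp: ext_matrix_def ext_map_def cylinder_def shift_def)
  then have "A a b"
    by (auto simp: shift_space_def)
  moreover have "\<psi> y = \<psi> x" by (rule const) (use y x in simp_all)
  ultimately show "A a b \<and> h = g \<otimes>\<^bsub>G\<^esub> \<psi> x" using y by simp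
next
  assume R: "A a b \<and> h = g \<otimes>\<^bsub>G\<^esub> \<psi> x"
  obtain z where z: "z \<in> shift_space S A" "z 0 = b"
    using cylinder_nonempty[OF assms(1,3)] by blast
  define y where "y = case_nat a z"
  have y: "y \<in> shift_space S A"
    using z R assms(2) by (auto simp: y_def shift_space_def split: nat.split)
  have sh: "shift y = z" by (simp add: shift_def y_def)
  have "\<psi> y = \<psi> x" using const[OF y x(1)] x(2) by (simp add: y_def)
  then have "ext_map G \<psi> (y, g) = (z, h)" using R sh by (simp add: ext_map_def)
  moreover have "(y, g) \<in> cylinder S A [a] \<times> {g}" using y by (simp add: cylinder_def y_def)
  moreover have "(z, h) \<in> cylinder S A [b] \<times> {h}" using z by (simp add: cylinder_def)
  ultimately show "ext_matrix G S A \<psi> (a, g) (b, h)"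
    unfolding ext_matrix_def prod.case by (metis IntI empty_iff image_eqI)
qed

lemma tmc_extension:
  assumes "tmc S A" "group G" "countable (carrier G)"
    and "\<And>x. x \<in> shift_space S A \<Longrightarrow> \<psi> x \<in> carrier G"
    and const: "\<And>x y. x \<in> shift_space S A \<Longrightarrow> y \<in> shift_space S A \<Longrightarrow> x 0 = y 0 \<Longrightarrow> \<psi> x = \<psi> y"
  shows "tmc (ext_states G S) (ext_matrix G S A \<psi>)"
  unfolding tmc_def
proof (intro conjI ballI)
  show "countable (ext_states G S)"
    using assms(1,3) by (simp add: ext_states_def tmc_def)
next
  fix p assume "p \<in> ext_states G S"
  then obtain a g where p: "p = (a, g)" "a \<in> S" "g \<in> carrier G"
    by (auto simp: ext_states_def)
  obtain x where x: "x \<in> shift_space S A" "x 0 = a"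
    using cylinder_nonempty[OF assms(1) p(2)] by blast
  obtain b where b: "b \<in> S" "A a b" using assms(1) p by (auto simp: tmc_def)
  have "ext_matrix G S A \<psi> (a, g) (b, g \<otimes>\<^bsub>G\<^esub> \<psi> x)"
    by (subst ext_matrix_iff[OF assms(1) p(2) b(1) x]) (erule (2) const, use b in simp)
  moreover have "g \<otimes>\<^bsub>G\<^esub> \<psi> x \<in> carrier G"
    using assms(2,4) p(3) x(1) by (simp add: group.is_monoid monoid.m_closed)
  ultimately show "\<exists>q\<in>ext_states G S. ext_matrix G S A \<psi> p q"
    using b p(1) by (auto simp: ext_states_def)
qed

end

theory Submission
  imports Defs "HOL-Library.Omega_Words_Fun" "HOL-Real_Asymp.Real_Asymp"
begin

text \<open>
  The proof bounds the periodic points of the extension by \<open>\<ell>\<^sup>2\<close> norms on the group. Restrict to a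
  finite set \<open>B\<close> of symbols. The preimages of order \<open>n\<close> of a point \<open>x\<close> are the points \<open>wx\<close> with
  \<open>w\<close> a word of length \<open>n\<close>, and the weights \<open>\<Phi>\<^sub>n(wx)\<close> are collected in two ways: their sum
  \<open>Z\<^sub>n(x)\<close> (\<open>word_mass\<close>, the truncation of \<open>L\<^sup>n 1(x)\<close>) and the vector \<open>F\<^sub>n(x) = \<Sum> \<Phi>\<^sub>n(wx) \<delta>\<close>, with the
  point mass \<open>\<delta>\<close> at the product \<open>\<psi>(w)\<close> of the labels of \<open>w\<close> (\<open>group_mass\<close>). By bounded distortion
  and the b.i.p. property, \<open>Z\<^sub>n\<close> is up to a shift of \<open>n\<close> and a constant at most the sum over the
  periodic points of the shift in \<open>[a]\<close> (\<open>word_mass_le_periodic\<close>), while the sum over the periodic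
  points of the extension is at most a constant times \<open>F\<^sub>n(x)(id)\<close>, hence at most a constant times
  the \<open>\<ell>\<^sup>2\<close> norm of \<open>F\<^sub>n(x)\<close> (\<open>sum_periodic_le\<close>).

  Splitting words gives \<open>F\<^sub>n\<^sub>+\<^sub>m(x) = \<Sum> \<Phi>\<^sub>m(wx) F\<^sub>n(wx) * \<delta>\<close> over the words \<open>w\<close> of length \<open>m\<close>, again with
  the point mass at \<open>\<psi>(w)\<close>. Suppose that a finite set \<open>Y\<close> of group elements moves every vector by
  at least \<open>\<epsilon>\<close> times its norm. Group the words \<open>w = uv\<close> by a long prefix \<open>u\<close>. By distortion, the
  vector \<open>F\<^sub>n(uvx)\<close> depends on \<open>v\<close> only up to a factor close to one; and if each element of \<open>Y\<close>, and
  the identity, is the value of a loop at \<open>a\<close>, all loops having the same length, then the b.i.p.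
  property provides suffixes \<open>v\<close> through all these loops, from a finite list that does not depend
  on \<open>u\<close> and \<open>x\<close>. Two of the translates with the same prefix are then nearly a vector and its
  translate by some \<open>y\<close> that moves it, and the triangle inequality loses a fixed proportion
  (\<open>group_mass_contraction\<close>). By iteration the norm of \<open>F\<^sub>n(x)\<close> is at most \<open>(1 - \<delta>)\<close> to the power
  \<open>n div m\<close> times \<open>Z\<^sub>n(x)\<close>, with \<open>\<delta>\<close> and \<open>m\<close> independent of \<open>B\<close>. As the pressure of the shift is
  finite, the pressure of the extension would be strictly smaller. So equality of the pressures
  yields vectors that are almost invariant under all of \<open>Y\<close> (\<open>almost_invariant_vector\<close>).

  The common length of the loops matters since the extension may have a period: only elements of
  a subgroup are seen in this way. Let \<open>p\<close> be the length of a loop with value \<open>id\<close> and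
  \<open>t\<close> the value of a loop whose length is \<open>1\<close> modulo \<open>p\<close>. If \<open>g\<close> is the value of a loop of length
  \<open>q\<close>, then \<open>t\<^sup>i g\<close> and \<open>t\<^sup>j\<close> with \<open>j = (i + q) mod p\<close> become values of loops of one length after
  multiplication by a power of \<open>t\<close>. If \<open>\<xi>\<close> is almost invariant under the resulting products, the
  sum over \<open>i < p\<close> of the translates of \<open>\<xi>\<^sup>2\<close> by \<open>t\<^sup>i\<close> is an almost \<open>g\<close>-invariant function in \<open>\<ell>\<^sup>1\<close>
  (\<open>amenable_if_almost_invariant_loops\<close>). One of its level sets is a Foelner set
  (\<open>isoperimetric_functional\<close>), and Foelner sets can be enlarged to exhaust the group
  (\<open>amenable_if_foelner\<close>).
\<close>

section \<open>Finitely supported vectors and their right translates\<close>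

context group
begin

definition gsupp :: "('a \<Rightarrow> real) \<Rightarrow> 'a set" where
  "gsupp f = {g \<in> carrier G. f g \<noteq> 0}"

definition norm2 :: "('a \<Rightarrow> real) \<Rightarrow> real" where
  "norm2 f = L2_set f (gsupp f)"

text \<open>Right convolution with the point mass at \<open>s\<close>. Values off the carrier never matter: supports and
  norms only see the carrier.\<close>

definition translate :: "'a \<Rightarrow> ('a \<Rightarrow> real) \<Rightarrow> 'a \<Rightarrow> real" where
  "translate s f = (\<lambda>g. f (g \<otimes> inv s))"

lemma norm2_eq:
  assumes "finite A" "gsupp f \<subseteq> A" "A \<subseteq> carrier G"
  shows "norm2 f = L2_set f A"
proof -
  have "(\<Sum>g\<in>gsupp f. (f g)\<^sup>2) = (\<Sum>g\<in>A. (f g)\<^sup>2)"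
    using assms by (intro sum.mono_neutral_left) (auto simp: gsupp_def)
  then show ?thesis by (simp add: norm2_def L2_set_def)
qed

lemma norm2_nonneg [simp]: "norm2 f \<ge> 0"
  by (simp add: norm2_def L2_set_nonneg)

lemma gsupp_subset: "gsupp f \<subseteq> carrier G"
  by (auto simp: gsupp_def)

lemma gsupp_add: "gsupp (\<lambda>g. f g + h g) \<subseteq> gsupp f \<union> gsupp h"
  by (auto simp: gsupp_def)

lemma gsupp_diff: "gsupp (\<lambda>g. f g - h g) \<subseteq> gsupp f \<union> gsupp h"
  by (auto simp: gsupp_def)

lemma gsupp_scale: "gsupp (\<lambda>g. c * f g) \<subseteq> gsupp f"
  by (auto simp: gsupp_def)

lemma gsupp_sum: "gsupp (\<lambda>g. \<Sum>i\<in>I. f i g) \<subseteq> (\<Union>i\<in>I. gsupp (f i))"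
  by (auto simp: gsupp_def intro: sum.neutral)

lemma finite_gsupp_add: "finite (gsupp f) \<Longrightarrow> finite (gsupp h) \<Longrightarrow> finite (gsupp (\<lambda>g. f g + h g))"
  by (rule finite_subset[OF gsupp_add]) simp

lemma finite_gsupp_diff: "finite (gsupp f) \<Longrightarrow> finite (gsupp h) \<Longrightarrow> finite (gsupp (\<lambda>g. f g - h g))"
  by (rule finite_subset[OF gsupp_diff]) simp

lemma finite_gsupp_scale: "finite (gsupp f) \<Longrightarrow> finite (gsupp (\<lambda>g. c * f g))"
  by (rule finite_subset[OF gsupp_scale])

lemma finite_gsupp_sum:
  "finite I \<Longrightarrow> (\<And>i. i \<in> I \<Longrightarrow> finite (gsupp (f i))) \<Longrightarrow> finite (gsupp (\<lambda>g. \<Sum>i\<in>I. f i g))"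
  by (rule finite_subset[OF gsupp_sum]) blast

lemmas finite_gsupp = finite_gsupp_add finite_gsupp_diff finite_gsupp_scale finite_gsupp_sum

lemma gsupp_translate:
  assumes "s \<in> carrier G"
  shows "gsupp (translate s f) = (\<lambda>g. g \<otimes> s) ` gsupp f"
proof (intro equalityI subsetI)
  fix g assume g: "g \<in> gsupp (translate s f)"
  then have "g = (g \<otimes> inv s) \<otimes> s" using assms by (simp add: gsupp_def m_assoc)
  moreover have "g \<otimes> inv s \<in> gsupp f" using g assms by (simp add: gsupp_def translate_def)
  ultimately show "g \<in> (\<lambda>g. g \<otimes> s) ` gsupp f" by blast
next
  fix g assume "g \<in> (\<lambda>g. g \<otimes> s) ` gsupp f"
  then show "g \<in> gsupp (translate s f)" using assms by (auto simp: gsupp_def translate_def m_assoc)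
qed

lemma finite_gsupp_translate [simp]:
  "s \<in> carrier G \<Longrightarrow> finite (gsupp f) \<Longrightarrow> finite (gsupp (translate s f))"
  by (simp add: gsupp_translate)

lemma translate_translate:
  assumes "s \<in> carrier G" "t \<in> carrier G" "g \<in> carrier G"
  shows "translate s (translate t f) g = translate (t \<otimes> s) f g"
  using assms by (simp add: translate_def m_assoc inv_mult_group)

lemma translate_one: "g \<in> carrier G \<Longrightarrow> translate \<one> f g = f g"
  by (simp add: translate_def)

lemma sum_translate:
  assumes "s \<in> carrier G"
  shows "(\<Sum>g\<in>gsupp (translate s f). h (translate s f g)) = (\<Sum>g\<in>gsupp f. h (f g))"
proof -
  have inj: "inj_on (\<lambda>g. g \<otimes> s) (gsupp f)"
    using assms gsupp_subset by (auto intro!: inj_onI simp: gsupp_def)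
  have "(\<Sum>g\<in>gsupp (translate s f). h (translate s f g))
      = (\<Sum>g\<in>gsupp f. h (translate s f (g \<otimes> s)))"
    unfolding gsupp_translate[OF assms] by (subst sum.reindex[OF inj]) simp
  also have "\<dots> = (\<Sum>g\<in>gsupp f. h (f g))"
    by (rule sum.cong) (use assms in \<open>auto simp: translate_def gsupp_def m_assoc\<close>)
  finally show ?thesis .
qed

lemma norm2_translate [simp]: "s \<in> carrier G \<Longrightarrow> norm2 (translate s f) = norm2 f"
  unfolding norm2_def L2_set_def using sum_translate[of s "\<lambda>v. v\<^sup>2" f] by simp

lemma norm2_cong: "(\<And>g. g \<in> carrier G \<Longrightarrow> f g = h g) \<Longrightarrow> norm2 f = norm2 h"
  unfolding norm2_def gsupp_def by (intro L2_set_cong) (auto intro: Collect_cong)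

lemma norm2_add:
  assumes "finite (gsupp f)" "finite (gsupp h)"
  shows "norm2 (\<lambda>g. f g + h g) \<le> norm2 f + norm2 h"
proof -
  let ?A = "gsupp f \<union> gsupp h"
  have "norm2 (\<lambda>g. f g + h g) = L2_set (\<lambda>g. f g + h g) ?A"
    using assms gsupp_add by (intro norm2_eq) (auto simp: gsupp_def)
  moreover have "norm2 f = L2_set f ?A" "norm2 h = L2_set h ?A"
    using assms by (auto intro!: norm2_eq simp: gsupp_def)
  ultimately show ?thesis by (simp add: L2_set_triangle_ineq)
qed

lemma norm2_scale: "c \<ge> 0 \<Longrightarrow> norm2 (\<lambda>g. c * f g) = c * norm2 f"
proof (cases "c = 0")
  case True
  then show ?thesis by (simp add: norm2_def gsupp_def)
next
  case False
  assume "c \<ge> 0"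
  moreover have "gsupp (\<lambda>g. c * f g) = gsupp f" using False by (simp add: gsupp_def)
  ultimately show ?thesis by (simp add: norm2_def L2_set_right_distrib)
qed

lemma norm2_sum:
  assumes "finite I" "\<And>i. i \<in> I \<Longrightarrow> finite (gsupp (f i))"
  shows "norm2 (\<lambda>g. \<Sum>i\<in>I. f i g) \<le> (\<Sum>i\<in>I. norm2 (f i))"
  using assms
proof (induction I rule: finite_induct)
  case empty
  then show ?case by (simp add: norm2_def gsupp_def)
next
  case (insert i I)
  have "norm2 (\<lambda>g. \<Sum>i\<in>insert i I. f i g) = norm2 (\<lambda>g. f i g + (\<Sum>i\<in>I. f i g))"
    using insert by simp
  also have "\<dots> \<le> norm2 (f i) + norm2 (\<lambda>g. \<Sum>i\<in>I. f i g)"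
    using insert by (intro norm2_add) (auto intro!: finite_gsupp_sum)
  finally show ?case using insert by simp
qed

lemma norm2_mono:
  assumes "finite (gsupp h)" "\<And>g. g \<in> carrier G \<Longrightarrow> \<bar>f g\<bar> \<le> h g"
  shows "norm2 f \<le> norm2 h"
proof -
  have sub: "gsupp f \<subseteq> gsupp h" using assms(2) by (fastforce simp: gsupp_def)
  have "norm2 f = L2_set f (gsupp h)"
    using assms sub by (intro norm2_eq) (auto simp: gsupp_def)
  also have "\<dots> = L2_set (\<lambda>g. \<bar>f g\<bar>) (gsupp h)" by (simp add: L2_set_def)
  also have "\<dots> \<le> L2_set h (gsupp h)"
    by (intro L2_set_mono) (use assms in \<open>auto simp: gsupp_def\<close>)
  finally show ?thesis by (simp add: norm2_def)
qed

lemma abs_le_norm2: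
  assumes "finite (gsupp f)" "g \<in> carrier G"
  shows "\<bar>f g\<bar> \<le> norm2 f"
proof (cases "g \<in> gsupp f")
  case True
  have "\<bar>f g\<bar> \<le> L2_set (\<lambda>g. \<bar>f g\<bar>) (gsupp f)"
    using assms True by (intro member_le_L2_set) auto
  then show ?thesis by (simp add: norm2_def L2_set_def)
qed (use assms in \<open>auto simp: gsupp_def\<close>)

lemma norm2_power2:
  assumes "finite A" "gsupp f \<subseteq> A" "A \<subseteq> carrier G"
  shows "(norm2 f)\<^sup>2 = (\<Sum>g\<in>A. (f g)\<^sup>2)"
  using norm2_eq[OF assms] by (simp add: L2_set_def sum_nonneg)

lemma norm2_parallelogram:
  assumes "finite (gsupp f)" "finite (gsupp h)"
  shows "(norm2 (\<lambda>g. f g + h g))\<^sup>2 + (norm2 (\<lambda>g. f g - h g))\<^sup>2 = 2 * (norm2 f)\<^sup>2 + 2 * (norm2 h)\<^sup>2"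
proof -
  let ?A = "gsupp f \<union> gsupp h"
  have A: "finite ?A" "?A \<subseteq> carrier G" using assms gsupp_subset by auto
  have "(norm2 (\<lambda>g. f g + h g))\<^sup>2 = (\<Sum>g\<in>?A. (f g + h g)\<^sup>2)"
    "(norm2 (\<lambda>g. f g - h g))\<^sup>2 = (\<Sum>g\<in>?A. (f g - h g)\<^sup>2)"
    "(norm2 f)\<^sup>2 = (\<Sum>g\<in>?A. (f g)\<^sup>2)" "(norm2 h)\<^sup>2 = (\<Sum>g\<in>?A. (h g)\<^sup>2)"
    using A gsupp_add gsupp_diff by (simp_all add: norm2_power2)
  moreover have "(\<Sum>g\<in>?A. (f g + h g)\<^sup>2) + (\<Sum>g\<in>?A. (f g - h g)\<^sup>2)
      = 2 * (\<Sum>g\<in>?A. (f g)\<^sup>2) + 2 * (\<Sum>g\<in>?A. (h g)\<^sup>2)"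
    unfolding sum_distrib_left sum.distrib[symmetric]
    by (rule sum.cong) (auto simp: power2_sum power2_diff)
  ultimately show ?thesis by simp
qed

lemma norm2_minus_commute: "norm2 (\<lambda>g. f g - h g) = norm2 (\<lambda>g. h g - f g)"
proof -
  have "gsupp (\<lambda>g. f g - h g) = gsupp (\<lambda>g. h g - f g)" by (auto simp: gsupp_def)
  then show ?thesis unfolding norm2_def L2_set_def by (simp only: power2_commute)
qed

text \<open>If \<open>f0\<close> is moved by \<open>y\<close>, the parallelogram law makes the sum of \<open>f0\<close> and its translate strictly
  shorter than twice the norm of \<open>f0\<close>. The gap is quadratic in \<open>\<epsilon>\<close>, so it survives a
  perturbation of one summand of relative size \<open>\<epsilon>\<^sup>2 / 16\<close>.\<close>

lemma norm2_pair_gap: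
  assumes fin: "finite (gsupp f0)" "finite (gsupp f1)" and y: "y \<in> carrier G"
    and eps: "0 < \<epsilon>" "\<epsilon> \<le> 1" and \<theta>: "\<theta> \<le> \<epsilon>\<^sup>2 / 16"
    and near: "\<And>g. g \<in> carrier G \<Longrightarrow> \<bar>f1 g - f0 g\<bar> \<le> \<theta> * f0 g"
    and far: "norm2 (\<lambda>g. translate y f0 g - f0 g) \<ge> \<epsilon> * norm2 f0"
    and \<theta>0: "\<theta> \<ge> 0"
  shows "norm2 (\<lambda>g. f0 g + translate y f1 g) \<le> (1 - \<epsilon>\<^sup>2 / 16) * (norm2 f0 + norm2 f1)"
proof -
  let ?n = "norm2 f0"
  have e2: "\<epsilon>\<^sup>2 \<le> 1" using eps by (simp add: power_le_one)
  have diff: "norm2 (\<lambda>g. f1 g - f0 g) \<le> \<theta> * ?n"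
  proof -
    have "norm2 (\<lambda>g. f1 g - f0 g) \<le> norm2 (\<lambda>g. \<theta> * f0 g)"
      by (rule norm2_mono) (use fin near in \<open>auto intro: finite_gsupp\<close>)
    then show ?thesis using \<theta>0 by (simp add: norm2_scale)
  qed
  have "(norm2 (\<lambda>g. translate y f0 g + f0 g))\<^sup>2 + (\<epsilon> * ?n)\<^sup>2
      \<le> (norm2 (\<lambda>g. translate y f0 g + f0 g))\<^sup>2 + (norm2 (\<lambda>g. translate y f0 g - f0 g))\<^sup>2"
    using far eps by (intro add_left_mono power_mono) auto
  also have "\<dots> = 4 * ?n\<^sup>2"
    using norm2_parallelogram[of "translate y f0" f0] fin y by simp
  finally have "(norm2 (\<lambda>g. translate y f0 g + f0 g))\<^sup>2 \<le> (4 - \<epsilon>\<^sup>2) * ?n\<^sup>2"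
    by (simp add: power_mult_distrib algebra_simps)
  also have "\<dots> \<le> ((2 - \<epsilon>\<^sup>2 / 4) * ?n)\<^sup>2"
  proof -
    have "4 - \<epsilon>\<^sup>2 \<le> (2 - \<epsilon>\<^sup>2 / 4)\<^sup>2" by (simp add: power2_diff)
    then show ?thesis unfolding power_mult_distrib by (rule mult_right_mono) simp
  qed
  finally have sumf: "norm2 (\<lambda>g. translate y f0 g + f0 g) \<le> (2 - \<epsilon>\<^sup>2 / 4) * ?n"
    by (rule power2_le_imp_le) (use e2 in auto)
  have "norm2 (\<lambda>g. f0 g + translate y f1 g)
      = norm2 (\<lambda>g. (translate y f0 g + f0 g) + translate y (\<lambda>g. f1 g - f0 g) g)"
    by (rule norm2_cong) (simp add: translate_def)
  also have "\<dots> \<le> norm2 (\<lambda>g. translate y f0 g + f0 g) + norm2 (translate y (\<lambda>g. f1 g - f0 g))"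
    by (rule norm2_add) (use fin y in \<open>auto intro!: finite_gsupp finite_gsupp_translate\<close>)
  also have "\<dots> \<le> (2 - \<epsilon>\<^sup>2 / 4) * ?n + \<theta> * ?n"
    using sumf diff y by simp
  also have "\<dots> = (2 - \<epsilon>\<^sup>2 / 4 + \<theta>) * ?n" by (simp add: algebra_simps)
  finally have 1: "norm2 (\<lambda>g. f0 g + translate y f1 g) \<le> (2 - \<epsilon>\<^sup>2 / 4 + \<theta>) * ?n" .
  have "?n \<le> norm2 f1 + norm2 (\<lambda>g. f1 g - f0 g)"
  proof -
    have "?n = norm2 (\<lambda>g. f1 g + (-1) * (f1 g - f0 g))" by simp
    also have "\<dots> \<le> norm2 f1 + norm2 (\<lambda>g. (-1) * (f1 g - f0 g))"
      by (rule norm2_add) (use fin in \<open>auto intro!: finite_gsupp finite_gsupp_scale simp del: mult_minus1\<close>)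
    also have "norm2 (\<lambda>g. (-1) * (f1 g - f0 g)) = norm2 (\<lambda>g. f1 g - f0 g)"
      using norm2_minus_commute[of f0 f1] by simp
    finally show ?thesis .
  qed
  then have n1: "norm2 f1 \<ge> (1 - \<theta>) * ?n" using diff by (simp add: algebra_simps)
  have "(2 - \<epsilon>\<^sup>2 / 4 + \<theta>) * ?n \<le> (1 - \<epsilon>\<^sup>2 / 16) * ((2 - \<theta>) * ?n)"
  proof -
    have "0 \<le> \<epsilon>\<^sup>2 * \<theta>" using \<theta>0 by simp
    moreover have "(1 - \<epsilon>\<^sup>2 / 16) * (2 - \<theta>) = 2 - \<theta> - \<epsilon>\<^sup>2 / 8 + \<epsilon>\<^sup>2 * \<theta> / 16"
      by (simp add: field_simps)
    ultimately have "2 - \<epsilon>\<^sup>2 / 4 + \<theta> \<le> (1 - \<epsilon>\<^sup>2 / 16) * (2 - \<theta>)" using \<theta> by linarith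
    then show ?thesis unfolding mult.assoc[symmetric] by (rule mult_right_mono) simp
  qed
  also have "\<dots> \<le> (1 - \<epsilon>\<^sup>2 / 16) * (norm2 f0 + norm2 f1)"
    using n1 e2 by (intro mult_left_mono) (auto simp: algebra_simps)
  finally show ?thesis using 1 by linarith
qed

text \<open>One pair of vectors with a gap in the triangle inequality shortens a whole weighted sum, provided
  that the pair carries a proportion \<open>\<kappa>\<close> of the weight and no vector is much longer than the first
  of the pair. The smaller of the two weights is split off and the gap applied to it.\<close>

lemma norm2_sum_gap:
  assumes R: "finite R" "w0 \<in> R" "w1 \<in> R" "w0 \<noteq> w1"
    and fin: "\<And>w. w \<in> R \<Longrightarrow> finite (gsupp (\<xi> w))"
    and c: "\<And>w. w \<in> R \<Longrightarrow> c w \<ge> 0"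
    and gap: "norm2 (\<lambda>g. \<xi> w0 g + \<xi> w1 g) \<le> (1 - \<gamma>) * (norm2 (\<xi> w0) + norm2 (\<xi> w1))"
    and \<gamma>: "\<gamma> \<ge> 0"
    and \<kappa>: "\<kappa> \<ge> 0" "c w0 \<ge> \<kappa> * (\<Sum>w\<in>R. c w)" "c w1 \<ge> \<kappa> * (\<Sum>w\<in>R. c w)"
    and K: "K > 0" "\<And>w. w \<in> R \<Longrightarrow> norm2 (\<xi> w) \<le> K * norm2 (\<xi> w0)"
  shows "norm2 (\<lambda>g. \<Sum>w\<in>R. c w * \<xi> w g) \<le> (1 - \<kappa> * \<gamma> / K) * (\<Sum>w\<in>R. c w * norm2 (\<xi> w))"
proof -
  define d where "d = min (c w0) (c w1)"
  define R' where "R' = R - {w0, w1}"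
  have split: "(\<Sum>w\<in>R. h w) = h w0 + h w1 + (\<Sum>w\<in>R'. h w)" for h :: "_ \<Rightarrow> real"
    unfolding R'_def using R by (simp add: sum.remove[of R w0] sum.remove[of "R - {w0}" w1] Diff_insert2[symmetric] algebra_simps)
  have d: "0 \<le> d" "d \<le> c w0" "d \<le> c w1" "d \<ge> \<kappa> * (\<Sum>w\<in>R. c w)"
    using c R \<kappa> by (auto simp: d_def)
  let ?f = "\<lambda>g. d * (\<xi> w0 g + \<xi> w1 g)" and ?a = "\<lambda>g. (c w0 - d) * \<xi> w0 g"
    and ?b = "\<lambda>g. (c w1 - d) * \<xi> w1 g" and ?r = "\<lambda>g. \<Sum>w\<in>R'. c w * \<xi> w g"
  have finR': "finite R'" "R' \<subseteq> R" using R by (auto simp: R'_def)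
  have fins: "finite (gsupp ?f)" "finite (gsupp ?a)" "finite (gsupp ?b)" "finite (gsupp ?r)"
    using fin R finR' by (auto intro!: finite_gsupp)
  have "norm2 (\<lambda>g. \<Sum>w\<in>R. c w * \<xi> w g) = norm2 (\<lambda>g. (?f g + ?a g) + (?b g + ?r g))"
    by (rule norm2_cong) (simp add: split algebra_simps)
  also have "\<dots> \<le> norm2 (\<lambda>g. ?f g + ?a g) + norm2 (\<lambda>g. ?b g + ?r g)"
    by (rule norm2_add) (use fins in \<open>auto intro: finite_gsupp_add\<close>)
  also have "\<dots> \<le> (norm2 ?f + norm2 ?a) + (norm2 ?b + norm2 ?r)"
    using fins by (intro add_mono norm2_add)
  also have "norm2 ?f = d * norm2 (\<lambda>g. \<xi> w0 g + \<xi> w1 g)" using d by (simp add: norm2_scale)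
  also have "norm2 ?a = (c w0 - d) * norm2 (\<xi> w0)" using d by (simp add: norm2_scale)
  also have "norm2 ?b = (c w1 - d) * norm2 (\<xi> w1)" using d by (simp add: norm2_scale)
  also have "norm2 ?r \<le> (\<Sum>w\<in>R'. norm2 (\<lambda>g. c w * \<xi> w g))"
    using finR' fin by (intro norm2_sum) (auto intro!: finite_gsupp)
  also have "\<dots> = (\<Sum>w\<in>R'. c w * norm2 (\<xi> w))"
    using finR' c by (intro sum.cong) (auto simp: norm2_scale)
  finally have "norm2 (\<lambda>g. \<Sum>w\<in>R. c w * \<xi> w g) \<le> d * norm2 (\<lambda>g. \<xi> w0 g + \<xi> w1 g)
      + (c w0 - d) * norm2 (\<xi> w0) + ((c w1 - d) * norm2 (\<xi> w1) + (\<Sum>w\<in>R'. c w * norm2 (\<xi> w)))"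
    by simp
  also have "\<dots> \<le> d * ((1 - \<gamma>) * (norm2 (\<xi> w0) + norm2 (\<xi> w1)))
      + (c w0 - d) * norm2 (\<xi> w0) + ((c w1 - d) * norm2 (\<xi> w1) + (\<Sum>w\<in>R'. c w * norm2 (\<xi> w)))"
    using mult_left_mono[OF gap d(1)] by simp
  also have "\<dots> = (\<Sum>w\<in>R. c w * norm2 (\<xi> w)) - \<gamma> * (d * (norm2 (\<xi> w0) + norm2 (\<xi> w1)))"
    by (simp add: split algebra_simps)
  also have "\<dots> \<le> (\<Sum>w\<in>R. c w * norm2 (\<xi> w)) - \<gamma> * (\<kappa> * (\<Sum>w\<in>R. c w) * norm2 (\<xi> w0))"
    using \<gamma> d \<kappa> c by (intro diff_left_mono mult_left_mono mult_mono) (auto intro!: sum_nonneg)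
  also have "\<dots> \<le> (\<Sum>w\<in>R. c w * norm2 (\<xi> w)) - \<gamma> * (\<kappa> * ((\<Sum>w\<in>R. c w * norm2 (\<xi> w)) / K))"
  proof -
    have "(\<Sum>w\<in>R. c w * norm2 (\<xi> w)) \<le> (\<Sum>w\<in>R. c w * (K * norm2 (\<xi> w0)))"
      using c K by (intro sum_mono mult_left_mono) auto
    also have "\<dots> = (\<Sum>w\<in>R. c w) * norm2 (\<xi> w0) * K" by (simp add: sum_distrib_right sum_distrib_left mult_ac)
    finally have "(\<Sum>w\<in>R. c w * norm2 (\<xi> w)) / K \<le> (\<Sum>w\<in>R. c w) * norm2 (\<xi> w0)"
      using K by (simp add: divide_simps)
    then show ?thesis using \<gamma> \<kappa>(1) unfolding mult.assoc by (intro diff_left_mono mult_left_mono)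
  qed
  also have "\<dots> = (1 - \<kappa> * \<gamma> / K) * (\<Sum>w\<in>R. c w * norm2 (\<xi> w))" by (simp add: algebra_simps)
  finally show ?thesis .
qed

section \<open>Foelner sets from almost invariant vectors\<close>

definition norm1 :: "('a \<Rightarrow> real) \<Rightarrow> real" where
  "norm1 f = (\<Sum>g\<in>gsupp f. \<bar>f g\<bar>)"

lemma norm1_eq:
  assumes "finite A" "gsupp f \<subseteq> A" "A \<subseteq> carrier G"
  shows "norm1 f = (\<Sum>g\<in>A. \<bar>f g\<bar>)"
  unfolding norm1_def using assms by (intro sum.mono_neutral_left) (auto simp: gsupp_def)

lemma norm1_nonneg: "norm1 f \<ge> 0"
  by (simp add: norm1_def sum_nonneg)

lemma norm1_cong: "(\<And>g. g \<in> carrier G \<Longrightarrow> f g = h g) \<Longrightarrow> norm1 f = norm1 h"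
  unfolding norm1_def gsupp_def by (intro sum.cong) auto

lemma norm1_translate: "s \<in> carrier G \<Longrightarrow> norm1 (translate s f) = norm1 f"
  unfolding norm1_def using sum_translate[of s abs f] by simp

lemma norm1_minus_commute: "norm1 (\<lambda>g. f g - h g) = norm1 (\<lambda>g. h g - f g)"
proof -
  have "gsupp (\<lambda>g. f g - h g) = gsupp (\<lambda>g. h g - f g)" by (auto simp: gsupp_def)
  then show ?thesis unfolding norm1_def by (simp only: abs_minus_commute)
qed

lemma norm1_add:
  assumes "finite (gsupp f)" "finite (gsupp h)"
  shows "norm1 (\<lambda>g. f g + h g) \<le> norm1 f + norm1 h"
proof -
  let ?A = "gsupp f \<union> gsupp h"
  have A: "finite ?A" "?A \<subseteq> carrier G" using assms gsupp_subset by auto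
  have "norm1 (\<lambda>g. f g + h g) = (\<Sum>g\<in>?A. \<bar>f g + h g\<bar>)"
    "norm1 f = (\<Sum>g\<in>?A. \<bar>f g\<bar>)" "norm1 h = (\<Sum>g\<in>?A. \<bar>h g\<bar>)"
    using A gsupp_add by (auto intro!: norm1_eq)
  then show ?thesis
    unfolding sum.distrib[symmetric] by (auto intro!: sum_mono simp flip: sum.distrib)
qed

lemma norm1_sum:
  assumes "finite I" "\<And>i. i \<in> I \<Longrightarrow> finite (gsupp (f i))"
  shows "norm1 (\<lambda>g. \<Sum>i\<in>I. f i g) \<le> (\<Sum>i\<in>I. norm1 (f i))"
  using assms
proof (induction I rule: finite_induct)
  case empty
  then show ?case by (simp add: norm1_def gsupp_def)
next
  case (insert i I)
  have "norm1 (\<lambda>g. \<Sum>i\<in>insert i I. f i g) = norm1 (\<lambda>g. f i g + (\<Sum>i\<in>I. f i g))"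
    using insert by simp
  also have "\<dots> \<le> norm1 (f i) + norm1 (\<lambda>g. \<Sum>i\<in>I. f i g)"
    using insert by (intro norm1_add) (auto intro!: finite_gsupp_sum)
  finally show ?case using insert by simp
qed

lemma norm1_sum_eq:
  assumes "finite I" "\<And>i. i \<in> I \<Longrightarrow> finite (gsupp (f i))"
    and nn: "\<And>i g. i \<in> I \<Longrightarrow> g \<in> carrier G \<Longrightarrow> f i g \<ge> 0"
  shows "norm1 (\<lambda>g. \<Sum>i\<in>I. f i g) = (\<Sum>i\<in>I. norm1 (f i))"
proof -
  let ?A = "\<Union>i\<in>I. gsupp (f i)"
  have A: "finite ?A" "?A \<subseteq> carrier G" using assms(1,2) by (auto simp: gsupp_def)
  have "norm1 (\<lambda>g. \<Sum>i\<in>I. f i g) = (\<Sum>g\<in>?A. \<bar>\<Sum>i\<in>I. f i g\<bar>)"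
    by (rule norm1_eq[OF A(1) gsupp_sum A(2)])
  also have "\<dots> = (\<Sum>g\<in>?A. \<Sum>i\<in>I. \<bar>f i g\<bar>)"
  proof (rule sum.cong[OF refl])
    fix g assume "g \<in> ?A"
    then have "g \<in> carrier G" using A by blast
    then show "\<bar>\<Sum>i\<in>I. f i g\<bar> = (\<Sum>i\<in>I. \<bar>f i g\<bar>)"
      using nn by (simp add: sum_nonneg)
  qed
  also have "\<dots> = (\<Sum>i\<in>I. \<Sum>g\<in>?A. \<bar>f i g\<bar>)" by (rule sum.swap)
  also have "\<dots> = (\<Sum>i\<in>I. norm1 (f i))"
    using A by (intro sum.cong refl norm1_eq[symmetric]) auto
  finally show ?thesis .
qed

lemma norm1_square: "norm1 (\<lambda>g. (f g)\<^sup>2) = (norm2 f)\<^sup>2"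
proof -
  have "gsupp (\<lambda>g. (f g)\<^sup>2) = gsupp f" by (auto simp: gsupp_def)
  then show ?thesis by (simp add: norm1_def norm2_def L2_set_def sum_nonneg)
qed

text \<open>The step from \<open>\<ell>\<^sup>2\<close> to \<open>\<ell>\<^sup>1\<close>: factor a difference of squares and apply the Cauchy-Schwarz
  inequality.\<close>

lemma norm1_square_translate_diff:
  assumes fin: "finite (gsupp f)" and y: "y \<in> carrier G"
    and le: "norm2 (\<lambda>g. translate y f g - f g) \<le> \<epsilon> * norm2 f"
  shows "norm1 (\<lambda>g. translate y (\<lambda>g. (f g)\<^sup>2) g - (f g)\<^sup>2) \<le> 2 * \<epsilon> * norm1 (\<lambda>g. (f g)\<^sup>2)"
proof -
  let ?t = "translate y f"
  let ?A = "gsupp f \<union> gsupp ?t"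
  have A: "finite ?A" "?A \<subseteq> carrier G" using assms gsupp_subset by auto
  have "norm1 (\<lambda>g. translate y (\<lambda>g. (f g)\<^sup>2) g - (f g)\<^sup>2) = (\<Sum>g\<in>?A. \<bar>(?t g)\<^sup>2 - (f g)\<^sup>2\<bar>)"
    unfolding translate_def by (subst norm1_eq[of ?A]) (use A in \<open>auto simp: gsupp_def translate_def\<close>)
  also have "\<dots> = (\<Sum>g\<in>?A. \<bar>?t g - f g\<bar> * \<bar>?t g + f g\<bar>)"
    by (intro sum.cong) (auto simp: abs_mult[symmetric] power2_eq_square algebra_simps)
  also have "\<dots> \<le> L2_set (\<lambda>g. ?t g - f g) ?A * L2_set (\<lambda>g. ?t g + f g) ?A"
    by (rule L2_set_mult_ineq)
  also have "\<dots> = norm2 (\<lambda>g. ?t g - f g) * norm2 (\<lambda>g. ?t g + f g)"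
  proof -
    have "norm2 (\<lambda>g. ?t g - f g) = L2_set (\<lambda>g. ?t g - f g) ?A"
      using A gsupp_diff[of ?t f] by (intro norm2_eq) auto
    moreover have "norm2 (\<lambda>g. ?t g + f g) = L2_set (\<lambda>g. ?t g + f g) ?A"
      using A gsupp_add[of ?t f] by (intro norm2_eq) auto
    ultimately show ?thesis by simp
  qed
  also have "\<dots> \<le> (\<epsilon> * norm2 f) * (2 * norm2 f)"
  proof (rule mult_mono)
    show "norm2 (\<lambda>g. ?t g + f g) \<le> 2 * norm2 f"
      using norm2_add[of ?t f] fin y by simp
    show "0 \<le> \<epsilon> * norm2 f" using le norm2_nonneg order_trans by blast
  qed (use le in auto)
  also have "\<dots> = 2 * \<epsilon> * norm1 (\<lambda>g. (f g)\<^sup>2)"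
    unfolding norm1_square by (simp add: power2_eq_square)
  finally show ?thesis .
qed

text \<open>Translation by \<open>g\<close> permutes the summands of \<open>\<eta>\<close> up to small errors. In the application \<open>x i\<close>
  is the value of a loop whose length has residue \<open>i\<close>, and \<open>\<sigma>\<close> is the action of \<open>g\<close> on residues.\<close>

lemma norm1_sum_translates_diff:
  fixes x :: "nat \<Rightarrow> 'a"
  assumes fin: "finite (gsupp f)" and x: "\<And>i. i < p \<Longrightarrow> x i \<in> carrier G" and g: "g \<in> carrier G"
    and \<sigma>: "bij_betw \<sigma> {..<p} {..<p}"
    and le: "\<And>i. i < p \<Longrightarrow>
      norm1 (\<lambda>h. translate (x i \<otimes> g) f h - translate (x (\<sigma> i)) f h) \<le> \<delta>"
  defines "\<eta> \<equiv> (\<lambda>h. \<Sum>i<p. translate (x i) f h)"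
  shows "norm1 (\<lambda>h. translate g \<eta> h - \<eta> h) \<le> real p * \<delta>"
proof -
  have \<sigma>': "\<sigma> i < p" if "i < p" for i
    using bij_betwE[OF \<sigma>] that by auto
  have "norm1 (\<lambda>h. translate g \<eta> h - \<eta> h)
      = norm1 (\<lambda>h. \<Sum>i<p. translate (x i \<otimes> g) f h - translate (x (\<sigma> i)) f h)"
  proof (rule norm1_cong)
    fix h assume h: "h \<in> carrier G"
    have "translate g \<eta> h = (\<Sum>i<p. translate g (translate (x i) f) h)"
      by (simp add: \<eta>_def translate_def)
    also have "\<dots> = (\<Sum>i<p. translate (x i \<otimes> g) f h)"
      using x g h by (intro sum.cong) (auto simp: translate_translate)
    finally have "translate g \<eta> h = (\<Sum>i<p. translate (x i \<otimes> g) f h)" .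
    moreover have "\<eta> h = (\<Sum>i<p. translate (x (\<sigma> i)) f h)"
      unfolding \<eta>_def by (rule sum.reindex_bij_betw[OF \<sigma>, symmetric])
    ultimately show "translate g \<eta> h - \<eta> h
        = (\<Sum>i<p. translate (x i \<otimes> g) f h - translate (x (\<sigma> i)) f h)"
      by (simp add: sum_subtractf)
  qed
  also have "\<dots> \<le> (\<Sum>i<p. norm1 (\<lambda>h. translate (x i \<otimes> g) f h - translate (x (\<sigma> i)) f h))"
    by (intro norm1_sum) (use fin x g \<sigma>' in \<open>auto intro!: finite_gsupp_diff finite_gsupp_translate\<close>)
  also have "\<dots> \<le> (\<Sum>i<p. \<delta>)" using le by (intro sum_mono) auto
  finally show ?thesis by simp
qed

text \<open>A linear isoperimetric inequality for finite sets extends to nonnegative functions, which are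
  positive combinations of indicators of their level sets. Subtracting the minimum over the support
  peels off the largest level set \<open>K\<close>. Both sides of the inequality are additive in this step: the
  difference of two values changes, and then by the subtracted constant, exactly if one of the two
  points lies in \<open>K\<close> and the other does not.\<close>

lemma isoperimetric_functional:
  fixes \<epsilon> :: real
  assumes E: "finite E" "E \<subseteq> carrier G"
    and iso: "\<And>K. finite K \<Longrightarrow> K \<noteq> {} \<Longrightarrow> K \<subseteq> carrier G \<Longrightarrow>
      \<epsilon> * card K \<le> (\<Sum>s\<in>E. real (card (sym_diff ((\<lambda>g. g \<otimes> s) ` K) K)))"
    and "finite (gsupp f)" "\<And>g. g \<in> carrier G \<Longrightarrow> f g \<ge> 0"
  shows "\<epsilon> * norm1 f \<le> (\<Sum>s\<in>E. norm1 (\<lambda>g. translate s f g - f g))"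
  using assms(4,5)
proof (induction "card (gsupp f)" arbitrary: f rule: less_induct)
  case less
  let ?K = "gsupp f"
  show ?case
  proof (cases "?K = {}")
    case True
    then show ?thesis by (simp add: norm1_def sum_nonneg)
  next
    case False
    have K: "finite ?K" "?K \<subseteq> carrier G" using less gsupp_subset by auto
    define c where "c = Min (f ` ?K)"
    have "c \<in> f ` ?K" unfolding c_def using K False by (intro Min_in) auto
    then obtain k where k: "k \<in> ?K" "f k = c" by auto
    have c_le: "c \<le> f g" if "g \<in> ?K" for g unfolding c_def using K that by simp
    have c0: "c > 0" using k less(3)[of k] by (auto simp: gsupp_def)
    define f' where "f' = (\<lambda>g. if g \<in> ?K then f g - c else 0)"
    have sub: "gsupp f' \<subset> ?K"
    proof
      show "gsupp f' \<subseteq> ?K" by (auto simp: gsupp_def f'_def)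
      show "gsupp f' \<noteq> ?K" using k by (auto simp: gsupp_def f'_def)
    qed
    have fin': "finite (gsupp f')" using sub K finite_subset by blast
    have IH: "\<epsilon> * norm1 f' \<le> (\<Sum>s\<in>E. norm1 (\<lambda>g. translate s f' g - f' g))"
      using K sub fin' c_le by (intro less(1)) (auto simp: psubset_card_mono f'_def)
    have n: "norm1 f = norm1 f' + c * card ?K"
    proof -
      have "norm1 f' = (\<Sum>g\<in>?K. \<bar>f' g\<bar>)" using K sub by (intro norm1_eq) auto
      also have "\<dots> = (\<Sum>g\<in>?K. \<bar>f g\<bar> - c)"
        using c_le c0 by (intro sum.cong) (auto simp: f'_def abs_if dest: c_le)
      finally show ?thesis by (simp add: norm1_def sum_subtractf)
    qed
    have nt: "norm1 (\<lambda>g. translate s f g - f g)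
        = norm1 (\<lambda>g. translate s f' g - f' g) + c * card (sym_diff ((\<lambda>g. g \<otimes> s) ` ?K) ?K)"
      if s: "s \<in> E" for s
    proof -
      have sc: "s \<in> carrier G" using E s by blast
      let ?Ks = "(\<lambda>g. g \<otimes> s) ` ?K"
      have Ks: "?Ks = gsupp (translate s f)" using gsupp_translate[OF sc] by simp
      let ?A = "?K \<union> ?Ks"
      have A: "finite ?A" "?A \<subseteq> carrier G" using K sc by auto
      have memKs: "g \<in> ?Ks \<longleftrightarrow> g \<otimes> inv s \<in> ?K" if "g \<in> carrier G" for g
        unfolding Ks using that sc by (auto simp: gsupp_def translate_def)
      have zero: "f g = 0" if "g \<in> carrier G" "g \<notin> ?K" for g using that by (auto simp: gsupp_def)
      have pt: "\<bar>translate s f g - f g\<bar>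
          = \<bar>translate s f' g - f' g\<bar> + c * of_bool (g \<in> sym_diff ?Ks ?K)" if "g \<in> ?A" for g
      proof -
        have gc: "g \<in> carrier G" using A that by blast
        have gs: "g \<otimes> inv s \<in> carrier G" using gc sc by simp
        note m = memKs[OF gc]
        consider "g \<in> ?K" "g \<in> ?Ks" | "g \<in> ?K" "g \<notin> ?Ks" | "g \<notin> ?K" "g \<in> ?Ks" using \<open>g \<in> ?A\<close> by blast
        then show ?thesis
        proof cases
          case 1
          then show ?thesis using m by (simp add: f'_def translate_def)
        next
          case 2
          then have "f (g \<otimes> inv s) = 0" "f g \<ge> c" using m zero[OF gs] c_le by auto
          then show ?thesis using 2 m c0 by (simp add: f'_def translate_def)
        next
          case 3
          then have "f g = 0" "f (g \<otimes> inv s) \<ge> c" using m zero[OF gc] c_le by auto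
          then show ?thesis using 3 m c0 by (simp add: f'_def translate_def)
        qed
      qed
      have "norm1 (\<lambda>g. translate s f g - f g) = (\<Sum>g\<in>?A. \<bar>translate s f g - f g\<bar>)"
        using A Ks gsupp_diff[of "translate s f" f] by (intro norm1_eq) auto
      also have "\<dots> = (\<Sum>g\<in>?A. \<bar>translate s f' g - f' g\<bar>) + (\<Sum>g\<in>?A. c * of_bool (g \<in> sym_diff ?Ks ?K))"
        unfolding sum.distrib[symmetric] by (rule sum.cong[OF refl pt])
      also have "(\<Sum>g\<in>?A. \<bar>translate s f' g - f' g\<bar>) = norm1 (\<lambda>g. translate s f' g - f' g)"
      proof (rule norm1_eq[symmetric])
        have "gsupp (translate s f') \<subseteq> ?Ks" unfolding gsupp_translate[OF sc] using sub by blast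
        then show "gsupp (\<lambda>g. translate s f' g - f' g) \<subseteq> ?A"
          using gsupp_diff[of "translate s f'" f'] sub by blast
      qed (use A in auto)
      also have "(\<Sum>g\<in>?A. c * of_bool (g \<in> sym_diff ?Ks ?K)) = c * card (sym_diff ?Ks ?K)"
      proof -
        have "(\<Sum>g\<in>?A. c * of_bool (g \<in> sym_diff ?Ks ?K)) = (\<Sum>g\<in>?A \<inter> sym_diff ?Ks ?K. c)"
          by (subst sum.inter_restrict[OF A(1)]) (auto intro!: sum.cong)
        also have "?A \<inter> sym_diff ?Ks ?K = sym_diff ?Ks ?K" by blast
        finally show ?thesis by simp
      qed
      finally show ?thesis .
    qed
    have "\<epsilon> * norm1 f = \<epsilon> * norm1 f' + c * (\<epsilon> * card ?K)" by (simp add: n algebra_simps)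
    also have "\<dots> \<le> (\<Sum>s\<in>E. norm1 (\<lambda>g. translate s f' g - f' g))
        + c * (\<Sum>s\<in>E. real (card (sym_diff ((\<lambda>g. g \<otimes> s) ` ?K) ?K)))"
      using IH iso[OF K(1) False K(2)] c0 by (intro add_mono mult_left_mono) auto
    also have "\<dots> = (\<Sum>s\<in>E. norm1 (\<lambda>g. translate s f g - f g))"
      using nt by (simp add: sum.distrib sum_distrib_left)
    finally show ?thesis .
  qed
qed

lemma right_foelner_set:
  fixes \<epsilon> :: real
  assumes E: "finite E" "E \<subseteq> carrier G" and \<epsilon>: "\<epsilon> > 0"
    and f: "finite (gsupp f)" "\<And>g. g \<in> carrier G \<Longrightarrow> f g \<ge> 0" "norm1 f > 0"
    and inv: "\<And>s. s \<in> E \<Longrightarrow> norm1 (\<lambda>g. translate s f g - f g) \<le> \<epsilon> / (card E + 1) * norm1 f"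
  obtains K where "finite K" "K \<noteq> {}" "K \<subseteq> carrier G"
    "\<And>s. s \<in> E \<Longrightarrow> real (card (sym_diff ((\<lambda>g. g \<otimes> s) ` K) K)) \<le> \<epsilon> * card K"
proof -
  have "\<exists>K. finite K \<and> K \<noteq> {} \<and> K \<subseteq> carrier G \<and>
      (\<Sum>s\<in>E. real (card (sym_diff ((\<lambda>g. g \<otimes> s) ` K) K))) < \<epsilon> * card K"
  proof (rule ccontr)
    assume "\<not> ?thesis"
    then have iso: "\<epsilon> * card K \<le> (\<Sum>s\<in>E. real (card (sym_diff ((\<lambda>g. g \<otimes> s) ` K) K)))"
      if "finite K" "K \<noteq> {}" "K \<subseteq> carrier G" for K
      using that by (meson not_le)
    have "\<epsilon> * norm1 f \<le> (\<Sum>s\<in>E. norm1 (\<lambda>g. translate s f g - f g))"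
      by (rule isoperimetric_functional[OF E iso f(1,2)])
    also have "\<dots> \<le> (\<Sum>s\<in>E. \<epsilon> / (card E + 1) * norm1 f)" by (rule sum_mono[OF inv])
    also have "\<dots> = (card E / (card E + 1)) * (\<epsilon> * norm1 f)" by simp
    also have "\<dots> < 1 * (\<epsilon> * norm1 f)"
      using \<epsilon> f by (intro mult_strict_right_mono) auto
    finally show False by simp
  qed
  then obtain K where K: "finite K" "K \<noteq> {}" "K \<subseteq> carrier G"
      "(\<Sum>s\<in>E. real (card (sym_diff ((\<lambda>g. g \<otimes> s) ` K) K))) < \<epsilon> * card K" by blast
  have "real (card (sym_diff ((\<lambda>g. g \<otimes> s) ` K) K)) \<le> \<epsilon> * card K" if "s \<in> E" for s
    using member_le_sum[OF that, of "\<lambda>s. real (card (sym_diff ((\<lambda>g. g \<otimes> s) ` K) K))"] E K(4) by auto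
  with K that show ?thesis by blast
qed

text \<open>Inversion exchanges right and left translates. To exhaust the group, add the first \<open>n + 1\<close> elements
  of an enumeration to a Foelner set with at least \<open>(n + 1)\<^sup>2\<close> points, which is large enough
  to make this negligible.\<close>

lemma amenable_if_foelner:
  assumes count: "countable (carrier G)"
    and fol: "\<And>E (\<epsilon>::real). finite E \<Longrightarrow> E \<subseteq> carrier G \<Longrightarrow> \<epsilon> > 0 \<Longrightarrow>
      \<exists>K. finite K \<and> K \<noteq> {} \<and> K \<subseteq> carrier G \<and>
        (\<forall>s\<in>E. real (card (sym_diff ((\<lambda>g. g \<otimes> s) ` K) K)) \<le> \<epsilon> * card K)"
  shows "amenable G"
proof (cases "finite (carrier G)")
  case True
  have "g <#\<^bsub>G\<^esub> carrier G = carrier G" if "g \<in> carrier G" for g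
    using that subgroup_self by (metis coset_join3)
  with True show ?thesis
    unfolding amenable_def by (intro exI[of _ "\<lambda>_. carrier G"]) auto
next
  case False
  have left: "\<exists>K. finite K \<and> K \<noteq> {} \<and> K \<subseteq> carrier G \<and>
        (\<forall>s\<in>E. real (card (sym_diff (s <#\<^bsub>G\<^esub> K) K)) \<le> \<epsilon> * real (card K))"
    if E: "finite E" "E \<subseteq> carrier G" "\<epsilon> > 0" for E and \<epsilon> :: real
  proof -
    obtain K where K: "finite K" "K \<noteq> {}" "K \<subseteq> carrier G"
        "\<forall>s\<in>m_inv G ` E. real (card (sym_diff ((\<lambda>g. g \<otimes> s) ` K) K)) \<le> \<epsilon> * card K"
      using fol[of "m_inv G ` E" \<epsilon>] E by auto
    let ?K = "m_inv G ` K"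
    have cK: "card ?K = card K"
      using K by (intro card_image) (meson inj_on_subset inv_inj)
    have "real (card (sym_diff (s <#\<^bsub>G\<^esub> ?K) ?K)) \<le> \<epsilon> * card ?K" if s: "s \<in> E" for s
    proof -
      have sc: "s \<in> carrier G" using s E by blast
      let ?R = "(\<lambda>g. g \<otimes> inv s) ` K"
      have Rc: "?R \<subseteq> carrier G" using K sc by auto
      have "s <#\<^bsub>G\<^esub> ?K = m_inv G ` ?R"
        unfolding l_coset_def image_image using K sc
        by (force simp: inv_mult_group subset_iff)
      moreover have "sym_diff (m_inv G ` ?R) ?K = m_inv G ` sym_diff ?R K"
      proof -
        have inj: "inj_on (m_inv G) (?R \<union> K)"
          using K Rc by (intro inj_on_subset[OF inv_inj]) auto
        show ?thesis
          using inj_on_image_set_diff[OF inj, of ?R K] inj_on_image_set_diff[OF inj, of K ?R]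
          by (simp add: image_Un Diff_subset le_supI1 le_supI2)
      qed
      moreover have "card (m_inv G ` sym_diff ?R K) \<le> card (sym_diff ?R K)"
        using K by (intro card_image_le) auto
      ultimately have "card (sym_diff (s <#\<^bsub>G\<^esub> ?K) ?K) \<le> card (sym_diff ?R K)" by simp
      then show ?thesis using K(4) s cK by fastforce
    qed
    moreover have "finite ?K" "?K \<noteq> {}" "?K \<subseteq> carrier G" using K by auto
    ultimately show ?thesis by blast
  qed
  define e where "e = from_nat_into (carrier G)"
  have e: "bij_betw e UNIV (carrier G)"
    unfolding e_def using bij_betw_from_nat_into[OF count False] .
  have ec: "e n \<in> carrier G" for n using e bij_betwE by blast
  have einj: "inj e" using e by (simp add: bij_betw_def)
  define E where "E n = e ` {..<(n+1)*(n+1)}" for n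
  define B where "B n = e ` {..n}" for n
  have E: "finite (E n)" "E n \<subseteq> carrier G" "card (E n) = (n+1)*(n+1)" for n
    using ec einj by (auto simp: E_def card_image inj_on_subset)
  have rE: "real (card (E n)) = (real n + 1) * (real n + 1)" for n by (simp add: E(3) algebra_simps)
  have B: "finite (B n)" "B n \<subseteq> carrier G" "card (B n) = n + 1" for n
    using ec einj by (auto simp: B_def card_image inj_on_subset)
  have "\<forall>n. \<exists>F. finite F \<and> F \<noteq> {} \<and> F \<subseteq> carrier G \<and>
        (\<forall>s\<in>E n. real (card (sym_diff (s <#\<^bsub>G\<^esub> F) F)) \<le> 1 / (2 * real (card (E n))) * card F)"
  proof
    fix n
    have "(0::real) < 1 / (2 * real (card (E n)))" by (simp add: rE)
    then show "\<exists>F. finite F \<and> F \<noteq> {} \<and> F \<subseteq> carrier G \<and>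
        (\<forall>s\<in>E n. real (card (sym_diff (s <#\<^bsub>G\<^esub> F) F)) \<le> 1 / (2 * real (card (E n))) * card F)"
      by (rule left[OF E(1,2)])
  qed
  then obtain F where F: "\<And>n. finite (F n)" "\<And>n. F n \<noteq> {}" "\<And>n. F n \<subseteq> carrier G"
      "\<And>n s. s \<in> E n \<Longrightarrow> real (card (sym_diff (s <#\<^bsub>G\<^esub> F n) (F n))) \<le> 1 / (2 * real (card (E n))) * card (F n)"
    by metis
  have fin_l: "finite (s <#\<^bsub>G\<^esub> K)" if "finite K" for s K
    using that by (auto simp: l_coset_def)
  have card_l: "card (s <#\<^bsub>G\<^esub> K) \<le> card K" if "finite K" for s K
  proof -
    have "s <#\<^bsub>G\<^esub> K = (\<lambda>h. s \<otimes> h) ` K" by (auto simp: l_coset_def)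
    then show ?thesis using card_image_le[OF that] by simp
  qed
  \<comment> \<open>A set moved by less than one point by every element of \<open>E\<close> is a union of \<open>E\<close>-orbits,
    hence has at least as many points as \<open>E\<close>.\<close>
  have large: "card (E n) \<le> card (F n)" for n
  proof (rule ccontr)
    assume less: "\<not> ?thesis"
    have inv: "s <#\<^bsub>G\<^esub> F n = F n" if s: "s \<in> E n" for s
    proof -
      have "real (card (sym_diff (s <#\<^bsub>G\<^esub> F n) (F n))) \<le> 1 / (2 * real (card (E n))) * card (F n)"
        by (rule F(4)[OF s])
      also have "\<dots> < 1" using less by (simp add: divide_simps)
      finally have "sym_diff (s <#\<^bsub>G\<^esub> F n) (F n) = {}" using F(1)[of n] fin_l by auto
      then show ?thesis by blast
    qed
    obtain f where f: "f \<in> F n" using F(2) by blast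
    have "(\<lambda>s. s \<otimes> f) ` E n \<subseteq> F n" using inv f by (force simp: l_coset_def)
    moreover have "inj_on (\<lambda>s. s \<otimes> f) (E n)"
    proof (rule inj_onI)
      fix x y assume "x \<in> E n" "y \<in> E n" "x \<otimes> f = y \<otimes> f"
      moreover from this have "x \<in> carrier G" "y \<in> carrier G" "f \<in> carrier G"
        using E(2)[of n] F(3)[of n] f by auto
      ultimately show "x = y" by simp
    qed
    ultimately have "card (E n) \<le> card (F n)" using F(1) card_inj_on_le by blast
    with less show False by simp
  qed
  let ?K = "\<lambda>n. F n \<union> B n"
  have bound: "real (card (sym_diff (g <#\<^bsub>G\<^esub> ?K n) (?K n))) / card (?K n) \<le> 3 / (real n + 1)"
    if g: "g \<in> E n" for g n
  proof -
    have "sym_diff (g <#\<^bsub>G\<^esub> ?K n) (?K n) \<subseteq> sym_diff (g <#\<^bsub>G\<^esub> F n) (F n) \<union> (g <#\<^bsub>G\<^esub> B n) \<union> B n"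
      by (auto simp: l_coset_def)
    then have "card (sym_diff (g <#\<^bsub>G\<^esub> ?K n) (?K n)) \<le> card (sym_diff (g <#\<^bsub>G\<^esub> F n) (F n) \<union> (g <#\<^bsub>G\<^esub> B n) \<union> B n)"
      using F(1) B(1) fin_l by (intro card_mono) auto
    also have "\<dots> \<le> card (sym_diff (g <#\<^bsub>G\<^esub> F n) (F n)) + card (g <#\<^bsub>G\<^esub> B n) + card (B n)"
      by (meson add_le_mono1 card_Un_le le_trans)
    finally have "card (sym_diff (g <#\<^bsub>G\<^esub> ?K n) (?K n)) \<le> card (sym_diff (g <#\<^bsub>G\<^esub> F n) (F n)) + (n + 1) + (n + 1)"
      using card_l[OF B(1)[of n], of g] B(3)[of n] by linarith
    then have "real (card (sym_diff (g <#\<^bsub>G\<^esub> ?K n) (?K n))) \<le> card (sym_diff (g <#\<^bsub>G\<^esub> F n) (F n)) + 2 * (real n + 1)"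
      by (drule_tac of_nat_mono[where 'a = real]) (simp only: of_nat_add, simp)
    also have "\<dots> \<le> 1 / (2 * real (card (E n))) * card (F n) + 2 * (real n + 1)" using F(4)[OF g] by simp
    also have "\<dots> \<le> 1 / (real n + 1) * card (F n) + 2 / (real n + 1) * card (F n)"
    proof (rule add_mono)
      have "real n + 1 \<le> 2 * ((real n + 1) * (real n + 1))"
        using mult_mono[of 1 "real n + 1" "real n + 1" "real n + 1"] by simp
      then show "1 / (2 * real (card (E n))) * card (F n) \<le> 1 / (real n + 1) * card (F n)"
        unfolding rE by (intro mult_right_mono divide_left_mono) auto
      have "(real n + 1) * (real n + 1) \<le> card (F n)"
        using large[of n] unfolding rE[symmetric] by simp
      then show "2 * (real n + 1) \<le> 2 / (real n + 1) * card (F n)" by (simp add: field_simps)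
    qed
    also have "\<dots> = 3 / (real n + 1) * card (F n)"
      by (simp only: distrib_right[symmetric] add_divide_distrib[symmetric]) simp
    also have "\<dots> \<le> 3 / (real n + 1) * card (?K n)"
      using F(1) B(1) by (intro mult_left_mono) (auto intro!: card_mono)
    finally show ?thesis
      using F(1,2) B(1) by (simp add: divide_le_eq card_gt_0_iff)
  qed
  show ?thesis
    unfolding amenable_def
  proof (intro exI[of _ ?K] conjI allI ballI)
    show "(\<Union>n. ?K n) = carrier G"
    proof
      show "(\<Union>n. ?K n) \<subseteq> carrier G" using F(3) B(2) by blast
      show "carrier G \<subseteq> (\<Union>n. ?K n)"
      proof
        fix g assume "g \<in> carrier G"
        then obtain n where "g = e n" using e by (metis bij_betw_imp_surj_on imageE)
        then show "g \<in> (\<Union>n. ?K n)" by (auto simp: B_def)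
      qed
    qed
    fix g assume "g \<in> carrier G"
    then obtain k where k: "g = e k" using e by (metis bij_betw_imp_surj_on imageE)
    have gE: "g \<in> E n" if "n \<ge> k" for n
    proof -
      have "k < (n + 1) * (n + 1)" using that by (simp add: le_imp_less_Suc trans_le_add1)
      then show ?thesis using k by (auto simp: E_def)
    qed
    have lim: "(\<lambda>n. 3 / (real n + 1)) \<longlonglongrightarrow> 0" by real_asymp
    have ev: "\<forall>\<^sub>F n in sequentially.
        real (card (sym_diff (g <#\<^bsub>G\<^esub> ?K n) (?K n))) / real (card (?K n)) \<le> 3 / (real n + 1)"
      using eventually_ge_at_top[of k] by eventually_elim (rule bound[OF gE])
    show "(\<lambda>n. real (card (sym_diff (g <#\<^bsub>G\<^esub> ?K n) (?K n))) / real (card (?K n))) \<longlonglongrightarrow> 0"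
      using ev lim by (rule tendsto_sandwich[OF always_eventually _ tendsto_const, rotated 1]) simp
  next
    fix n
    show "finite (?K n)" "?K n \<noteq> {}" "?K n \<subseteq> carrier G" using F(1,2,3)[of n] B(1,2)[of n] by simp_all
  qed
qed

text \<open>Here \<open>loop n g\<close> stands for: \<open>g\<close> is the value of a loop of length \<open>n\<close>. Almost invariant vectors are
  given for elements with loops of one common length only, hence, padding with the loop at the identity
  of length \<open>p\<close>, for finite sets of elements with loops of length \<open>0\<close> modulo \<open>p\<close>. The powers \<open>t\<^sup>i\<close>
  represent all residues, and \<open>g\<close> shifts residues by the length of its loop.\<close>

lemma amenable_if_almost_invariant_loops:
  fixes loop :: "nat \<Rightarrow> 'a \<Rightarrow> bool"
  assumes count: "countable (carrier G)"
    and closed: "\<And>n g. loop n g \<Longrightarrow> g \<in> carrier G"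
    and mult: "\<And>n g m h. loop n g \<Longrightarrow> loop m h \<Longrightarrow> loop (n + m) (g \<otimes> h)"
    and p: "loop p \<one>" "p > 0"
    and all: "\<And>g. g \<in> carrier G \<Longrightarrow> \<exists>n. loop n g"
    and t: "loop n0 t" "n0 mod p = 1 mod p"
    and inv: "\<And>N Y \<epsilon>. finite Y \<Longrightarrow> loop N \<one> \<Longrightarrow> (\<And>y. y \<in> Y \<Longrightarrow> loop N y) \<Longrightarrow> 0 < \<epsilon> \<Longrightarrow> \<epsilon> \<le> 1 \<Longrightarrow>
      \<exists>\<xi>. finite (gsupp \<xi>) \<and> norm2 \<xi> > 0 \<and>
        (\<forall>y\<in>Y. norm2 (\<lambda>g. translate y \<xi> g - \<xi> g) \<le> \<epsilon> * norm2 \<xi>)"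
  shows "amenable G"
proof (rule amenable_if_foelner[OF count])
  fix E and \<epsilon>' :: real
  assume E: "finite E" "E \<subseteq> carrier G" and \<epsilon>': "\<epsilon>' > 0"
  have tc: "t \<in> carrier G" using closed t by blast
  define reach where "reach r g \<longleftrightarrow> (\<exists>n. n mod p = r mod p \<and> loop n g)" for r g
  have reach_mult: "reach (r + s) (g \<otimes> h)" if "reach r g" "reach s h" for r s g h
    using that mult unfolding reach_def by (metis mod_add_cong)
  have reach_pow: "reach i (t [^] i)" for i :: nat
  proof (induction i)
    case 0
    then show ?case using p by (auto simp: reach_def intro!: exI[of _ p])
  next
    case (Suc i)
    have "reach 1 t" using t by (auto simp: reach_def)
    then show ?case using reach_mult[OF Suc, of 1 t] by simp
  qed
  have pad: "loop (n + k * p) g" if "loop n g" for n k g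
  proof (induction k)
    case (Suc k)
    have "loop (n + k * p + p) (g \<otimes> \<one>)" by (rule mult[OF Suc p(1)])
    then show ?case using closed[OF that] by (simp add: add_ac)
  qed (use that in simp)
  have common: "\<exists>K. \<forall>y\<in>Y. loop (K * p) y" if "finite Y" "\<forall>y\<in>Y. reach 0 y" for Y
    using that
  proof (induction Y rule: finite_induct)
    case (insert y Y)
    then obtain K where K: "\<forall>y\<in>Y. loop (K * p) y" by auto
    have "reach 0 y" using insert by simp
    then obtain n where n: "n mod p = 0 mod p" "loop n y" unfolding reach_def by blast
    then have "p dvd n" by (simp add: dvd_eq_mod_eq_0)
    then obtain k where k: "n = k * p" by (metis dvdE mult.commute)
    have "loop ((K + k) * p) z" if z: "z \<in> insert y Y" for z
    proof (cases "z = y")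
      case True
      then show ?thesis using pad[OF n(2), of K] k by (simp add: algebra_simps)
    next
      case False
      then have "loop (K * p) z" using K z by blast
      then show ?thesis using pad[of "K * p" z k] by (simp add: algebra_simps)
    qed
    then show ?case by blast
  qed simp
  obtain q where q: "\<And>g. g \<in> carrier G \<Longrightarrow> loop (q g) g" using all by metis
  define \<sigma> where "\<sigma> g i = (i + q g) mod p" for g i
  have \<sigma>: "bij_betw (\<sigma> g) {..<p} {..<p}" for g
  proof -
    have le: "j \<le> i" if "j < p" "\<sigma> g i = \<sigma> g j" for i j
    proof (rule ccontr)
      assume ij: "\<not> j \<le> i"
      then have "p dvd (j + q g) - (i + q g)"
        using that(2) by (subst mod_eq_dvd_iff_nat[symmetric]) (auto simp: \<sigma>_def)
      then have "p \<le> j - i" using ij by (auto dest: dvd_imp_le)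
      then show False using that(1) by linarith
    qed
    have "inj_on (\<sigma> g) {..<p}" by (rule inj_onI) (simp add: le order.antisym)
    moreover have "\<sigma> g ` {..<p} \<subseteq> {..<p}" using p by (auto simp: \<sigma>_def)
    ultimately show ?thesis by (simp add: bij_betw_def endo_inj_surj)
  qed
  \<comment> \<open>The last factor brings the residue of the length back to \<open>0\<close>.\<close>
  define x where "x g i = t [^] i \<otimes> g \<otimes> t [^] (p - \<sigma> g i)" for g and i :: nat
  define Y where "Y = insert \<one> (insert (t [^] p) ((\<lambda>(g,i). x g i) ` (E \<times> {..<p})))"
  have "reach 0 y" if "y \<in> Y" for y
  proof -
    have "reach 0 \<one>" using reach_pow[of 0] by simp
    moreover have "reach 0 (t [^] p)" using reach_pow[of p] by (simp add: reach_def)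
    moreover have "reach 0 (x g i)" if "g \<in> E" for g i
    proof -
      have "reach (q g) g" using q that E by (auto simp: reach_def)
      then have "reach (i + q g + (p - \<sigma> g i)) (x g i)"
        unfolding x_def by (intro reach_mult reach_pow)
      moreover have "(i + q g + (p - \<sigma> g i)) mod p = 0"
      proof -
        have "\<sigma> g i \<le> p" using p by (simp add: \<sigma>_def less_imp_le)
        moreover have "i + q g = p * ((i + q g) div p) + \<sigma> g i" by (simp add: \<sigma>_def)
        ultimately have "i + q g + (p - \<sigma> g i) = p * ((i + q g) div p) + p" by linarith
        then show ?thesis by simp
      qed
      ultimately show ?thesis by (simp add: reach_def)
    qed
    ultimately show ?thesis using that by (auto simp: Y_def)
  qed
  moreover have finY: "finite Y" using E by (simp add: Y_def)
  ultimately obtain K where K: "\<forall>y\<in>Y. loop (K * p) y" using common by blast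
  define \<epsilon> where "\<epsilon> = min 1 (\<epsilon>' / (4 * (card E + 1)))"
  have \<epsilon>: "0 < \<epsilon>" "\<epsilon> \<le> 1" "4 * \<epsilon> \<le> \<epsilon>' / (card E + 1)"
    using \<epsilon>' by (auto simp: \<epsilon>_def min_def divide_simps split: if_splits)
  have "\<exists>\<xi>. finite (gsupp \<xi>) \<and> norm2 \<xi> > 0 \<and>
        (\<forall>y\<in>Y. norm2 (\<lambda>g. translate y \<xi> g - \<xi> g) \<le> \<epsilon> * norm2 \<xi>)"
    by (rule inv[OF finY, of "K * p"]) (use K \<epsilon> in \<open>auto simp: Y_def\<close>)
  then obtain \<xi> where \<xi>: "finite (gsupp \<xi>)" "norm2 \<xi> > 0"
    "\<And>y. y \<in> Y \<Longrightarrow> norm2 (\<lambda>g. translate y \<xi> g - \<xi> g) \<le> \<epsilon> * norm2 \<xi>" by blast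
  define f where "f = (\<lambda>g. (\<xi> g)\<^sup>2)"
  have f: "finite (gsupp f)" "\<And>g. f g \<ge> 0" "norm1 f > 0"
  proof -
    have "gsupp f = gsupp \<xi>" by (auto simp: f_def gsupp_def)
    then show "finite (gsupp f)" using \<xi> by simp
    show "norm1 f > 0" unfolding f_def norm1_square using \<xi> by simp
  qed (simp add: f_def)
  have fY: "norm1 (\<lambda>g. translate y f g - f g) \<le> 2 * \<epsilon> * norm1 f" if "y \<in> Y" for y
    unfolding f_def by (rule norm1_square_translate_diff[OF \<xi>(1) _ \<xi>(3)[OF that]])
      (use K that closed in blast)
  define \<eta> where "\<eta> = (\<lambda>h. \<Sum>i<p. translate (t [^] i) f h)"
  have n\<eta>: "norm1 \<eta> = real p * norm1 f"
  proof -
    have "norm1 \<eta> = (\<Sum>i<p. norm1 (translate (t [^] i) f))"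
      unfolding \<eta>_def
    proof (rule norm1_sum_eq)
      show "finite (gsupp (translate (t [^] i) f))" for i :: nat using f tc by simp
    qed (simp_all add: translate_def f)
    then show ?thesis using tc by (simp add: norm1_translate)
  qed
  have \<eta>: "norm1 (\<lambda>h. translate g \<eta> h - \<eta> h) \<le> 4 * \<epsilon> * norm1 \<eta>" if g: "g \<in> E" for g
  proof -
    have gc: "g \<in> carrier G" using g E by blast
    have "norm1 (\<lambda>h. translate g \<eta> h - \<eta> h) \<le> real p * (4 * \<epsilon> * norm1 f)"
      unfolding \<eta>_def
    proof (rule norm1_sum_translates_diff[OF f(1) _ gc \<sigma>[of g]])
      fix i assume i: "i < p"
      let ?s = "t [^] (p - \<sigma> g i)"
      have sc: "?s \<in> carrier G" using tc by simp
      have "\<sigma> g i \<le> p" using p by (simp add: \<sigma>_def less_imp_le)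
      then have tp: "t [^] \<sigma> g i \<otimes> ?s = t [^] p" using tc by (simp add: nat_pow_mult)
      have xY: "x g i \<in> Y" "t [^] p \<in> Y" using g i by (auto simp: Y_def)
      have xc: "x g i \<in> carrier G" using tc gc by (simp add: x_def)
      have "norm1 (\<lambda>h. translate (t [^] i \<otimes> g) f h - translate (t [^] \<sigma> g i) f h)
          = norm1 (translate ?s (\<lambda>h. translate (t [^] i \<otimes> g) f h - translate (t [^] \<sigma> g i) f h))"
        using sc by (simp add: norm1_translate)
      also have "\<dots> = norm1 (\<lambda>h. translate (x g i) f h - translate (t [^] p) f h)"
      proof (rule norm1_cong)
        fix h assume h: "h \<in> carrier G"
        have "translate ?s (\<lambda>h. translate (t [^] i \<otimes> g) f h - translate (t [^] \<sigma> g i) f h) h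
            = translate ?s (translate (t [^] i \<otimes> g) f) h - translate ?s (translate (t [^] \<sigma> g i) f) h"
          by (simp add: translate_def)
        also have "\<dots> = translate (x g i) f h - translate (t [^] p) f h"
          using sc tc gc h by (simp add: translate_translate x_def tp)
        finally show "translate ?s (\<lambda>h. translate (t [^] i \<otimes> g) f h - translate (t [^] \<sigma> g i) f h) h
            = translate (x g i) f h - translate (t [^] p) f h" .
      qed
      also have "\<dots> = norm1 (\<lambda>h. (translate (x g i) f h - f h) + (f h - translate (t [^] p) f h))"
        by simp
      also have "\<dots> \<le> norm1 (\<lambda>h. translate (x g i) f h - f h) + norm1 (\<lambda>h. f h - translate (t [^] p) f h)"
        by (rule norm1_add) (use f xc tc in \<open>auto intro!: finite_gsupp_diff finite_gsupp_translate\<close>)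
      also have "norm1 (\<lambda>h. f h - translate (t [^] p) f h) = norm1 (\<lambda>h. translate (t [^] p) f h - f h)"
        by (rule norm1_minus_commute)
      finally show "norm1 (\<lambda>h. translate (t [^] i \<otimes> g) f h - translate (t [^] \<sigma> g i) f h) \<le> 4 * \<epsilon> * norm1 f"
        using fY[OF xY(1)] fY[OF xY(2)] by linarith
    qed (use tc in simp)
    then show ?thesis by (simp add: n\<eta> mult_ac)
  qed
  show "\<exists>K. finite K \<and> K \<noteq> {} \<and> K \<subseteq> carrier G \<and>
        (\<forall>s\<in>E. real (card (sym_diff ((\<lambda>g. g \<otimes> s) ` K) K)) \<le> \<epsilon>' * card K)"
  proof (rule right_foelner_set[OF E \<epsilon>', of \<eta>])
    show "finite (gsupp \<eta>)" unfolding \<eta>_def using f tc by (auto intro!: finite_gsupp_sum)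
    show "\<And>g. g \<in> carrier G \<Longrightarrow> 0 \<le> \<eta> g" by (simp add: \<eta>_def translate_def f sum_nonneg)
    show "norm1 \<eta> > 0" using n\<eta> p f by simp
    fix s assume s: "s \<in> E"
    show "norm1 (\<lambda>g. translate s \<eta> g - \<eta> g) \<le> \<epsilon>' / (card E + 1) * norm1 \<eta>"
      using \<eta>[OF s] mult_right_mono[OF \<epsilon>(3) norm1_nonneg[of \<eta>]] by linarith
  qed blast
qed

end

section \<open>Preimage words and bounded distortion\<close>

(* These rules rewrite a prepended word symbol by symbol and hide the words that the lemmas below speak of. *)
declare build_cons [simp del] build_append [simp del]

lemma shift_funpow: "(shift ^^ k) x = suffix k x"
  by (induction k) (auto simp: shift_def fun_eq_iff)

lemma birkhoff_prod_suffix: "birkhoff_prod \<phi> n x = (\<Prod>k<n. \<phi> (suffix k x))"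
  by (simp add: birkhoff_prod_def shift_funpow)

lemma birkhoff_prod_add:
  "birkhoff_prod \<phi> (n + m) x = birkhoff_prod \<phi> n x * birkhoff_prod \<phi> m (suffix n x)"
proof (induction m)
  case (Suc m)
  have "suffix m (suffix n x) = suffix (n + m) x" by simp
  with Suc show ?case unfolding birkhoff_prod_suffix by (simp del: suffix_suffix)
qed (simp add: birkhoff_prod_suffix)

lemma birkhoff_prod_0 [simp]: "birkhoff_prod \<phi> 0 x = 1"
  by (simp add: birkhoff_prod_def)

lemma birkhoff_prod_conc:
  assumes "length u = n"
  shows "birkhoff_prod \<phi> (n + m) (u \<frown> y) = birkhoff_prod \<phi> n (u \<frown> y) * birkhoff_prod \<phi> m y"
  using suffix_conc_length[of u y] assms by (simp add: birkhoff_prod_add)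

text \<open>A positive potential with locally Hoelder continuous logarithm. The bound \<open>\<Lambda>\<close> on the finite partial
  sums of \<open>L 1\<close> replaces the sup norm of the Ruelle operator; the estimates that precede the
  periodic points then involve finite sums of reals only.\<close>

locale markov_potential =
  fixes S :: "'s set" and A :: "'s \<Rightarrow> 's \<Rightarrow> bool" and \<phi> :: "(nat \<Rightarrow> 's) \<Rightarrow> real"
    and r C \<Lambda> :: real
  assumes pos: "x \<in> shift_space S A \<Longrightarrow> \<phi> x > 0"
    and r: "0 < r" "r < 1" and C: "C \<ge> 0"
    and hoelder: "x \<in> shift_space S A \<Longrightarrow> y \<in> shift_space S A \<Longrightarrow> n \<ge> 1 \<Longrightarrow>
      (\<And>k. k < n \<Longrightarrow> x k = y k) \<Longrightarrow> \<bar>ln (\<phi> x) - ln (\<phi> y)\<bar> \<le> C * r ^ n"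
    and \<Lambda>: "\<Lambda> > 0"
    and transfer_bound: "x \<in> shift_space S A \<Longrightarrow> finite B \<Longrightarrow> B \<subseteq> S \<Longrightarrow>
      (\<Sum>v\<in>{v \<in> B. A v (x 0)}. \<phi> ([v] \<frown> x)) \<le> \<Lambda>"
begin

abbreviation X :: "(nat \<Rightarrow> 's) set" where
  "X \<equiv> shift_space S A"

abbreviation \<Phi> :: "nat \<Rightarrow> (nat \<Rightarrow> 's) \<Rightarrow> real" where
  "\<Phi> \<equiv> birkhoff_prod \<phi>"

definition D :: real where
  "D = C / (1 - r)"

lemma D_nonneg: "D \<ge> 0"
  using C r by (simp add: D_def)

lemma suffix_in_X: "x \<in> X \<Longrightarrow> suffix k x \<in> X"
  by (auto simp: shift_space_def)

lemma Cons_conc_in_X: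
  "(v # w) \<frown> x \<in> X \<longleftrightarrow> v \<in> S \<and> A v ((w \<frown> x) 0) \<and> w \<frown> x \<in> X"
proof -
  have eq: "((v # w) \<frown> x) k = (case k of 0 \<Rightarrow> v | Suc k \<Rightarrow> (w \<frown> x) k)" for k
    by (auto simp: conc_def split: nat.split)
  show ?thesis
    unfolding shift_space_def mem_Collect_eq eq
    by (auto split: nat.splits)
qed

lemma conc_0: "(w \<frown> x) 0 = (if w = [] then x 0 else hd w)"
  by (auto simp: conc_def hd_conv_nth)

lemma conc_in_X:
  assumes "x \<in> X"
  shows "w \<frown> x \<in> X \<longleftrightarrow> set w \<subseteq> S \<and> successively A w \<and> (w \<noteq> [] \<longrightarrow> A (last w) (x 0))"
proof (induction w)
  case (Cons v w)
  then show ?case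
    by (cases w) (auto simp: Cons_conc_in_X conc_0)
qed (use assms in simp)

lemma conc_in_X_swap:
  assumes "u \<frown> y \<in> X" "y \<in> X" "z \<in> X" "u \<noteq> []" "A (last u) (z 0)"
  shows "u \<frown> z \<in> X"
  using assms by (simp add: conc_in_X)

lemma conc_in_X_suffix: "u \<frown> y \<in> X \<Longrightarrow> y \<in> X"
  using suffix_in_X[of "u \<frown> y" "length u"] by simp

lemma birkhoff_pos: "x \<in> X \<Longrightarrow> \<Phi> n x > 0"
  unfolding birkhoff_prod_suffix by (intro prod_pos ballI pos suffix_in_X)

text \<open>The error terms form a geometric series; the factor \<open>1 - r ^ n\<close> keeps track of its partial sums and
  lets the induction close.\<close>

lemma ln_birkhoff_distortion:
  assumes "x \<in> X" "y \<in> X" "\<And>k. k < n + j \<Longrightarrow> x k = y k"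
  shows "ln (\<Phi> n x) \<le> ln (\<Phi> n y) + D * r ^ j * (1 - r ^ n)"
  using assms
proof (induction n arbitrary: x y)
  case (Suc n)
  have X: "suffix 1 x \<in> X" "suffix 1 y \<in> X" using Suc by (auto intro: suffix_in_X)
  have IH: "ln (\<Phi> n (suffix 1 x)) \<le> ln (\<Phi> n (suffix 1 y)) + D * r ^ j * (1 - r ^ n)"
    by (rule Suc.IH[OF X]) (use Suc(4) in simp)
  have 1: "\<bar>ln (\<phi> x) - ln (\<phi> y)\<bar> \<le> C * r ^ (Suc n + j)"
    using Suc by (intro hoelder) auto
  have step: "\<Phi> (Suc n) z = \<phi> z * \<Phi> n (suffix 1 z)" for z
    using birkhoff_prod_add[of \<phi> 1 n z] by (simp add: birkhoff_prod_suffix)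
  have "ln (\<Phi> (Suc n) x) = ln (\<phi> x) + ln (\<Phi> n (suffix 1 x))"
    unfolding step using pos[OF Suc(2)] birkhoff_pos[OF X(1), of n] by (intro ln_mult_pos)
  moreover have "ln (\<Phi> (Suc n) y) = ln (\<phi> y) + ln (\<Phi> n (suffix 1 y))"
    unfolding step using pos[OF Suc(3)] birkhoff_pos[OF X(2), of n] by (intro ln_mult_pos)
  moreover have "C * r ^ (Suc n + j) \<le> C * r ^ (n + j)"
    using C r by (intro mult_left_mono power_decreasing) auto
  moreover have "C * r ^ (n + j) = D * r ^ j * (r ^ n - r ^ Suc n)"
    using r by (simp add: D_def power_add field_simps)
  ultimately have "ln (\<Phi> (Suc n) x) \<le> ln (\<Phi> (Suc n) y)
      + (D * r ^ j * (1 - r ^ n) + D * r ^ j * (r ^ n - r ^ Suc n))"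
    using IH 1 by linarith
  also have "D * r ^ j * (1 - r ^ n) + D * r ^ j * (r ^ n - r ^ Suc n) = D * r ^ j * (1 - r ^ Suc n)"
    by (simp add: algebra_simps)
  finally show ?case .
qed simp

lemma birkhoff_distortion:
  assumes "x \<in> X" "y \<in> X" "\<And>k. k < n + j \<Longrightarrow> x k = y k"
  shows "\<Phi> n x \<le> exp (D * r ^ j) * \<Phi> n y"
proof -
  have "D * r ^ j * (1 - r ^ n) \<le> D * r ^ j"
    using D_nonneg r by (intro mult_left_le) auto
  then have "ln (\<Phi> n x) \<le> ln (\<Phi> n y) + D * r ^ j"
    using ln_birkhoff_distortion[of x y n j] assms by simp
  then have "exp (ln (\<Phi> n x)) \<le> exp (ln (\<Phi> n y) + D * r ^ j)" by simp
  then show ?thesis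
    using birkhoff_pos[OF assms(1), of n] birkhoff_pos[OF assms(2), of n]
    by (simp add: exp_add mult.commute)
qed

lemma birkhoff_distortion_0:
  assumes "x \<in> X" "y \<in> X" "\<And>k. k < n \<Longrightarrow> x k = y k"
  shows "\<Phi> n x \<le> exp D * \<Phi> n y"
  using birkhoff_distortion[of x y n 0] assms by simp

text \<open>By distortion a word has nearly the same weight before all points, so finitely many words have
  weights bounded away from zero.\<close>

lemma birkhoff_lower_bound:
  assumes "finite V"
  obtains \<omega> where "\<omega> > 0" "\<And>v x. v \<in> V \<Longrightarrow> v \<frown> x \<in> X \<Longrightarrow> \<omega> \<le> \<Phi> (length v) (v \<frown> x)"
proof -
  have "\<exists>\<omega>>0. \<forall>v\<in>V. \<forall>x. v \<frown> x \<in> X \<longrightarrow> \<omega> \<le> \<Phi> (length v) (v \<frown> x)"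
    using assms
  proof (induction V rule: finite_induct)
    case empty
    then show ?case by (auto intro: exI[of _ 1])
  next
    case (insert v V)
    then obtain \<omega> where \<omega>: "\<omega> > 0" "\<forall>v\<in>V. \<forall>x. v \<frown> x \<in> X \<longrightarrow> \<omega> \<le> \<Phi> (length v) (v \<frown> x)"
      by blast
    have "\<exists>\<omega>'>0. \<forall>x. v \<frown> x \<in> X \<longrightarrow> \<omega>' \<le> \<Phi> (length v) (v \<frown> x)"
    proof (cases "\<exists>z. v \<frown> z \<in> X")
      case True
      then obtain z where z: "v \<frown> z \<in> X" by blast
      have "exp (- D) * \<Phi> (length v) (v \<frown> z) \<le> \<Phi> (length v) (v \<frown> x)" if "v \<frown> x \<in> X" for x
        using birkhoff_distortion_0[OF z that, of "length v"] by (simp add: exp_minus field_simps)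
      moreover have "exp (- D) * \<Phi> (length v) (v \<frown> z) > 0" using birkhoff_pos[OF z] by simp
      ultimately show ?thesis by blast
    qed (auto intro: exI[of _ 1])
    then obtain \<omega>' where \<omega>': "\<omega>' > 0" "\<forall>x. v \<frown> x \<in> X \<longrightarrow> \<omega>' \<le> \<Phi> (length v) (v \<frown> x)" by blast
    show ?case
      using \<omega> \<omega>' by (intro exI[of _ "min \<omega> \<omega>'"]) (auto simp: min_le_iff_disj)
  qed
  with that show ?thesis by blast
qed

text \<open>The preimages of \<open>x\<close> of order \<open>n\<close> that use only new symbols from \<open>B\<close>. A finite set \<open>B\<close> makes them
  finite in number; all estimates below are uniform in \<open>B\<close>.\<close>

definition preimage_words :: "'s set \<Rightarrow> nat \<Rightarrow> (nat \<Rightarrow> 's) \<Rightarrow> 's list set" where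
  "preimage_words B n x = {w. length w = n \<and> set w \<subseteq> B \<and> w \<frown> x \<in> X}"

definition word_mass :: "'s set \<Rightarrow> nat \<Rightarrow> (nat \<Rightarrow> 's) \<Rightarrow> real" where
  "word_mass B n x = (\<Sum>w\<in>preimage_words B n x. \<Phi> n (w \<frown> x))"

lemma finite_preimage_words [simp]: "finite B \<Longrightarrow> finite (preimage_words B n x)"
  by (rule finite_subset[OF _ finite_lists_length_eq[of B n]]) (auto simp: preimage_words_def)

lemma preimage_words_pos: "w \<in> preimage_words B n x \<Longrightarrow> \<Phi> m (w \<frown> x) > 0"
  by (simp add: preimage_words_def birkhoff_pos)

lemma word_mass_nonneg: "word_mass B n x \<ge> 0"
  unfolding word_mass_def by (intro sum_nonneg less_imp_le) (rule preimage_words_pos)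

lemma preimage_words_cong:
  assumes "x \<in> X" "y \<in> X" "x 0 = y 0"
  shows "preimage_words B n x = preimage_words B n y"
  using assms by (auto simp: preimage_words_def conc_in_X)

lemma sum_preimage_words_add:
  assumes "finite B"
  shows "(\<Sum>w\<in>preimage_words B (n + m) x. h w)
    = (\<Sum>v\<in>preimage_words B m x. \<Sum>u\<in>preimage_words B n (v \<frown> x). h (u @ v))"
proof -
  have "(\<Sum>v\<in>preimage_words B m x. \<Sum>u\<in>preimage_words B n (v \<frown> x). h (u @ v))
      = (\<Sum>(v,u)\<in>Sigma (preimage_words B m x) (\<lambda>v. preimage_words B n (v \<frown> x)). h (u @ v))"
    using assms by (intro sum.Sigma) auto
  also have "\<dots> = (\<Sum>w\<in>preimage_words B (n + m) x. h w)"
  proof (rule sum.reindex_bij_witness[where i = "\<lambda>w. (drop n w, take n w)" and j = "\<lambda>(v,u). u @ v"])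
    fix w assume w: "w \<in> preimage_words B (n + m) x"
    then have eq: "take n w \<frown> drop n w \<frown> x = w \<frown> x" by simp
    have "drop n w \<frown> x \<in> X"
      by (rule conc_in_X_suffix[of "take n w"]) (use w eq in \<open>simp add: preimage_words_def\<close>)
    then show "(drop n w, take n w) \<in> Sigma (preimage_words B m x) (\<lambda>v. preimage_words B n (v \<frown> x))"
      using w eq by (auto simp: preimage_words_def dest: in_set_takeD in_set_dropD)
  qed (auto simp: preimage_words_def)
  finally show ?thesis by simp
qed

lemma birkhoff_append:
  "u \<in> preimage_words B n (v \<frown> x) \<Longrightarrow>
    \<Phi> (n + m) ((u @ v) \<frown> x) = \<Phi> n (u \<frown> v \<frown> x) * \<Phi> m (v \<frown> x)"
  using birkhoff_prod_conc[of u n \<phi> m "v \<frown> x"] by (simp add: preimage_words_def)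

lemma word_mass_add:
  assumes "finite B"
  shows "word_mass B (n + m) x = (\<Sum>v\<in>preimage_words B m x. \<Phi> m (v \<frown> x) * word_mass B n (v \<frown> x))"
  unfolding word_mass_def sum_preimage_words_add[OF assms]
  by (intro sum.cong refl) (simp add: sum_distrib_left birkhoff_append mult.commute del: conc_conc)

lemma word_mass_0: "x \<in> X \<Longrightarrow> word_mass B 0 x = 1"
proof -
  assume "x \<in> X"
  then have "preimage_words B 0 x = {[]}" by (auto simp: preimage_words_def)
  then show ?thesis by (simp add: word_mass_def)
qed

lemma word_mass_le:
  assumes "finite B" "x \<in> X"
  shows "word_mass B n x \<le> \<Lambda> ^ n"
proof (induction n)
  case 0
  then show ?case using assms by (simp add: word_mass_0)
next
  case (Suc n)
  have one: "word_mass B 1 y \<le> \<Lambda>" if y: "y \<in> X" for y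
  proof -
    have "preimage_words B 1 y = (\<lambda>v. [v]) ` {v \<in> B \<inter> S. A v (y 0)}"
      using y by (auto simp: preimage_words_def conc_in_X length_Suc_conv)
    then have "word_mass B 1 y = (\<Sum>v\<in>{v \<in> B \<inter> S. A v (y 0)}. \<Phi> 1 ([v] \<frown> y))"
      by (simp add: word_mass_def sum.reindex inj_on_def)
    also have "\<dots> = (\<Sum>v\<in>{v \<in> B \<inter> S. A v (y 0)}. \<phi> ([v] \<frown> y))"
      by (simp add: birkhoff_prod_suffix)
    also have "\<dots> \<le> \<Lambda>" using assms y by (intro transfer_bound) auto
    finally show ?thesis .
  qed
  have "word_mass B (1 + n) x = (\<Sum>v\<in>preimage_words B n x. \<Phi> n (v \<frown> x) * word_mass B 1 (v \<frown> x))"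
    by (rule word_mass_add[OF assms(1)])
  also have "\<dots> \<le> (\<Sum>v\<in>preimage_words B n x. \<Phi> n (v \<frown> x) * \<Lambda>)"
    by (intro sum_mono mult_left_mono one less_imp_le[OF preimage_words_pos])
       (auto simp: preimage_words_def)
  also have "\<dots> = word_mass B n x * \<Lambda>" by (simp add: word_mass_def sum_distrib_right)
  also have "\<dots> \<le> \<Lambda> ^ n * \<Lambda>" using Suc \<Lambda> by (intro mult_right_mono) auto
  finally show ?case by (simp add: mult.commute)
qed

end

section \<open>Preimage words weighted in the group\<close>

text \<open>A cocycle that is constant on cylinders of length one is a labelling of the symbols.\<close>

locale labelled_markov_potential = markov_potential S A \<phi> r C \<Lambda> + group G
  for S :: "'s set" and A \<phi> r C \<Lambda> and G :: "('g, 'm) monoid_scheme" (structure) +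
  fixes letter :: "'s \<Rightarrow> 'g"
  assumes letter_closed: "v \<in> S \<Longrightarrow> letter v \<in> carrier G"
begin

primrec val :: "'s list \<Rightarrow> 'g" where
  "val [] = \<one>"
| "val (v # w) = letter v \<otimes> val w"

lemma val_closed: "set w \<subseteq> S \<Longrightarrow> val w \<in> carrier G"
  by (induction w) (auto simp: letter_closed)

lemma val_append: "set u \<subseteq> S \<Longrightarrow> set w \<subseteq> S \<Longrightarrow> val (u @ w) = val u \<otimes> val w"
  by (induction u) (auto simp: letter_closed val_closed m_assoc)

lemma preimage_words_in_S: "w \<in> preimage_words B n x \<Longrightarrow> set w \<subseteq> S"
  unfolding preimage_words_def using conc_in_X conc_in_X_suffix by blast

lemma val_preimage_words: "w \<in> preimage_words B n x \<Longrightarrow> val w \<in> carrier G"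
  by (simp add: val_closed preimage_words_in_S)

definition group_mass :: "'s set \<Rightarrow> nat \<Rightarrow> (nat \<Rightarrow> 's) \<Rightarrow> 'g \<Rightarrow> real" where
  "group_mass B n x g = (\<Sum>w\<in>preimage_words B n x. if val w = g then \<Phi> n (w \<frown> x) else 0)"

lemma group_mass_nonneg: "group_mass B n x g \<ge> 0"
  unfolding group_mass_def by (intro sum_nonneg) (auto intro: less_imp_le[OF preimage_words_pos])

lemma finite_gsupp_group_mass [simp]:
  assumes "finite B"
  shows "finite (gsupp (group_mass B n x))"
proof (rule finite_subset)
  show "gsupp (group_mass B n x) \<subseteq> val ` preimage_words B n x"
    unfolding gsupp_def group_mass_def by (auto intro!: sum.neutral dest!: sum.not_neutral_contains_not_neutral split: if_splits)
qed (use assms in simp)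

text \<open>The Markov property of the vectors: the last \<open>m\<close> symbols contribute a scalar weight and a right
  translation.\<close>

lemma group_mass_add:
  assumes "finite B" "g \<in> carrier G"
  shows "group_mass B (n + m) x g
    = (\<Sum>v\<in>preimage_words B m x. \<Phi> m (v \<frown> x) * translate (val v) (group_mass B n (v \<frown> x)) g)"
  unfolding group_mass_def sum_preimage_words_add[OF assms(1)] translate_def
proof (rule sum.cong[OF refl])
  fix v assume v: "v \<in> preimage_words B m x"
  note vc = val_preimage_words[OF v]
  have "(if val (u @ v) = g then \<Phi> (n + m) ((u @ v) \<frown> x) else 0)
      = \<Phi> m (v \<frown> x) * (if val u = g \<otimes> inv val v then \<Phi> n (u \<frown> v \<frown> x) else 0)"
    if u: "u \<in> preimage_words B n (v \<frown> x)" for u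
  proof -
    have "val (u @ v) = g \<longleftrightarrow> val u = g \<otimes> inv val v"
      using val_append[OF preimage_words_in_S[OF u] preimage_words_in_S[OF v]] vc
        val_preimage_words[OF u] assms(2) by (metis inv_solve_right)
    then show ?thesis by (simp add: birkhoff_append[OF u] del: conc_conc)
  qed
  then show "(\<Sum>u\<in>preimage_words B n (v \<frown> x). if val (u @ v) = g then \<Phi> (n + m) ((u @ v) \<frown> x) else 0)
      = \<Phi> m (v \<frown> x) * (\<Sum>u\<in>preimage_words B n (v \<frown> x).
          if val u = g \<otimes> inv val v then \<Phi> n (u \<frown> v \<frown> x) else 0)"
    by (simp add: sum_distrib_left del: conc_conc)
qed

lemma norm2_group_mass_le:
  assumes B: "finite B" and x: "x \<in> X"
  shows "norm2 (group_mass B n x) \<le> word_mass B n x"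
proof -
  have zero: "norm2 (group_mass B 0 y) \<le> 1" if "y \<in> X" for y
  proof -
    have "preimage_words B 0 y = {[]}" using that by (auto simp: preimage_words_def)
    then have "group_mass B 0 y = (\<lambda>g. if \<one> = g then 1 else 0)"
      by (simp add: group_mass_def fun_eq_iff)
    then have "norm2 (group_mass B 0 y) = L2_set (\<lambda>g. if \<one> = g then 1 else 0) {\<one>}"
      by (simp only:) (rule norm2_eq, auto simp: gsupp_def split: if_splits)
    then show ?thesis by simp
  qed
  have "norm2 (group_mass B (0 + n) x)
      = norm2 (\<lambda>g. \<Sum>v\<in>preimage_words B n x. \<Phi> n (v \<frown> x) * translate (val v) (group_mass B 0 (v \<frown> x)) g)"
    by (rule norm2_cong) (rule group_mass_add[OF B])
  also have "\<dots> \<le> (\<Sum>v\<in>preimage_words B n x.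
      norm2 (\<lambda>g. \<Phi> n (v \<frown> x) * translate (val v) (group_mass B 0 (v \<frown> x)) g))"
    using B by (intro norm2_sum) (auto intro!: finite_gsupp_scale finite_gsupp_translate val_preimage_words)
  also have "\<dots> \<le> (\<Sum>v\<in>preimage_words B n x. \<Phi> n (v \<frown> x))"
  proof (rule sum_mono)
    fix v assume v: "v \<in> preimage_words B n x"
    have "norm2 (\<lambda>g. \<Phi> n (v \<frown> x) * translate (val v) (group_mass B 0 (v \<frown> x)) g)
        = \<Phi> n (v \<frown> x) * norm2 (group_mass B 0 (v \<frown> x))"
      using less_imp_le[OF preimage_words_pos[OF v, of n]] val_preimage_words[OF v]
      by (simp add: norm2_scale)
    also have "\<dots> \<le> \<Phi> n (v \<frown> x) * 1"
      using v by (intro mult_left_mono zero less_imp_le[OF preimage_words_pos[OF v]])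
        (simp add: preimage_words_def)
    finally show "norm2 (\<lambda>g. \<Phi> n (v \<frown> x) * translate (val v) (group_mass B 0 (v \<frown> x)) g) \<le> \<Phi> n (v \<frown> x)"
      by simp
  qed
  finally show ?thesis by (simp add: word_mass_def)
qed

lemma group_mass_distortion:
  assumes "x \<in> X" "y \<in> X" "\<And>k. k < j \<Longrightarrow> x k = y k" "j \<ge> 1"
  shows "group_mass B n x g \<le> exp (D * r ^ j) * group_mass B n y g"
proof -
  have eq: "preimage_words B n x = preimage_words B n y"
    using assms by (intro preimage_words_cong) auto
  show ?thesis
    unfolding group_mass_def eq sum_distrib_left
  proof (rule sum_mono)
    fix w assume w: "w \<in> preimage_words B n y"
    then have w': "w \<in> preimage_words B n x" using eq by simp
    have "\<Phi> n (w \<frown> x) \<le> exp (D * r ^ j) * \<Phi> n (w \<frown> y)"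
      by (rule birkhoff_distortion) (use w w' assms in \<open>auto simp: preimage_words_def conc_def\<close>)
    then show "(if val w = g then \<Phi> n (w \<frown> x) else 0)
        \<le> exp (D * r ^ j) * (if val w = g then \<Phi> n (w \<frown> y) else 0)" by simp
  qed
qed

section \<open>Contraction in a group without almost invariant vectors\<close>

definition bridge :: "'s \<Rightarrow> 's list \<Rightarrow> 's \<Rightarrow> bool" where
  "bridge i v j \<longleftrightarrow> set v \<subseteq> S \<and> successively A (i # v @ [j])"

lemma bridge_conc:
  assumes "bridge i v (x 0)" "x \<in> X"
  shows "v \<frown> x \<in> X" "A i ((v \<frown> x) 0)"
  using assms
  by (auto simp: bridge_def conc_in_X conc_0 successively_Cons successively_append_iff)

text \<open>The words of length \<open>l + N\<close> are grouped by their prefix \<open>u\<close> of length \<open>l\<close>. For given \<open>u\<close> and \<open>x\<close> the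
  words \<open>u @ v\<close>, with \<open>v\<close> from \<open>V\<close>, lead to the translates of almost one and the same vector by
  \<open>p \<otimes> q\<close> and by \<open>p \<otimes> y \<otimes> q\<close>; choosing \<open>y\<close> to move the vector translated by \<open>p\<close> gives a pair with a gap,
  which \<open>norm2_sum_gap\<close> spreads over the group of words. The distortion bounds compare the weights
  within the group by constants that depend neither on \<open>l\<close> nor on \<open>B\<close>, \<open>n\<close>, \<open>x\<close>; hence \<open>l\<close> can be
  chosen large for the given gap.\<close>

lemma group_mass_contraction:
  assumes Y: "Y \<noteq> {}" "Y \<subseteq> carrier G" "\<one> \<notin> Y"
    and eps: "0 < \<epsilon>" "\<epsilon> \<le> 1"
    and far: "\<And>\<xi>. finite (gsupp \<xi>) \<Longrightarrow>
      \<exists>y\<in>Y. \<epsilon> * norm2 \<xi> \<le> norm2 (\<lambda>g. translate y \<xi> g - \<xi> g)"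
    and V: "finite V" "\<And>v. v \<in> V \<Longrightarrow> length v = N"
    and conn: "\<And>i j. i \<in> S \<Longrightarrow> j \<in> S \<Longrightarrow>
      \<exists>v0\<in>V. \<exists>p\<in>carrier G. \<exists>q\<in>carrier G. bridge i v0 j \<and> val v0 = p \<otimes> q \<and>
        (\<forall>y\<in>Y. \<exists>v\<in>V. bridge i v j \<and> val v = p \<otimes> y \<otimes> q)"
  obtains m \<delta> where "m > 0" "0 < \<delta>" "\<delta> < 1"
    "\<And>B n x. finite B \<Longrightarrow> (\<Union>v\<in>V. set v) \<subseteq> B \<Longrightarrow> x \<in> X \<Longrightarrow>
      norm2 (group_mass B (n + m) x)
        \<le> (1 - \<delta>) * (\<Sum>w\<in>preimage_words B m x. \<Phi> m (w \<frown> x) * norm2 (group_mass B n (w \<frown> x)))"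
proof -
  define \<gamma> where "\<gamma> = \<epsilon>\<^sup>2 / 16"
  have \<gamma>: "\<gamma> > 0" using eps by (simp add: \<gamma>_def)
  obtain \<omega> where \<omega>: "\<omega> > 0" "\<And>v x. v \<in> V \<Longrightarrow> v \<frown> x \<in> X \<Longrightarrow> \<omega> \<le> \<Phi> (length v) (v \<frown> x)"
    using birkhoff_lower_bound[OF V(1)] by metis
  \<comment> \<open>The prefix length is chosen so long that what lies behind the prefix changes the
    vectors by a factor close to one only.\<close>
  have "(\<lambda>l. exp (D * r ^ l) - 1) \<longlonglongrightarrow> exp (D * 0) - 1"
    using r by (intro tendsto_intros LIMSEQ_realpow_zero) auto
  then have "\<forall>\<^sub>F l in sequentially. exp (D * r ^ l) - 1 < \<gamma>"
    using \<gamma> by (intro order_tendstoD(2)[of _ "exp (D * 0) - 1"]) auto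
  then have "\<forall>\<^sub>F l in sequentially. exp (D * r ^ l) - 1 < \<gamma> \<and> l \<ge> 1"
    using eventually_ge_at_top[of 1] by eventually_elim simp
  then obtain l where l: "exp (D * r ^ l) - 1 < \<gamma>" "l \<ge> 1"
    using eventually_happens by force
  define \<theta> where "\<theta> = exp (D * r ^ l) - 1"
  have \<theta>: "0 \<le> \<theta>" "\<theta> \<le> \<epsilon>\<^sup>2 / 16" using l D_nonneg r by (auto simp: \<theta>_def \<gamma>_def)
  \<comment> \<open>A lower bound for the share of one bridge in the weight of its group: \<open>\<Lambda> ^ N\<close> bounds the
    weights of all suffixes, and one factor \<open>exp D\<close> each compares the prefix weights from above and
    from below.\<close>
  define \<kappa> where "\<kappa> = \<omega> * exp (- (2 * D)) / \<Lambda> ^ N"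
  have \<kappa>: "\<kappa> > 0" using \<omega> \<Lambda> by (simp add: \<kappa>_def)
  \<comment> \<open>The minimum keeps \<open>1 - \<delta>\<close> positive, as iteration requires.\<close>
  define \<delta> where "\<delta> = min (1/2) (\<kappa> * \<gamma> / exp D)"
  have \<delta>: "0 < \<delta>" "\<delta> < 1" "\<delta> \<le> \<kappa> * \<gamma> / exp D" using \<kappa> \<gamma> by (auto simp: \<delta>_def)
  define m where "m = l + N"
  have contraction: "norm2 (group_mass B (n + m) x)
      \<le> (1 - \<delta>) * (\<Sum>w\<in>preimage_words B m x. \<Phi> m (w \<frown> x) * norm2 (group_mass B n (w \<frown> x)))"
    if B: "finite B" "(\<Union>v\<in>V. set v) \<subseteq> B" and x: "x \<in> X" for B n x
  proof -
    let ?W = "preimage_words B m x"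
    define c where "c w = \<Phi> m (w \<frown> x)" for w
    define \<xi> where "\<xi> w = translate (val w) (group_mass B n (w \<frown> x))" for w
    have n\<xi>: "norm2 (\<xi> w) = norm2 (group_mass B n (w \<frown> x))" if "w \<in> ?W" for w
      using val_preimage_words[OF that] by (simp add: \<xi>_def)
    have fin\<xi>: "finite (gsupp (\<xi> w))" if "w \<in> ?W" for w
      using val_preimage_words[OF that] B by (simp add: \<xi>_def)
    have c0: "c w > 0" if "w \<in> ?W" for w
      unfolding c_def by (rule preimage_words_pos[OF that])
    define R where "R u = {w \<in> ?W. take l w = u}" for u
    have fibre: "norm2 (\<lambda>g. \<Sum>w\<in>R u. c w * \<xi> w g) \<le> (1 - \<delta>) * (\<Sum>w\<in>R u. c w * norm2 (\<xi> w))"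
      if u: "u \<in> take l ` ?W" for u
    proof -
      obtain w where w: "w \<in> ?W" "take l w = u" using u by blast
      have lu: "length u = l" "u \<noteq> []" "set u \<subseteq> B"
        using w l by (auto simp: preimage_words_def m_def dest: in_set_takeD)
      have uS: "set u \<subseteq> S" using preimage_words_in_S[OF w(1)] w(2) by (auto dest: in_set_takeD)
      have "u \<frown> drop l w \<frown> x = w \<frown> x" using w by auto
      then have udw: "u \<frown> drop l w \<frown> x \<in> X" using w(1) by (simp add: preimage_words_def)
      define i where "i = last u"
      have i: "i \<in> S" using lu(2) uS by (auto simp: i_def)
      have x0: "x 0 \<in> S" using x by (simp add: shift_space_def)
      obtain v0 p q where v0: "v0 \<in> V" and pq: "p \<in> carrier G" "q \<in> carrier G"
        and br0: "bridge i v0 (x 0)" and val0: "val v0 = p \<otimes> q"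
        and brY: "\<forall>y\<in>Y. \<exists>v\<in>V. bridge i v (x 0) \<and> val v = p \<otimes> y \<otimes> q"
        using conn[OF i x0] by blast
      have ext: "(u @ v) \<in> R u \<and> u \<frown> v \<frown> x \<in> X \<and> v \<frown> x \<in> X \<and> val (u @ v) = val u \<otimes> val v"
        if v: "v \<in> V" "bridge i v (x 0)" for v
      proof -
        have vx: "v \<frown> x \<in> X" "A i ((v \<frown> x) 0)" using bridge_conc[OF v(2) x] by auto
        have uvx: "u \<frown> v \<frown> x \<in> X"
          by (rule conc_in_X_swap[OF udw conc_in_X_suffix[OF udw] vx(1) lu(2)]) (use vx(2) i_def in simp)
        moreover have "u @ v \<in> R u"
          using uvx v lu B(2) V(2)[OF v(1)] by (auto simp: R_def preimage_words_def m_def)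
        moreover have "val (u @ v) = val u \<otimes> val v"
          using uS v(2) by (intro val_append) (auto simp: bridge_def)
        ultimately show ?thesis using vx by blast
      qed
      define f0 where "f0 = translate (val u \<otimes> p) (group_mass B n (u \<frown> v0 \<frown> x))"
      have uc: "val u \<in> carrier G" using uS by (rule val_closed)
      have f0: "finite (gsupp f0)" using uc pq B by (simp add: f0_def)
      obtain y where y: "y \<in> Y" "\<epsilon> * norm2 f0 \<le> norm2 (\<lambda>g. translate y f0 g - f0 g)"
        using far[of f0] f0 by blast
      have yc: "y \<in> carrier G" using y Y by blast
      obtain v1 where v1: "v1 \<in> V" "bridge i v1 (x 0)" "val v1 = p \<otimes> y \<otimes> q" using brY y by blast
      note e0 = ext[OF v0 br0] and e1 = ext[OF v1(1,2)]
      let ?w0 = "u @ v0" and ?w1 = "u @ v1"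
      define f1 where "f1 = translate (val u \<otimes> p) (group_mass B n (u \<frown> v1 \<frown> x))"
      have f1: "finite (gsupp f1)" using uc pq B by (auto simp: f1_def)
      \<comment> \<open>The two words have different values since \<open>y\<close> is not the identity.\<close>
      have ne: "?w0 \<noteq> ?w1"
      proof
        assume "?w0 = ?w1"
        then have "p \<otimes> q = p \<otimes> y \<otimes> q" using val0 v1 by simp
        then have "y = \<one>" using pq yc by (simp add: m_assoc)
        then show False using Y y by blast
      qed
      have close: "group_mass B n (u \<frown> a) g \<le> (1 + \<theta>) * group_mass B n (u \<frown> b) g"
        if "u \<frown> a \<in> X" "u \<frown> b \<in> X" for a b g
        using group_mass_distortion[OF that, where j = l and n = n and B = B and g = g] lu l by (simp add: \<theta>_def conc_def)
      have near: "\<bar>f1 g - f0 g\<bar> \<le> \<theta> * f0 g" for g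
      proof -
        have a: "f1 g \<le> (1 + \<theta>) * f0 g" "f0 g \<le> (1 + \<theta>) * f1 g"
          unfolding f0_def f1_def translate_def using e0 e1 by (auto intro!: close simp del: conc_conc)
        have "f1 g \<ge> (1 - \<theta>) * f0 g"
        proof -
          have "\<theta> \<le> 1" using \<theta> eps power_le_one[of \<epsilon> 2] by linarith
          then have "(1 - \<theta>) * f0 g \<le> (1 - \<theta>) * ((1 + \<theta>) * f1 g)"
            using a by (intro mult_left_mono) auto
          also have "\<dots> = f1 g - \<theta>\<^sup>2 * f1 g" by (simp add: power2_eq_square algebra_simps)
          also have "\<dots> \<le> f1 g" by (simp add: f1_def translate_def group_mass_nonneg)
          finally show ?thesis .
        qed
        with a show ?thesis by (simp add: abs_le_iff algebra_simps)
      qed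
      have gap: "norm2 (\<lambda>g. f0 g + translate y f1 g) \<le> (1 - \<gamma>) * (norm2 f0 + norm2 f1)"
        unfolding \<gamma>_def by (rule norm2_pair_gap) (use f0 f1 yc eps \<theta> near y in auto)
      have \<xi>0: "\<xi> ?w0 g = translate q f0 g" if "g \<in> carrier G" for g
        unfolding \<xi>_def f0_def using e0 uc pq that
        by (simp add: val0 translate_translate m_assoc)
      have \<xi>1: "\<xi> ?w1 g = translate q (translate y f1) g" if "g \<in> carrier G" for g
        unfolding \<xi>_def f1_def using e1 uc pq yc that
        by (simp add: v1 translate_def m_assoc inv_mult_group)
      have W01: "?w0 \<in> ?W" "?w1 \<in> ?W" using e0 e1 by (auto simp: R_def)
      have gap': "norm2 (\<lambda>g. \<xi> ?w0 g + \<xi> ?w1 g) \<le> (1 - \<gamma>) * (norm2 (\<xi> ?w0) + norm2 (\<xi> ?w1))"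
      proof -
        have "norm2 (\<lambda>g. \<xi> ?w0 g + \<xi> ?w1 g) = norm2 (translate q (\<lambda>g. f0 g + translate y f1 g))"
          by (rule norm2_cong) (use \<xi>0 \<xi>1 in \<open>simp add: translate_def\<close>)
        also have "\<dots> = norm2 (\<lambda>g. f0 g + translate y f1 g)" using pq by simp
        also note gap
        also have "norm2 f0 = norm2 (\<xi> ?w0)" using norm2_cong[OF \<xi>0] pq by simp
        also have "norm2 f1 = norm2 (\<xi> ?w1)" using norm2_cong[OF \<xi>1] pq yc by simp
        finally show ?thesis .
      qed
      define b where "b = \<Phi> l (u \<frown> v0 \<frown> x)"
      have b: "b > 0" using e0 birkhoff_pos by (simp add: b_def)
      have c_split: "c (u @ v) = \<Phi> l (u \<frown> v \<frown> x) * \<Phi> N (v \<frown> x)" for v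
        unfolding c_def m_def using birkhoff_prod_conc[OF lu(1), of \<phi> N "v \<frown> x"] by simp
      have comp: "\<Phi> l (u \<frown> a) \<le> exp D * \<Phi> l (u \<frown> a')" if "u \<frown> a \<in> X" "u \<frown> a' \<in> X" for a a'
        by (rule birkhoff_distortion_0[OF that]) (simp add: lu)
      have csum: "(\<Sum>w\<in>R u. c w) \<le> exp D * b * \<Lambda> ^ N"
      proof -
        let ?V = "{v \<in> preimage_words B N x. u \<frown> v \<frown> x \<in> X}"
        have "R u = (\<lambda>v. u @ v) ` ?V"
        proof (intro equalityI subsetI)
          fix w assume w: "w \<in> R u"
          then have eq: "w = u @ drop l w" unfolding R_def by (metis (mono_tags, lifting) append_take_drop_id mem_Collect_eq)
          moreover have "drop l w \<in> ?V"
          proof -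
            have "u \<frown> drop l w \<frown> x \<in> X" using w eq by (simp add: R_def preimage_words_def)
            then show ?thesis using w conc_in_X_suffix[of u "drop l w \<frown> x"]
              by (auto simp: R_def preimage_words_def m_def dest: in_set_dropD)
          qed
          ultimately show "w \<in> (\<lambda>v. u @ v) ` ?V" by blast
        next
          fix w assume "w \<in> (\<lambda>v. u @ v) ` ?V"
          then show "w \<in> R u" using lu by (auto simp: R_def preimage_words_def m_def)
        qed
        then have "(\<Sum>w\<in>R u. c w) = (\<Sum>v\<in>?V. \<Phi> l (u \<frown> v \<frown> x) * \<Phi> N (v \<frown> x))"
          by (simp add: sum.reindex inj_on_def c_split del: conc_conc)
        also have "\<dots> \<le> (\<Sum>v\<in>?V. exp D * b * \<Phi> N (v \<frown> x))"
          unfolding b_def using e0 comp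
          by (intro sum_mono mult_right_mono) (auto intro: less_imp_le[OF preimage_words_pos] simp del: conc_conc)
        also have "\<dots> \<le> (\<Sum>v\<in>preimage_words B N x. exp D * b * \<Phi> N (v \<frown> x))"
          using B b by (intro sum_mono2) (auto intro!: mult_nonneg_nonneg less_imp_le[OF preimage_words_pos])
        also have "\<dots> = exp D * b * word_mass B N x" by (simp add: word_mass_def sum_distrib_left)
        also have "\<dots> \<le> exp D * b * \<Lambda> ^ N"
          using word_mass_le[OF B(1) x] b by (intro mult_left_mono) auto
        finally show ?thesis .
      qed
      have \<kappa>c: "\<kappa> * (\<Sum>w\<in>R u. c w) \<le> exp (- D) * b * \<omega>"
      proof -
        have "\<kappa> * (\<Sum>w\<in>R u. c w) \<le> \<kappa> * (exp D * b * \<Lambda> ^ N)"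
          using \<kappa> csum by (intro mult_left_mono) auto
        also have "\<dots> = (exp (- (2 * D)) * exp D) * b * \<omega>" using \<Lambda> by (simp add: \<kappa>_def)
        also have "exp (- (2 * D)) * exp D = exp (- D)" by (simp flip: exp_add)
        finally show ?thesis .
      qed
      have cw: "exp (- D) * b * \<omega> \<le> c (u @ v)" if v: "v \<in> V" "bridge i v (x 0)" for v
      proof -
        note e = ext[OF v]
        have "exp (- D) * b \<le> \<Phi> l (u \<frown> v \<frown> x)"
          using comp[of "v0 \<frown> x" "v \<frown> x"] e e0 by (simp add: b_def exp_minus field_simps del: conc_conc)
        moreover have "\<omega> \<le> \<Phi> N (v \<frown> x)" using \<omega>(2)[OF v(1)] e V(2)[OF v(1)] by simp
        ultimately show ?thesis unfolding c_split
          using b \<omega>(1) less_imp_le[OF birkhoff_pos] e by (intro mult_mono) auto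
      qed
      have "norm2 (\<lambda>g. \<Sum>w\<in>R u. c w * \<xi> w g)
          \<le> (1 - \<kappa> * \<gamma> / exp D) * (\<Sum>w\<in>R u. c w * norm2 (\<xi> w))"
      proof (rule norm2_sum_gap[of "R u" ?w0 ?w1])
        show "finite (R u)" using B by (simp add: R_def)
        show "\<kappa> * (\<Sum>w\<in>R u. c w) \<le> c ?w0" using \<kappa>c cw[OF v0 br0] by linarith
        show "\<kappa> * (\<Sum>w\<in>R u. c w) \<le> c ?w1" using \<kappa>c cw[OF v1(1,2)] by linarith
        fix w assume w: "w \<in> R u"
        then have "w \<in> ?W" "u = take l w" by (simp_all add: R_def)
        then have wW: "w \<in> ?W" "w = u @ drop l w" by simp_all
        have "norm2 (group_mass B n (w \<frown> x)) \<le> norm2 (\<lambda>g. exp D * group_mass B n (u \<frown> v0 \<frown> x) g)"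
        proof (rule norm2_mono)
          fix g
          have wx: "u \<frown> drop l w \<frown> x \<in> X" using wW by (simp add: preimage_words_def)
          have "group_mass B n (u \<frown> drop l w \<frown> x) g \<le> (1 + \<theta>) * group_mass B n (u \<frown> v0 \<frown> x) g"
            by (rule close[OF wx]) (use e0 in blast)
          also have "\<dots> \<le> exp D * group_mass B n (u \<frown> v0 \<frown> x) g"
          proof (rule mult_right_mono)
            have "D * r ^ l \<le> D" using D_nonneg r by (intro mult_left_le) (auto simp: power_le_one)
            then show "1 + \<theta> \<le> exp D" by (simp add: \<theta>_def)
          qed (rule group_mass_nonneg)
          finally show "\<bar>group_mass B n (w \<frown> x) g\<bar> \<le> exp D * group_mass B n (u \<frown> v0 \<frown> x) g"
            using wW(2) group_mass_nonneg by simp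
        qed (use B in \<open>auto intro!: finite_gsupp_scale\<close>)
        then show "norm2 (\<xi> w) \<le> exp D * norm2 (\<xi> ?w0)"
          using n\<xi>[OF wW(1)] n\<xi>[OF W01(1)] by (simp add: norm2_scale)
      qed (use e0 e1 ne gap' \<gamma> \<kappa> fin\<xi> c0 in \<open>auto simp: R_def less_imp_le\<close>)
      also have "\<dots> \<le> (1 - \<delta>) * (\<Sum>w\<in>R u. c w * norm2 (\<xi> w))"
        using \<delta> by (intro mult_right_mono sum_nonneg mult_nonneg_nonneg) (auto simp: R_def less_imp_le[OF c0])
      finally show ?thesis .
    qed
    have finW: "finite ?W" using B by simp
    have "norm2 (group_mass B (n + m) x) = norm2 (\<lambda>g. \<Sum>w\<in>?W. c w * \<xi> w g)"
      unfolding c_def \<xi>_def by (rule norm2_cong) (rule group_mass_add[OF B(1)])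
    also have "\<dots> = norm2 (\<lambda>g. \<Sum>u\<in>take l ` ?W. \<Sum>w\<in>R u. c w * \<xi> w g)"
      unfolding R_def sum.image_gen[OF finW, where g = "take l"] by simp
    also have "\<dots> \<le> (\<Sum>u\<in>take l ` ?W. norm2 (\<lambda>g. \<Sum>w\<in>R u. c w * \<xi> w g))"
      using finW fin\<xi> by (intro norm2_sum) (auto intro!: finite_gsupp simp: R_def)
    also have "\<dots> \<le> (\<Sum>u\<in>take l ` ?W. (1 - \<delta>) * (\<Sum>w\<in>R u. c w * norm2 (\<xi> w)))"
      by (rule sum_mono[OF fibre])
    also have "\<dots> = (1 - \<delta>) * (\<Sum>u\<in>take l ` ?W. \<Sum>w\<in>R u. c w * norm2 (\<xi> w))"
      by (simp add: sum_distrib_left)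
    also have "(\<Sum>u\<in>take l ` ?W. \<Sum>w\<in>R u. c w * norm2 (\<xi> w)) = (\<Sum>w\<in>?W. c w * norm2 (\<xi> w))"
      unfolding R_def by (rule sum.image_gen[OF finW, symmetric])
    also have "\<dots> = (\<Sum>w\<in>?W. \<Phi> m (w \<frown> x) * norm2 (group_mass B n (w \<frown> x)))"
      using n\<xi> by (simp add: c_def)
    finally show ?thesis .
  qed
  show ?thesis
  proof (rule that[OF _ \<delta>(1,2)])
    show "m > 0" using l by (simp add: m_def)
  qed (rule contraction)
qed

lemma group_mass_decay:
  assumes m: "m > 0" and \<delta>: "0 < \<delta>" "\<delta> < 1" and B: "finite B"
    and contr: "\<And>n x. x \<in> X \<Longrightarrow> norm2 (group_mass B (n + m) x)
        \<le> (1 - \<delta>) * (\<Sum>w\<in>preimage_words B m x. \<Phi> m (w \<frown> x) * norm2 (group_mass B n (w \<frown> x)))"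
    and x: "x \<in> X"
  shows "norm2 (group_mass B n x) \<le> (1 - \<delta>) ^ (n div m) * word_mass B n x"
  using x
proof (induction n arbitrary: x rule: less_induct)
  case (less n)
  show ?case
  proof (cases "n < m")
    case True
    then show ?thesis using norm2_group_mass_le[OF B less(2), of n] by simp
  next
    case False
    define k where "k = n - m"
    have n: "n = k + m" "n div m = Suc (k div m)" using False m by (auto simp: k_def le_div_geq)
    have "norm2 (group_mass B (k + m) x)
        \<le> (1 - \<delta>) * (\<Sum>w\<in>preimage_words B m x. \<Phi> m (w \<frown> x) * norm2 (group_mass B k (w \<frown> x)))"
      by (rule contr[OF less(2)])
    also have "\<dots> \<le> (1 - \<delta>) * (\<Sum>w\<in>preimage_words B m x.
        \<Phi> m (w \<frown> x) * ((1 - \<delta>) ^ (k div m) * word_mass B k (w \<frown> x)))"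
      using \<delta> m n
      by (intro mult_left_mono sum_mono less(1) less_imp_le[OF preimage_words_pos])
         (auto simp: preimage_words_def)
    also have "\<dots> = (1 - \<delta>) ^ Suc (k div m) * word_mass B (k + m) x"
      unfolding word_mass_add[OF B] by (simp add: sum_distrib_left mult_ac)
    finally show ?thesis unfolding n(2) n(1)[symmetric] .
  qed
qed

end

section \<open>Periodic points and pressure\<close>

lemma suffix_fixed_add:
  assumes "suffix n x = x"
  shows "x (n + k) = x k"
  using assms by (metis suffix_nth add.commute)

lemma periodic_point_eqI:
  assumes "suffix n x = x" "suffix n y = y" "n > 0" "\<And>k. k < n \<Longrightarrow> x k = y k"
  shows "x = y"
proof
  fix k
  show "x k = y k"
  proof (induction k rule: less_induct)
    case (less k)
    show ?case
    proof (cases "k < n")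
      case False
      then have "x k = x (k - n)" "y k = y (k - n)"
        using suffix_fixed_add[OF assms(1), of "k - n"] suffix_fixed_add[OF assms(2), of "k - n"] by simp_all
      then show ?thesis using less[of "k - n"] False assms(3) by simp
    qed (use assms(4) in simp)
  qed
qed

lemma infsum_ennreal_leI:
  fixes f :: "'b \<Rightarrow> ennreal"
  assumes "\<And>P. finite P \<Longrightarrow> P \<subseteq> A \<Longrightarrow> sum f P \<le> c"
  shows "infsum f A \<le> c"
  by (rule infsum_le_finite_sums[OF nonneg_summable_on_complete]) (use assms in auto)

lemma sum_le_infsum_ennreal:
  fixes f :: "'b \<Rightarrow> ennreal"
  assumes "finite P" "P \<subseteq> A"
  shows "sum f P \<le> infsum f A"
  by (subst nonneg_infsum_complete) (use assms in \<open>auto intro: SUP_upper\<close>)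

context markov_potential
begin

text \<open>A path from \<open>i\<close> to \<open>j\<close> lists its start but not its end, so that paths concatenate and a loop is the
  repeating block of a periodic point.\<close>

definition path :: "nat \<Rightarrow> 's \<Rightarrow> 's list \<Rightarrow> 's \<Rightarrow> bool" where
  "path n i w j \<longleftrightarrow> length w = n \<and> w \<noteq> [] \<and> hd w = i \<and> set w \<subseteq> S \<and> successively A (w @ [j])"

lemma path_append:
  assumes "path n i u j" "path m j w k"
  shows "path (n + m) i (u @ w) k"
  using assms by (auto simp: path_def successively_append_iff)

lemma path_single: "i \<in> S \<Longrightarrow> A i j \<Longrightarrow> path 1 i [i] j"
  by (simp add: path_def)

definition periodic :: "'s \<Rightarrow> nat \<Rightarrow> (nat \<Rightarrow> 's) set" where
  "periodic a n = {x \<in> X. x 0 = a \<and> suffix n x = x}"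

lemma periodic_birkhoff_nonneg: "x \<in> periodic a n \<Longrightarrow> \<Phi> m x \<ge> 0"
  by (rule less_imp_le[OF birkhoff_pos]) (simp add: periodic_def)

lemma iter_periodic:
  assumes "path n a w a"
  shows "w\<^sup>\<omega> \<in> periodic a n"
proof -
  have w: "length w = n" "w \<noteq> []" "hd w = a" "set w \<subseteq> S" and suc: "successively A (w @ [a])"
    using assms by (auto simp: path_def)
  have n: "n > 0" using w by auto
  have nth: "w\<^sup>\<omega> k = w ! (k mod n)" for k using n w by simp
  have step: "A (w\<^sup>\<omega> k) (w\<^sup>\<omega> (Suc k))" for k
  proof -
    define j where "j = k mod n"
    have j: "j < n" using n by (simp add: j_def)
    have "A ((w @ [a]) ! j) ((w @ [a]) ! Suc j)"
      using suc j w(1) by (simp add: successively_conv_nth)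
    moreover have "(w @ [a]) ! Suc j = w ! (Suc k mod n)"
    proof (cases "Suc j = n")
      case True
      then have "Suc k mod n = 0" by (simp add: j_def mod_Suc)
      then show ?thesis using True w by (simp add: nth_append hd_conv_nth)
    next
      case False
      then have "Suc k mod n = Suc j" by (simp add: j_def mod_Suc)
      then show ?thesis using False j w by (simp add: nth_append)
    qed
    ultimately show ?thesis using j w by (simp add: nth nth_append j_def)
  qed
  have "w\<^sup>\<omega> k \<in> S" for k
    unfolding nth using w n by (meson mod_less_divisor nth_mem subsetD)
  with step have "w\<^sup>\<omega> \<in> X" by (simp add: shift_space_def)
  moreover have "w\<^sup>\<omega> 0 = a" using nth[of 0] w by (simp add: hd_conv_nth)
  moreover have "suffix n w\<^sup>\<omega> = w\<^sup>\<omega>"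
    by (rule ext) (simp only: suffix_nth nth, simp)
  ultimately show ?thesis by (simp add: periodic_def)
qed

text \<open>A periodic point is determined by its first \<open>n\<close> symbols \<open>w\<close>, and by distortion its weight is comparable
  to that of \<open>w\<close> before \<open>x0\<close>, which starts with the same symbol \<open>a\<close>. The predicate \<open>Q\<close> serves to
  treat all periodic points and those of the extension at once.\<close>

lemma sum_periodic_le:
  assumes P: "finite P" "P \<subseteq> periodic a n" and n: "n > 0"
    and x0: "x0 \<in> X" "x0 0 = a"
    and B: "finite B" "\<And>x k. x \<in> P \<Longrightarrow> k < n \<Longrightarrow> x k \<in> B"
    and Q: "\<And>x. x \<in> P \<Longrightarrow> Q (prefix n x)"
  shows "(\<Sum>x\<in>P. \<Phi> n x) \<le> exp D * (\<Sum>w\<in>preimage_words B n x0. if Q w then \<Phi> n (w \<frown> x0) else 0)"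
proof -
  have inj: "inj_on (prefix n) P"
  proof (rule inj_onI)
    fix x y assume xy: "x \<in> P" "y \<in> P" "prefix n x = prefix n y"
    have "x k = y k" if "k < n" for k
      using subsequence_nth[of k n 0 x] subsequence_nth[of k n 0 y] xy(3) that by simp
    moreover have "suffix n x = x" "suffix n y = y" using xy(1,2) P(2) by (auto simp: periodic_def)
    ultimately show "x = y" using n periodic_point_eqI by blast
  qed
  have xX: "x \<in> X" "x 0 = a" "suffix n x = x" "prefix n x \<frown> x = x" if "x \<in> P" for x
  proof -
    show *: "x \<in> X" "x 0 = a" "suffix n x = x" using that P by (auto simp: periodic_def)
    show "prefix n x \<frown> x = x" using prefix_suffix[of x n] *(3) by simp
  qed
  have mem: "prefix n x \<in> preimage_words B n x0" if "x \<in> P" for x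
  proof -
    have "prefix n x \<frown> x0 \<in> X"
      using conc_in_X[OF xX(1)[OF that], of "prefix n x"] conc_in_X[OF x0(1), of "prefix n x"]
        xX[OF that] x0(2) by simp
    then show ?thesis using B(2)[OF that] by (auto simp: preimage_words_def)
  qed
  have "(\<Sum>x\<in>P. \<Phi> n x) \<le> (\<Sum>x\<in>P. exp D * \<Phi> n (prefix n x \<frown> x0))"
  proof (rule sum_mono)
    fix x assume x: "x \<in> P"
    show "\<Phi> n x \<le> exp D * \<Phi> n (prefix n x \<frown> x0)"
      by (rule birkhoff_distortion_0) (use xX[OF x] mem[OF x] in \<open>auto simp: preimage_words_def\<close>)
  qed
  also have "\<dots> = exp D * (\<Sum>w\<in>prefix n ` P. \<Phi> n (w \<frown> x0))"
    by (simp add: sum.reindex[OF inj] sum_distrib_left)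
  also have "(\<Sum>w\<in>prefix n ` P. \<Phi> n (w \<frown> x0)) = (\<Sum>w\<in>prefix n ` P. if Q w then \<Phi> n (w \<frown> x0) else 0)"
    using Q by (intro sum.cong) auto
  also have "\<dots> \<le> (\<Sum>w\<in>preimage_words B n x0. if Q w then \<Phi> n (w \<frown> x0) else 0)"
    using B mem by (intro sum_mono2) (auto intro: less_imp_le[OF preimage_words_pos])
  finally show ?thesis by simp
qed

text \<open>A preimage word \<open>w\<close> of \<open>x0\<close> can be followed by \<open>a\<close>; one of the finitely many connecting words \<open>c\<close> from
  \<open>a\<close> to the first symbol of \<open>w\<close> closes it to a loop. The word \<open>w\<close> is recovered from the periodic
  point as the symbols after the first \<open>M\<close>.\<close>

lemma word_mass_le_periodic:
  assumes V: "finite V" and conn: "\<And>j. j \<in> S \<Longrightarrow> \<exists>c\<in>V. path M a c j"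
    and x0: "x0 \<in> X" "x0 0 = a"
  obtains K where "K > 0"
    "\<And>B n. finite B \<Longrightarrow> n > 0 \<Longrightarrow>
      ennreal (word_mass B n x0) \<le> ennreal K * (\<Sum>\<^sub>\<infinity>x\<in>periodic a (M + n). ennreal (\<Phi> (M + n) x))"
proof -
  obtain \<omega> where \<omega>: "\<omega> > 0" "\<And>v x. v \<in> V \<Longrightarrow> v \<frown> x \<in> X \<Longrightarrow> \<omega> \<le> \<Phi> (length v) (v \<frown> x)"
    using birkhoff_lower_bound[OF V] by metis
  obtain c where c: "\<And>j. j \<in> S \<Longrightarrow> c j \<in> V \<and> path M a (c j) j"
    using conn by metis
  define K where "K = exp D / \<omega>"
  have K: "K > 0" using \<omega> by (simp add: K_def)
  have main: "ennreal (word_mass B n x0) \<le> ennreal K * (\<Sum>\<^sub>\<infinity>x\<in>periodic a (M + n). ennreal (\<Phi> (M + n) x))"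
    if B: "finite B" and n: "n > 0" for B n
  proof -
    let ?W = "preimage_words B n x0"
    define \<iota> where "\<iota> w = (c (hd w) @ w)\<^sup>\<omega>" for w
    have pth: "path n (hd w) w a" "hd w \<in> S" "length w = n" "w \<frown> x0 \<in> X" if "w \<in> ?W" for w
    proof -
      show *: "length w = n" "w \<frown> x0 \<in> X" using that by (auto simp: preimage_words_def)
      then have "set w \<subseteq> S" "successively A w" "w \<noteq> []" "A (last w) a"
        using conc_in_X[OF x0(1), of w] x0(2) n by auto
      then show "path n (hd w) w a" "hd w \<in> S"
        using * by (auto simp: path_def successively_append_iff)
    qed
    have cw: "length (c (hd w)) = M" if "w \<in> ?W" for w
      using c[OF pth(2)[OF that]] by (simp add: path_def)
    have \<iota>: "\<iota> w \<in> periodic a (M + n)" "\<iota> w = c (hd w) \<frown> w \<frown> \<iota> w" if w: "w \<in> ?W" for w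
    proof -
      show "\<iota> w \<in> periodic a (M + n)"
        unfolding \<iota>_def using c[OF pth(2)[OF w]] pth(1)[OF w] by (intro iter_periodic path_append) auto
      have "\<iota> w = (c (hd w) @ w) \<frown> \<iota> w"
        unfolding \<iota>_def by (rule iter_unroll) (use n pth(3)[OF w] in simp)
      then show "\<iota> w = c (hd w) \<frown> w \<frown> \<iota> w" by simp
    qed
    have inj: "inj_on \<iota> ?W"
    proof (rule inj_onI)
      fix w w' assume w: "w \<in> ?W" "w' \<in> ?W" "\<iota> w = \<iota> w'"
      have "w = prefix n (suffix M (\<iota> w))" if "w \<in> ?W" for w
      proof -
        have "suffix M (\<iota> w) = w \<frown> \<iota> w"
          by (subst \<iota>(2)[OF that]) (use cw[OF that] suffix_conc_length in metis)
        then show ?thesis using pth(3)[OF that] prefix_conc_length by metis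
      qed
      then show "w = w'" using w by metis
    qed
    have le: "\<Phi> n (w \<frown> x0) \<le> K * \<Phi> (M + n) (\<iota> w)" if w: "w \<in> ?W" for w
    proof -
      have \<iota>X: "\<iota> w \<in> X" using \<iota>(1)[OF w] by (simp add: periodic_def)
      then have 1: "c (hd w) \<frown> w \<frown> \<iota> w \<in> X" using \<iota>(2)[OF w] by simp
      then have 2: "w \<frown> \<iota> w \<in> X" by (rule conc_in_X_suffix)
      have "\<Phi> (M + n) (\<iota> w) = \<Phi> M (c (hd w) \<frown> w \<frown> \<iota> w) * \<Phi> n (w \<frown> \<iota> w)"
        using birkhoff_prod_conc[OF cw[OF w], of \<phi> n "w \<frown> \<iota> w"] \<iota>(2)[OF w] by simp
      moreover have "\<omega> \<le> \<Phi> M (c (hd w) \<frown> w \<frown> \<iota> w)"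
        using \<omega>(2)[OF _ 1] c[OF pth(2)[OF w]] cw[OF w] by simp
      ultimately have "\<omega> * \<Phi> n (w \<frown> \<iota> w) \<le> \<Phi> (M + n) (\<iota> w)"
        using less_imp_le[OF birkhoff_pos[OF 2, of n]] by (simp add: mult_right_mono)
      moreover have "\<Phi> n (w \<frown> x0) \<le> exp D * \<Phi> n (w \<frown> \<iota> w)"
        by (rule birkhoff_distortion_0[OF pth(4)[OF w] 2]) (simp add: pth(3)[OF w])
      ultimately have "\<Phi> n (w \<frown> x0) \<le> exp D * (\<Phi> (M + n) (\<iota> w) / \<omega>)"
        using \<omega>(1) by (smt (verit) exp_gt_zero mult_left_mono pos_le_divide_eq mult.commute)
      then show ?thesis by (simp add: K_def)
    qed
    have fin: "finite ?W" using B by simp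
    have \<iota>pos: "\<Phi> (M + n) (\<iota> w) \<ge> 0" if "w \<in> ?W" for w
      by (rule periodic_birkhoff_nonneg[OF \<iota>(1)[OF that]])
    have "word_mass B n x0 \<le> (\<Sum>w\<in>?W. K * \<Phi> (M + n) (\<iota> w))"
      unfolding word_mass_def by (rule sum_mono[OF le])
    also have "\<dots> = K * (\<Sum>x\<in>\<iota> ` ?W. \<Phi> (M + n) x)"
      by (simp add: sum.reindex[OF inj] sum_distrib_left)
    finally have "ennreal (word_mass B n x0) \<le> ennreal (K * (\<Sum>x\<in>\<iota> ` ?W. \<Phi> (M + n) x))"
      by (rule ennreal_leI)
    also have "\<dots> = ennreal K * (\<Sum>x\<in>\<iota> ` ?W. ennreal (\<Phi> (M + n) x))"
      using K \<iota>pos by (subst sum_ennreal) (auto intro!: ennreal_mult sum_nonneg)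
    also have "\<dots> \<le> ennreal K * (\<Sum>\<^sub>\<infinity>x\<in>periodic a (M + n). ennreal (\<Phi> (M + n) x))"
      using fin \<iota>(1) by (intro mult_left_mono sum_le_infsum_ennreal) auto
    finally show ?thesis .
  qed
  show ?thesis by (rule that[OF K main])
qed

lemma sum_periodic_le_power:
  assumes n: "n > 0" and x0: "x0 \<in> X" "x0 0 = a"
  shows "(\<Sum>\<^sub>\<infinity>x\<in>periodic a n. ennreal (\<Phi> n x)) \<le> ennreal (exp D * \<Lambda> ^ n)"
proof (rule infsum_ennreal_leI)
  fix P assume P: "finite P" "P \<subseteq> periodic a n"
  define B where "B = (\<Union>x\<in>P. x ` {..<n})"
  have B: "finite B" using P by (simp add: B_def)
  have "(\<Sum>x\<in>P. \<Phi> n x) \<le> exp D * (\<Sum>w\<in>preimage_words B n x0. if True then \<Phi> n (w \<frown> x0) else 0)"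
    by (rule sum_periodic_le[OF P n x0 B]) (auto simp: B_def)
  also have "\<dots> = exp D * word_mass B n x0" by (simp add: word_mass_def)
  also have "\<dots> \<le> exp D * \<Lambda> ^ n" using word_mass_le[OF B x0(1)] by simp
  finally have "ennreal (\<Sum>x\<in>P. \<Phi> n x) \<le> ennreal (exp D * \<Lambda> ^ n)" by (rule ennreal_leI)
  then show "(\<Sum>x\<in>P. ennreal (\<Phi> n x)) \<le> ennreal (exp D * \<Lambda> ^ n)"
    using periodic_birkhoff_nonneg P(2) by (subst sum_ennreal) auto
qed

end

text \<open>Exponential bounds on sums in place of bounds on scaled logarithms spare a treatment of the values
  \<open>0\<close> and \<open>\<infinity>\<close> wherever a pressure is estimated.\<close>

lemma scaled_ext_log_le_iff:
  assumes "n > 0"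
  shows "ereal (1 / real n) * ext_log s \<le> ereal c \<longleftrightarrow> s \<le> ennreal (exp (real n * c))"
proof (cases s)
  case (real x)
  show ?thesis
  proof (cases "x = 0")
    case True
    then show ?thesis using real assms by (simp add: ext_log_def)
  next
    case False
    then have x: "x > 0" using real by simp
    have "ereal (1 / real n) * ext_log s = ereal (ln x / real n)"
      using real x by (simp add: ext_log_def)
    also have "\<dots> \<le> ereal c \<longleftrightarrow> ln x \<le> real n * c"
      using assms by (simp add: divide_le_eq mult.commute)
    also have "\<dots> \<longleftrightarrow> x \<le> exp (real n * c)" using x by (metis exp_le_cancel_iff exp_ln)
    also have "\<dots> \<longleftrightarrow> s \<le> ennreal (exp (real n * c))" using real by (simp add: ennreal_le_iff)
    finally show ?thesis .
  qed
next
  case top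
  then show ?thesis using assms by (simp add: ext_log_def top_unique)
qed

lemma limsup_ext_log_gap:
  fixes Q R :: "nat \<Rightarrow> ennreal"
  assumes p: "limsup (\<lambda>n. ereal (1 / real n) * ext_log (R n)) = ereal p"
    and \<rho>: "0 < \<rho>" "\<rho> < 1" and m: "m > 0" and K: "K > 0"
    and le: "\<And>n. n > 0 \<Longrightarrow> Q n \<le> ennreal (K * \<rho> ^ (n div m)) * R (M + n)"
  shows "limsup (\<lambda>n. ereal (1 / real n) * ext_log (Q n)) < ereal p"
proof -
  \<comment> \<open>The exponential loss per step is \<open>4 * \<tau>\<close>: one \<open>\<tau>\<close> pays for the limes superior of \<open>R\<close>, one for the
    constants, and at least one remains.\<close>
  define \<tau> where "\<tau> = - ln \<rho> / (4 * real m)"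
  have \<tau>: "\<tau> > 0" using \<rho> m by (simp add: \<tau>_def divide_less_0_iff)
  define c0 where "c0 = ln K + 4 * \<tau> * real m + real M * (p + \<tau>)"
  have "\<forall>\<^sub>F n in sequentially. ereal (1 / real n) * ext_log (R n) < ereal (p + \<tau>)"
    by (rule Limsup_lessD) (use p \<tau> in simp)
  then have "\<forall>\<^sub>F n in sequentially. R n \<le> ennreal (exp (real n * (p + \<tau>)))"
    using eventually_gt_at_top[of 0]
    by eventually_elim (use scaled_ext_log_le_iff in \<open>blast intro: less_imp_le\<close>)
  then have evR: "\<forall>\<^sub>F n in sequentially. R (n + M) \<le> ennreal (exp (real (n + M) * (p + \<tau>)))"
    by (rule eventually_compose_filterlim) (rule filterlim_add_const_nat_at_top)
  have evc: "\<forall>\<^sub>F n in sequentially. c0 \<le> real n * \<tau>"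
  proof -
    have "\<forall>\<^sub>F n in sequentially. c0 / \<tau> \<le> real n"
      using filterlim_real_sequentially by (simp add: filterlim_at_top)
    then show ?thesis by eventually_elim (use \<tau> in \<open>simp add: pos_divide_le_eq\<close>)
  qed
  have "\<forall>\<^sub>F n in sequentially. ereal (1 / real n) * ext_log (Q n) \<le> ereal (p - \<tau>)"
    using evR evc eventually_gt_at_top[of 0]
  proof eventually_elim
    case (elim n)
    have "real n \<le> real m * (real (n div m) + 1)"
    proof -
      have "n \<le> m * (n div m + 1)" using m by (metis add.commute dividend_less_times_div less_imp_le mult_Suc_right Suc_eq_plus1)
      then have "real n \<le> real (m * (n div m + 1))" by (simp only: of_nat_le_iff)
      then show ?thesis by (simp add: algebra_simps)
    qed
    then have "4 * \<tau> * real n \<le> 4 * \<tau> * (real m * (real (n div m) + 1))"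
      using \<tau> by (intro mult_left_mono) auto
    also have "\<dots> = - ln \<rho> * real (n div m) + 4 * \<tau> * real m"
      using m by (simp add: \<tau>_def field_simps)
    finally have exponent: "real (n div m) * ln \<rho> \<le> 4 * \<tau> * real m - 4 * \<tau> * real n"
      by (simp add: algebra_simps)
    have "K * \<rho> ^ (n div m) = exp (ln K + real (n div m) * ln \<rho>)"
      using K \<rho> by (simp add: exp_add exp_of_nat_mult)
    also have "\<dots> \<le> exp (ln K + (4 * \<tau> * real m - 4 * \<tau> * real n))" using exponent by simp
    finally have factor: "K * \<rho> ^ (n div m) \<le> exp (ln K + (4 * \<tau> * real m - 4 * \<tau> * real n))" .
    have "Q n \<le> ennreal (K * \<rho> ^ (n div m)) * R (M + n)" using le elim by simp
    also have "\<dots> \<le> ennreal (exp (ln K + (4 * \<tau> * real m - 4 * \<tau> * real n)))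
        * ennreal (exp (real (n + M) * (p + \<tau>)))"
      using elim factor by (intro mult_mono ennreal_leI) (auto simp: add.commute)
    also have "\<dots> = ennreal (exp (c0 + real n * (p - 3 * \<tau>)))"
      by (simp add: ennreal_mult[symmetric] exp_add[symmetric] c0_def algebra_simps)
    also have "\<dots> \<le> ennreal (exp (real n * (p - \<tau>)))"
    proof -
      have "0 \<le> real n * \<tau>" using \<tau> by simp
      then show ?thesis using elim by (intro ennreal_leI) (simp add: algebra_simps)
    qed
    finally show ?case using scaled_ext_log_le_iff elim by blast
  qed
  then have "limsup (\<lambda>n. ereal (1 / real n) * ext_log (Q n)) \<le> ereal (p - \<tau>)"
    by (rule Limsup_bounded)
  also have "\<dots> < ereal p" using \<tau> by simp
  finally show ?thesis .
qed

context markov_potential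
begin

text \<open>The Ruelle operator bounds the pressure from above, and the repetitions of a single loop from below.
  Finiteness is what turns an exponential gap between sums into a strict inequality of pressures.\<close>

lemma periodic_pressure_finite:
  assumes q: "path q a w a"
  shows "\<exists>p. limsup (\<lambda>n. ereal (1 / real n) * ext_log (\<Sum>\<^sub>\<infinity>x\<in>periodic a n. ennreal (\<Phi> n x))) = ereal p"
    (is "\<exists>p. ?L = ereal p")
proof -
  let ?R = "\<lambda>n. \<Sum>\<^sub>\<infinity>x\<in>periodic a n. ennreal (\<Phi> n x)"
  define z where "z = w\<^sup>\<omega>"
  have z: "z \<in> X" "z 0 = a" "suffix q z = z" and q0: "q > 0"
    using iter_periodic[OF q] q by (auto simp: z_def periodic_def path_def)
  have "?L \<le> ereal (D + \<bar>ln \<Lambda>\<bar>)"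
  proof (rule Limsup_bounded)
    show "\<forall>\<^sub>F n in sequentially. ereal (1 / real n) * ext_log (?R n) \<le> ereal (D + \<bar>ln \<Lambda>\<bar>)"
      using eventually_gt_at_top[of 0]
    proof eventually_elim
      case (elim n)
      have "exp D * \<Lambda> ^ n = exp (D + real n * ln \<Lambda>)"
        using \<Lambda> by (simp add: exp_add exp_of_nat_mult)
      also have "\<dots> \<le> exp (real n * (D + \<bar>ln \<Lambda>\<bar>))"
      proof -
        have "D \<le> real n * D" using D_nonneg elim by (simp add: mult_le_cancel_right1)
        moreover have "real n * ln \<Lambda> \<le> real n * \<bar>ln \<Lambda>\<bar>" by (intro mult_left_mono) auto
        ultimately show ?thesis by (simp add: algebra_simps)
      qed
      finally have "?R n \<le> ennreal (exp (real n * (D + \<bar>ln \<Lambda>\<bar>)))"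
        using sum_periodic_le_power[OF elim z(1,2)] by (meson ennreal_leI order_trans)
      then show ?case using scaled_ext_log_le_iff[OF elim] by blast
    qed
  qed
  moreover have "?L \<noteq> -\<infinity>"
  proof
    assume L: "?L = -\<infinity>"
    define c where "c = ln (\<Phi> q z) / real q"
    have "\<forall>\<^sub>F n in sequentially. ereal (1 / real n) * ext_log (?R n) < ereal (c - 1)"
      by (rule Limsup_lessD) (use L in simp)
    then obtain N where N: "\<forall>n\<ge>N. ereal (1 / real n) * ext_log (?R n) < ereal (c - 1)"
      unfolding eventually_sequentially ..
    define n where "n = Suc N * q"
    have "Suc N * 1 \<le> n" unfolding n_def using q0 by (intro mult_le_mono2) simp
    then have n: "n \<ge> N" "n > 0" by simp_all
    have per: "suffix (k * q) z = z" "\<Phi> (k * q) z = \<Phi> q z ^ k" for k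
    proof (induction k)
      case (Suc k)
      { case 1 show ?case using Suc(1) z(3) by (metis mult_Suc suffix_suffix) }
      { case 2 show ?case using Suc(2) z(3) by (simp add: birkhoff_prod_add) }
    qed auto
    have "ennreal (\<Phi> n z) \<le> ?R n"
      using sum_le_infsum_ennreal[of "{z}" "periodic a n" "\<lambda>x. ennreal (\<Phi> n x)"] z per(1)[of "Suc N"]
      by (simp add: periodic_def n_def)
    also have "\<dots> \<le> ennreal (exp (real n * (c - 1)))"
      using less_imp_le[OF N[rule_format, OF n(1)]] scaled_ext_log_le_iff[OF n(2)] by blast
    finally have "\<Phi> n z \<le> exp (real n * (c - 1))" by (simp add: ennreal_le_iff)
    moreover have "\<Phi> n z = exp (real n * c)"
    proof -
      have "real n * c = real (Suc N) * ln (\<Phi> q z)" using q0 by (simp add: n_def c_def field_simps)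
      then show ?thesis
        using per(2)[of "Suc N"] birkhoff_pos[OF z(1), of q] by (simp only: exp_of_nat_mult exp_ln n_def)
    qed
    ultimately show False using n(2) by (simp add: algebra_simps)
  qed
  ultimately show ?thesis by (cases ?L) auto
qed

end

section \<open>Extensions with big images and preimages\<close>

text \<open>The topological hypotheses in terms of words: mixing and the b.i.p. set \<open>J\<close> for the base, and for the
  extension only that every group element is the value of a loop at \<open>a\<close>. The point \<open>x0\<close> of \<open>[a]\<close> is
  the one at which weights are compared.\<close>

locale bip_extension = labelled_markov_potential S A \<phi> r C \<Lambda> G letter
  for S :: "'s set" and A \<phi> r C \<Lambda> and G :: "('g, 'm) monoid_scheme" (structure) and letter +
  fixes J :: "'s set" and a :: 's and x0 :: "nat \<Rightarrow> 's"
  assumes J: "finite J" "J \<subseteq> S" and a: "a \<in> S"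
    and image: "v \<in> S \<Longrightarrow> \<exists>\<beta>\<in>J. A v \<beta>"
    and preimage: "v \<in> S \<Longrightarrow> \<exists>\<beta>\<in>J. A \<beta> v"
    and mixing: "i \<in> S \<Longrightarrow> j \<in> S \<Longrightarrow> \<exists>N. \<forall>n\<ge>N. \<exists>w. path n i w j"
    and transitive: "g \<in> carrier G \<Longrightarrow> \<exists>n w. path n a w a \<and> val w = g"
    and x0: "x0 \<in> X" "x0 0 = a"
begin

definition loop :: "nat \<Rightarrow> 'g \<Rightarrow> bool" where
  "loop n g \<longleftrightarrow> (\<exists>w. path n a w a \<and> val w = g)"

lemma loop_mult:
  assumes "loop n g" "loop m h"
  shows "loop (n + m) (g \<otimes> h)"
proof -
  obtain u w where "path n a u a" "val u = g" "path m a w a" "val w = h"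
    using assms by (auto simp: loop_def)
  moreover from this have "val (u @ w) = g \<otimes> h"
    using val_append[of u w] by (simp add: path_def)
  ultimately show ?thesis unfolding loop_def using path_append by blast
qed

lemma loop_closed: "loop n g \<Longrightarrow> g \<in> carrier G"
  by (auto simp: loop_def path_def val_closed)

lemma common_connection_length:
  obtains N where "\<And>\<beta>. \<beta> \<in> J \<Longrightarrow> \<exists>w. path N \<beta> w a" "\<And>\<beta>. \<beta> \<in> J \<Longrightarrow> \<exists>w. path N a w \<beta>"
proof -
  have "\<forall>\<beta>\<in>J. \<forall>\<^sub>F n in sequentially. (\<exists>w. path n \<beta> w a) \<and> (\<exists>w. path n a w \<beta>)"
  proof
    fix \<beta> assume "\<beta> \<in> J"
    then have "\<beta> \<in> S" using J by blast
    then show "\<forall>\<^sub>F n in sequentially. (\<exists>w. path n \<beta> w a) \<and> (\<exists>w. path n a w \<beta>)"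
      using mixing[of \<beta> a] mixing[of a \<beta>] a
      by (intro eventually_conj) (auto simp: eventually_sequentially)
  qed
  then have "\<forall>\<^sub>F n in sequentially. \<forall>\<beta>\<in>J. (\<exists>w. path n \<beta> w a) \<and> (\<exists>w. path n a w \<beta>)"
    using J by (simp add: eventually_ball_finite_distrib)
  then obtain N where "\<forall>\<beta>\<in>J. (\<exists>w. path N \<beta> w a) \<and> (\<exists>w. path N a w \<beta>)"
    unfolding eventually_sequentially by auto
  with that show ?thesis by blast
qed

definition group_periodic :: "nat \<Rightarrow> (nat \<Rightarrow> 's) set" where
  "group_periodic n = {x \<in> periodic a n. val (prefix n x) = \<one>}"

text \<open>Otherwise every vector is moved by some element of \<open>Y\<close> other than the identity. The bridges from \<open>i\<close> to
  \<open>j\<close> required for the contraction run through \<open>J\<close>: a symbol \<open>\<beta>\<close> after \<open>i\<close>, a path from \<open>\<beta>\<close> to \<open>a\<close>, a loop with the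
  prescribed value, a path from \<open>a\<close> to a symbol \<open>\<beta>'\<close> before \<open>j\<close>. As \<open>J\<close> and \<open>Y\<close> are finite
  there are finitely many such words. The resulting decay separates the two pressures.\<close>

lemma almost_invariant_vector:
  assumes pressure_eq:
      "limsup (\<lambda>n. ereal (1 / real n) * ext_log (\<Sum>\<^sub>\<infinity>x\<in>group_periodic n. ennreal (\<Phi> n x)))
        = limsup (\<lambda>n. ereal (1 / real n) * ext_log (\<Sum>\<^sub>\<infinity>x\<in>periodic a n. ennreal (\<Phi> n x)))"
    and Y: "finite Y" and one: "loop N \<one>" and loopY: "\<And>y. y \<in> Y \<Longrightarrow> loop N y"
    and eps: "0 < \<epsilon>" "\<epsilon> \<le> 1"
  shows "\<exists>\<xi>. finite (gsupp \<xi>) \<and> norm2 \<xi> > 0 \<and>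
      (\<forall>y\<in>Y. norm2 (\<lambda>g. translate y \<xi> g - \<xi> g) \<le> \<epsilon> * norm2 \<xi>)"
proof (rule ccontr)
  assume contra: "\<not> ?thesis"
  define Y' where "Y' = Y - {\<one>}"
  have Yc: "Y' \<subseteq> carrier G" using loopY loop_closed by (auto simp: Y'_def)
  have far: "\<exists>y\<in>Y'. \<epsilon> * norm2 \<xi> \<le> norm2 (\<lambda>g. translate y \<xi> g - \<xi> g)"
    if fin: "finite (gsupp \<xi>)" and pos: "norm2 \<xi> > 0" for \<xi>
  proof -
    obtain y where y: "y \<in> Y" "\<epsilon> * norm2 \<xi> < norm2 (\<lambda>g. translate y \<xi> g - \<xi> g)"
      using contra fin pos by (auto simp: not_le)
    have "y \<noteq> \<one>"
    proof
      assume "y = \<one>"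
      then have "norm2 (\<lambda>g. translate y \<xi> g - \<xi> g) = norm2 (\<lambda>_. 0)"
        by (intro norm2_cong) (simp add: translate_one)
      then have "norm2 (\<lambda>g. translate y \<xi> g - \<xi> g) = 0" by (simp add: norm2_def gsupp_def)
      then show False using y eps pos by (simp add: mult_less_0_iff)
    qed
    with y show ?thesis by (auto simp: Y'_def intro: less_imp_le)
  qed
  have Yne: "Y' \<noteq> {}"
  proof -
    have supp: "gsupp (\<lambda>g. if g = \<one> then 1 else 0) = {\<one>}" by (auto simp: gsupp_def)
    then have "norm2 (\<lambda>g. if g = \<one> then 1 else 0) = 1" by (simp add: norm2_def)
    then show ?thesis using far[of "\<lambda>g. if g = \<one> then 1 else 0"] supp by auto
  qed
  have far': "\<exists>y\<in>Y'. \<epsilon> * norm2 \<xi> \<le> norm2 (\<lambda>g. translate y \<xi> g - \<xi> g)"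
    if "finite (gsupp \<xi>)" for \<xi>
  proof (cases "norm2 \<xi> > 0")
    case False
    then have "norm2 \<xi> = 0" using norm2_nonneg[of \<xi>] by linarith
    then show ?thesis using Yne by auto
  qed (use far that in blast)
  obtain N1 where N1: "\<And>\<beta>. \<beta> \<in> J \<Longrightarrow> \<exists>w. path N1 \<beta> w a" "\<And>\<beta>. \<beta> \<in> J \<Longrightarrow> \<exists>w. path N1 a w \<beta>"
    using common_connection_length by blast
  obtain b where b: "\<And>\<beta>. \<beta> \<in> J \<Longrightarrow> path N1 \<beta> (b \<beta>) a" using N1(1) by metis
  obtain c where c: "\<And>\<beta>. \<beta> \<in> J \<Longrightarrow> path N1 a (c \<beta>) \<beta>" using N1(2) by metis
  have "\<And>y. y \<in> insert \<one> Y \<Longrightarrow> \<exists>w. path N a w a \<and> val w = y"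
    using one loopY by (auto simp: loop_def)
  then obtain W where W: "\<And>y. y \<in> insert \<one> Y \<Longrightarrow> path N a (W y) a \<and> val (W y) = y" by metis
  define out where "out \<beta> = c \<beta> @ [\<beta>]" for \<beta>
  have out: "path (N1 + 1) a (out \<beta>) j" if "\<beta> \<in> J" "A \<beta> j" for \<beta> j
    unfolding out_def using that J by (intro path_append[OF c] path_single) auto
  define word where "word \<beta> y \<beta>' = b \<beta> @ W y @ out \<beta>'" for \<beta> y \<beta>'
  define V where "V = (\<lambda>(\<beta>, y, \<beta>'). word \<beta> y \<beta>') ` (J \<times> insert \<one> Y \<times> J)"
  have finV: "finite V" using J Y by (simp add: V_def)
  have word_path: "path (N1 + (N + (N1 + 1))) \<beta> (word \<beta> y \<beta>') j"
    if "\<beta> \<in> J" "y \<in> insert \<one> Y" "\<beta>' \<in> J" "A \<beta>' j" for \<beta> y \<beta>' j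
    unfolding word_def
    by (rule path_append[OF b[OF that(1)] path_append[OF conjunct1[OF W[OF that(2)]] out[OF that(3,4)]]])
  have lenV: "length v = N1 + (N + (N1 + 1))" if v: "v \<in> V" for v
  proof -
    have lens: "length (b \<beta>) = N1" "length (out \<beta>) = N1 + 1" if "\<beta> \<in> J" for \<beta>
      using b[OF that] c[OF that] by (auto simp: path_def out_def)
    have "length (W y) = N" if "y \<in> insert \<one> Y" for y using W[OF that] by (simp add: path_def)
    then show ?thesis using v lens by (auto simp: V_def word_def)
  qed
  have conn: "\<exists>v0\<in>V. \<exists>p\<in>carrier G. \<exists>q\<in>carrier G. bridge i v0 j \<and> val v0 = p \<otimes> q \<and>
        (\<forall>y\<in>Y'. \<exists>v\<in>V. bridge i v j \<and> val v = p \<otimes> y \<otimes> q)"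
    if ij: "i \<in> S" "j \<in> S" for i j
  proof -
    obtain \<beta> where \<beta>: "\<beta> \<in> J" "A i \<beta>" using image ij by blast
    obtain \<beta>' where \<beta>': "\<beta>' \<in> J" "A \<beta>' j" using preimage ij by blast
    have "set (b \<beta>) \<subseteq> S" "set (out \<beta>') \<subseteq> S" using b[OF \<beta>(1)] out[OF \<beta>'] by (auto simp: path_def)
    note sets = this
    then have pq: "val (b \<beta>) \<in> carrier G" "val (out \<beta>') \<in> carrier G" by (auto intro: val_closed)
    have br: "bridge i (word \<beta> y \<beta>') j \<and> val (word \<beta> y \<beta>') = val (b \<beta>) \<otimes> y \<otimes> val (out \<beta>')
        \<and> word \<beta> y \<beta>' \<in> V" if y: "y \<in> insert \<one> Y" for y
    proof -
      have "path (N1 + (N + (N1 + 1))) \<beta> (word \<beta> y \<beta>') j" using \<beta> \<beta>' y by (intro word_path)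
      then have "bridge i (word \<beta> y \<beta>') j"
        using \<beta> by (cases "word \<beta> y \<beta>'") (auto simp: path_def bridge_def)
      moreover have "set (W y) \<subseteq> S" "val (W y) = y" using W[OF y] by (auto simp: path_def)
      moreover have "y \<in> carrier G" using y loopY loop_closed by auto
      moreover have "word \<beta> y \<beta>' \<in> V"
        unfolding V_def using \<beta> \<beta>' y by (intro image_eqI[of _ _ "(\<beta>, y, \<beta>')"]) auto
      ultimately show ?thesis
        using sets pq by (auto simp: word_def val_append m_assoc)
    qed
    have "val (word \<beta> \<one> \<beta>') = val (b \<beta>) \<otimes> val (out \<beta>')" using br[of \<one>] pq by simp
    moreover have "\<forall>y\<in>Y'. \<exists>v\<in>V. bridge i v j \<and> val v = val (b \<beta>) \<otimes> y \<otimes> val (out \<beta>')"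
      using br by (auto simp: Y'_def)
    ultimately show ?thesis using br[of \<one>] pq by blast
  qed
  obtain m \<delta> where m: "m > 0" and \<delta>: "0 < \<delta>" "\<delta> < 1" and contr:
    "\<And>B n x. finite B \<Longrightarrow> (\<Union>v\<in>V. set v) \<subseteq> B \<Longrightarrow> x \<in> X \<Longrightarrow>
      norm2 (group_mass B (n + m) x)
        \<le> (1 - \<delta>) * (\<Sum>w\<in>preimage_words B m x. \<Phi> m (w \<frown> x) * norm2 (group_mass B n (w \<frown> x)))"
    by (rule group_mass_contraction[OF Yne Yc _ eps far' finV lenV conn]) (auto simp: Y'_def)
  have connV: "\<exists>c\<in>out ` J. path (N1 + 1) a c j" if "j \<in> S" for j
    using preimage[OF that] out by blast
  obtain K where K: "K > 0" "\<And>B n. finite B \<Longrightarrow> n > 0 \<Longrightarrow>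
      ennreal (word_mass B n x0)
        \<le> ennreal K * (\<Sum>\<^sub>\<infinity>x\<in>periodic a (N1 + 1 + n). ennreal (\<Phi> (N1 + 1 + n) x))"
    using word_mass_le_periodic[OF finite_imageI[OF J(1)] connV x0] by blast
  let ?R = "\<lambda>n. \<Sum>\<^sub>\<infinity>x\<in>periodic a n. ennreal (\<Phi> n x)"
  let ?Q = "\<lambda>n. \<Sum>\<^sub>\<infinity>x\<in>group_periodic n. ennreal (\<Phi> n x)"
  have QR: "?Q n \<le> ennreal (exp D * K * (1 - \<delta>) ^ (n div m)) * ?R (N1 + 1 + n)" if n: "n > 0" for n
  proof (rule infsum_ennreal_leI)
    fix P assume P: "finite P" "P \<subseteq> group_periodic n"
    then have P': "P \<subseteq> periodic a n" by (auto simp: group_periodic_def)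
    define B where "B = (\<Union>x\<in>P. x ` {..<n}) \<union> (\<Union>v\<in>V. set v)"
    have B: "finite B" "(\<Union>v\<in>V. set v) \<subseteq> B" using P finV by (auto simp: B_def)
    have "(\<Sum>x\<in>P. \<Phi> n x) \<le> exp D * group_mass B n x0 \<one>"
      unfolding group_mass_def
      by (rule sum_periodic_le[OF P(1) P' n x0 B(1)]) (use P in \<open>auto simp: B_def group_periodic_def\<close>)
    also have "group_mass B n x0 \<one> \<le> norm2 (group_mass B n x0)"
      using abs_le_norm2[of "group_mass B n x0" \<one>] B by simp
    also have "\<dots> \<le> (1 - \<delta>) ^ (n div m) * word_mass B n x0"
      by (rule group_mass_decay[OF m \<delta> B(1) contr[OF B] x0(1)])
    finally have "(\<Sum>x\<in>P. \<Phi> n x) \<le> exp D * (1 - \<delta>) ^ (n div m) * word_mass B n x0"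
      by (simp add: mult.assoc)
    then have "ennreal (\<Sum>x\<in>P. \<Phi> n x) \<le> ennreal (exp D * (1 - \<delta>) ^ (n div m) * word_mass B n x0)"
      by (rule ennreal_leI)
    also have "\<dots> = ennreal (exp D * (1 - \<delta>) ^ (n div m)) * ennreal (word_mass B n x0)"
      using \<delta> word_mass_nonneg by (intro ennreal_mult) auto
    also have "\<dots> \<le> ennreal (exp D * (1 - \<delta>) ^ (n div m)) * (ennreal K * ?R (N1 + 1 + n))"
      by (intro mult_left_mono K B n) auto
    also have "\<dots> = ennreal (exp D * K * (1 - \<delta>) ^ (n div m)) * ?R (N1 + 1 + n)"
      using \<delta> K by (simp add: ennreal_mult mult_ac)
    finally show "(\<Sum>x\<in>P. ennreal (\<Phi> n x))
        \<le> ennreal (exp D * K * (1 - \<delta>) ^ (n div m)) * ?R (N1 + 1 + n)"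
      using periodic_birkhoff_nonneg P' by (subst sum_ennreal) auto
  qed
  obtain q w where qw: "path q a w a" using one by (auto simp: loop_def)
  obtain p where p: "limsup (\<lambda>n. ereal (1 / real n) * ext_log (?R n)) = ereal p"
    using periodic_pressure_finite[OF qw] by blast
  have "limsup (\<lambda>n. ereal (1 / real n) * ext_log (?Q n)) < ereal p"
    by (rule limsup_ext_log_gap[OF p _ _ m _ QR]) (use \<delta> K in auto)
  then show False using pressure_eq p by simp
qed

text \<open>Transitivity supplies a loop of some length \<open>p\<close> with value the identity, and mixing of the base a loop
  of length \<open>1\<close> modulo \<open>p\<close>, whatever its value.\<close>

lemma amenable_if_pressure_eq:
  assumes count: "countable (carrier G)"
    and pressure_eq:
      "limsup (\<lambda>n. ereal (1 / real n) * ext_log (\<Sum>\<^sub>\<infinity>x\<in>group_periodic n. ennreal (\<Phi> n x)))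
        = limsup (\<lambda>n. ereal (1 / real n) * ext_log (\<Sum>\<^sub>\<infinity>x\<in>periodic a n. ennreal (\<Phi> n x)))"
  shows "amenable G"
proof -
  obtain p w where w: "path p a w a" "val w = \<one>" using transitive[of \<one>] by auto
  have p: "loop p \<one>" "p > 0" using w by (auto simp: loop_def path_def)
  obtain N0 where N0: "\<forall>n\<ge>N0. \<exists>w. path n a w a" using mixing[OF a a] by blast
  define n0 where "n0 = N0 * p + 1"
  have "N0 * 1 \<le> N0 * p" using p by (intro mult_le_mono2) simp
  then have "n0 \<ge> N0" unfolding n0_def by linarith
  then obtain u where u: "path n0 a u a" using N0 by blast
  have n0: "n0 mod p = 1 mod p" by (simp only: n0_def mod_mult_self3)
  have t: "loop n0 (val u)" using u by (auto simp: loop_def)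
  have all: "\<exists>n. loop n g" if "g \<in> carrier G" for g
    using transitive[OF that] by (auto simp: loop_def)
  show ?thesis
  proof (rule amenable_if_almost_invariant_loops[where loop = loop, OF count _ _ p _ t n0])
    show "g \<in> carrier G" if "loop n g" for n g by (rule loop_closed[OF that])
    show "loop (n + m) (g \<otimes> h)" if "loop n g" "loop m h" for n g m h by (rule loop_mult[OF that])
  qed (fact all, rule almost_invariant_vector[OF pressure_eq])
qed

end

section \<open>From the extension to labelled words\<close>

text \<open>The group coordinate along a path of the extension is the running product of the labels, so the path
  is determined by its projection to the base and its starting point.\<close>

lemma ext_matrix_path:
  assumes tmc: "tmc S A"
    and const: "\<And>x y. x \<in> shift_space S A \<Longrightarrow> y \<in> shift_space S A \<Longrightarrow> x 0 = y 0 \<Longrightarrow> \<psi> x = \<psi> y"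
    and letter: "\<And>x. x \<in> shift_space S A \<Longrightarrow> \<psi> x = letter (x 0)"
    and lab: "labelled_markov_potential S A \<phi> r C \<Lambda> G letter"
    and W: "set W \<subseteq> ext_states G S" "(b, h) \<in> ext_states G S" "W \<noteq> []"
      "successively (ext_matrix G S A \<psi>) (W @ [(b, h)])" "hd W = (i, g)"
  shows "markov_potential.path S A (length W) i (map fst W) b \<and>
    h = g \<otimes>\<^bsub>G\<^esub> labelled_markov_potential.val G letter (map fst W)"
  using W
proof (induction W arbitrary: i g)
  case (Cons s W)
  interpret labelled_markov_potential S A \<phi> r C \<Lambda> G letter by (rule lab)
  have s: "s = (i, g)" "i \<in> S" "g \<in> carrier G" using Cons.prems by (auto simp: ext_states_def)
  obtain x where x: "x \<in> shift_space S A" "x 0 = i" using cylinder_nonempty[OF tmc s(2)] by blast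
  have em: "ext_matrix G S A \<psi> (i, g') (j, k) \<longleftrightarrow> A i j \<and> k = g' \<otimes>\<^bsub>G\<^esub> \<psi> x" if "j \<in> S" for j k g'
    by (rule ext_matrix_iff[where \<psi> = \<psi>, OF tmc s(2) that x]) (rule const)
  have li: "\<psi> x = letter i" "letter i \<in> carrier G" using letter[OF x(1)] x(2) letter_closed s by auto
  show ?case
  proof (cases W)
    case Nil
    have "ext_matrix G S A \<psi> (i, g) (b, h)" "b \<in> S" using Cons.prems Nil s by (auto simp: ext_states_def)
    then have "A i b" "h = g \<otimes>\<^bsub>G\<^esub> letter i" using em li by auto
    then show ?thesis using Nil s li by (simp add: path_def)
  next
    case (Cons s' W')
    obtain j k where s': "s' = (j, k)" by force
    have jk: "j \<in> S" "k \<in> carrier G" using Cons.prems Cons s' by (auto simp: ext_states_def)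
    have "ext_matrix G S A \<psi> (i, g) (j, k)" using Cons.prems Cons s s' by simp
    then have step: "A i j" "k = g \<otimes>\<^bsub>G\<^esub> letter i" using em[OF jk(1)] li by auto
    have IH: "path (length W) j (map fst W) b \<and> h = k \<otimes>\<^bsub>G\<^esub> val (map fst W)"
      by (rule Cons.IH) (use Cons.prems Cons s' in \<open>auto simp: successively_Cons\<close>)
    have "path (1 + length W) i ([i] @ map fst W) b"
      using IH by (intro path_append[OF path_single[OF s(2) step(1)]]) blast
    moreover have "val (map fst W) \<in> carrier G"
      using IH val_closed[of "map fst W"] by (simp add: path_def)
    ultimately show ?thesis using IH step s li by (simp add: m_assoc)
  qed
qed simp

lemma ext_map_funpow:
  assumes letter: "\<And>x. x \<in> shift_space S A \<Longrightarrow> \<psi> x = letter (x 0)"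
    and lab: "labelled_markov_potential S A \<phi> r C \<Lambda> G letter"
    and x: "x \<in> shift_space S A"
  shows "(ext_map G \<psi> ^^ n) (x, \<one>\<^bsub>G\<^esub>)
    = (suffix n x, labelled_markov_potential.val G letter (prefix n x))"
proof (induction n)
  interpret labelled_markov_potential S A \<phi> r C \<Lambda> G letter by (rule lab)
  {
    case 0
    show ?case by simp
  next
    case (Suc n)
    have xS: "x k \<in> S" for k using x by (simp add: shift_space_def)
    have "shift (suffix n x) = suffix (Suc n) x" using shift_funpow[of "Suc n" x] by (simp add: shift_funpow)
    moreover have "\<psi> (suffix n x) = letter (x n)" using letter[OF suffix_in_X[OF x]] by simp
    moreover have "val (prefix (Suc n) x) = val (prefix n x) \<otimes>\<^bsub>G\<^esub> letter (x n)"
      using val_append[of "prefix n x" "[x n]"] xS letter_closed[OF xS[of n]] by auto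
    moreover have "(ext_map G \<psi> ^^ Suc n) (x, \<one>\<^bsub>G\<^esub>) = ext_map G \<psi> (suffix n x, val (prefix n x))"
      using Suc by (simp only: funpow.simps o_apply)
    ultimately show ?case by (simp only: ext_map_def prod.case)
  }
qed

lemma hoelder_bound:
  assumes "variation S A f n \<le> ereal c"
    and "x \<in> shift_space S A" "y \<in> shift_space S A" "\<And>k. k < n \<Longrightarrow> x k = y k"
  shows "\<bar>f x - f y\<bar> \<le> c"
proof -
  have "ereal \<bar>f x - f y\<bar> \<le> variation S A f n"
    unfolding variation_def using assms(2-4) by (intro SUP_upper2[of "(x, y)"]) auto
  then show ?thesis using assms(1) order_trans by fastforce
qed

lemma ruelle_op_finite_sum_le:
  assumes pos: "\<And>x. x \<in> shift_space S A \<Longrightarrow> \<phi> x > 0"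
    and fin: "sup_norm S A (ruelle_op S A \<phi> (\<lambda>_. 1)) < \<infinity>"
    and x: "x \<in> shift_space S A" and B: "finite B" "B \<subseteq> S"
  shows "(\<Sum>v\<in>{v \<in> B. A v (x 0)}. \<phi> ([v] \<frown> x)) \<le> enn2real (sup_norm S A (ruelle_op S A \<phi> (\<lambda>_. 1)))"
proof -
  let ?B = "{v \<in> B. A v (x 0)}" and ?I = "{v \<in> S. x \<in> shift ` cylinder S A [v]}"
  have y: "[v] \<frown> x \<in> cylinder S A [v]" "shift ([v] \<frown> x) = x" if "v \<in> ?B" for v
  proof -
    have "([v] \<frown> x) k = (case k of 0 \<Rightarrow> v | Suc k \<Rightarrow> x k)" for k
      by (auto simp: conc_def split: nat.split)
    then show "[v] \<frown> x \<in> cylinder S A [v]" "shift ([v] \<frown> x) = x"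
      using x that B by (auto simp: cylinder_def shift_space_def shift_def split: nat.split)
  qed
  have inv: "inv_branch S A v x = [v] \<frown> x" if "v \<in> ?B" for v
    unfolding inv_branch_def by (rule the_inv_into_f_eq[OF inj_on_shift_cylinder y(2,1)[OF that]])
  have sub: "?B \<subseteq> ?I"
  proof
    fix v assume v: "v \<in> ?B"
    have "x \<in> shift ` cylinder S A [v]" using y[OF v] by (metis image_eqI)
    then show "v \<in> ?I" using v B by blast
  qed
  have nn: "\<phi> ([v] \<frown> x) \<ge> 0" if "v \<in> ?B" for v
    using pos y(1)[OF that] by (simp add: cylinder_def less_imp_le[OF pos])
  have "ennreal (\<Sum>v\<in>?B. \<phi> ([v] \<frown> x)) = (\<Sum>v\<in>?B. ennreal (\<phi> (inv_branch S A v x)) * 1)"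
    using inv nn by (subst sum_ennreal[symmetric]) auto
  also have "\<dots> \<le> ruelle_op S A \<phi> (\<lambda>_. 1) x"
    unfolding ruelle_op_def using B sub by (intro sum_le_infsum_ennreal) auto
  also have "\<dots> \<le> sup_norm S A (ruelle_op S A \<phi> (\<lambda>_. 1))"
    unfolding sup_norm_def using x by (rule SUP_upper)
  also have "\<dots> = ennreal (enn2real (sup_norm S A (ruelle_op S A \<phi> (\<lambda>_. 1))))"
    using fin by simp
  finally show ?thesis by (simp add: ennreal_le_iff)
qed

theorem theorem5p4:
  fixes S :: "'s set" and A :: "'s \<Rightarrow> 's \<Rightarrow> bool"
    and G :: "('g, 'm) monoid_scheme"
    and \<psi> :: "(nat \<Rightarrow> 's) \<Rightarrow> 'g" and \<phi> :: "(nat \<Rightarrow> 's) \<Rightarrow> real"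
    and a :: 's
  assumes "tmc S A" and "bip S A"
    and "group G" and "countable (carrier G)"
    and "\<And>x. x \<in> shift_space S A \<Longrightarrow> \<psi> x \<in> carrier G"
    and "\<And>v x y. v \<in> S \<Longrightarrow> x \<in> cylinder S A [v] \<Longrightarrow> y \<in> cylinder S A [v] \<Longrightarrow> \<psi> x = \<psi> y"
    and "top_transitive (ext_states G S) (ext_matrix G S A \<psi>)"
    and "\<And>x. x \<in> shift_space S A \<Longrightarrow> \<phi> x > 0"
    and "locally_hoelder S A (\<lambda>x. ln (\<phi> x))"
    and "sup_norm S A (ruelle_op S A \<phi> (\<lambda>_. 1)) < \<infinity>"
    and "a \<in> S"
    and "ext_pressure G S A \<psi> \<phi> a = pressure S A \<phi> a"
  shows "amenable G"
proof -
  obtain r C where rC: "0 < r" "r < 1" "C \<ge> 1"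
    and var: "\<And>n. n \<ge> 1 \<Longrightarrow> variation S A (\<lambda>x. ln (\<phi> x)) n \<le> ereal (C * r ^ n)"
    using assms(9) unfolding locally_hoelder_def by blast
  define \<Lambda> where "\<Lambda> = enn2real (sup_norm S A (ruelle_op S A \<phi> (\<lambda>_. 1))) + 1"
  have \<Lambda>: "\<Lambda> > 0" by (simp add: \<Lambda>_def add_nonneg_pos)
  define letter where "letter v = \<psi> (SOME x. x \<in> shift_space S A \<and> x 0 = v)" for v
  have const: "\<psi> x = \<psi> y" if "x \<in> shift_space S A" "y \<in> shift_space S A" "x 0 = y 0" for x y
    by (rule assms(6)[of "x 0"]) (use that in \<open>auto simp: cylinder_def shift_space_def\<close>)
  have some: "(SOME x. x \<in> shift_space S A \<and> x 0 = v) \<in> shift_space S A \<and>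
      (SOME x. x \<in> shift_space S A \<and> x 0 = v) 0 = v" if "v \<in> S" for v
    using someI_ex[of "\<lambda>x. x \<in> shift_space S A \<and> x 0 = v"] cylinder_nonempty[OF assms(1) that] by blast
  have letter: "\<psi> x = letter (x 0)" if x: "x \<in> shift_space S A" for x
  proof -
    have "x 0 \<in> S" using x by (simp add: shift_space_def)
    from some[OF this] show ?thesis unfolding letter_def by (intro const x) auto
  qed
  have lab: "labelled_markov_potential S A \<phi> r C \<Lambda> G letter"
  proof (intro labelled_markov_potential.intro labelled_markov_potential_axioms.intro assms(3))
    show "markov_potential S A \<phi> r C \<Lambda>"
    proof
      show "\<bar>ln (\<phi> x) - ln (\<phi> y)\<bar> \<le> C * r ^ n"
        if "x \<in> shift_space S A" "y \<in> shift_space S A" "n \<ge> 1" "\<And>k. k < n \<Longrightarrow> x k = y k" for x y n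
        by (rule hoelder_bound[OF var[OF that(3)] that(1,2,4)])
      show "(\<Sum>v\<in>{v \<in> B. A v (x 0)}. \<phi> ([v] \<frown> x)) \<le> \<Lambda>"
        if "x \<in> shift_space S A" "finite B" "B \<subseteq> S" for x B
        using ruelle_op_finite_sum_le[where \<phi> = \<phi>, OF assms(8,10) that] by (simp add: \<Lambda>_def)
    qed (use rC \<Lambda> assms(8) in auto)
    show "letter v \<in> carrier G" if "v \<in> S" for v
      unfolding letter_def using assms(5) some[OF that] by blast
  qed
  interpret labelled_markov_potential S A \<phi> r C \<Lambda> G letter by (rule lab)
  obtain J where J: "finite J" "J \<subseteq> S" "\<And>v. v \<in> S \<Longrightarrow> \<exists>\<beta>\<in>J. \<exists>\<beta>'\<in>J.
      [v, \<beta>] \<in> admissible_words S A 2 \<and> [\<beta>', v] \<in> admissible_words S A 2"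
    using assms(2) unfolding bip_def by blast
  have bipJ: "(\<exists>\<beta>\<in>J. A v \<beta>) \<and> (\<exists>\<beta>\<in>J. A \<beta> v)" if "v \<in> S" for v
    using J(3)[OF that] by (auto simp: admissible_words_def)
  have conn: "\<exists>w. path n i w j" if "connected_by S A n i j" for n i j
    using that unfolding connected_by_def admissible_words_def path_def by auto
  have mix: "\<exists>N. \<forall>n\<ge>N. \<exists>w. path n i w j" if "i \<in> S" "j \<in> S" for i j
    using assms(2) that conn unfolding bip_def top_mixing_def by meson
  have trans: "\<exists>n w. path n a w a \<and> val w = g" if g: "g \<in> carrier G" for g
  proof -
    have st: "(a, \<one>\<^bsub>G\<^esub>) \<in> ext_states G S" "(a, g) \<in> ext_states G S"
      using assms(11) g by (auto simp: ext_states_def)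
    then obtain n W where W: "W \<noteq> []" "hd W = (a, \<one>\<^bsub>G\<^esub>)"
        "W @ [(a, g)] \<in> admissible_words (ext_states G S) (ext_matrix G S A \<psi>) (Suc n)"
      using assms(7) unfolding top_transitive_def connected_by_def by blast
    have "path (length W) a (map fst W) a \<and> g = \<one>\<^bsub>G\<^esub> \<otimes>\<^bsub>G\<^esub> val (map fst W)"
      by (rule ext_matrix_path[where \<psi> = \<psi>, OF assms(1) const letter lab _ st(2) W(1) _ W(2)])
         (use W(3) in \<open>auto simp: admissible_words_def\<close>)
    moreover from this have "val (map fst W) \<in> carrier G"
      using val_closed[of "map fst W"] by (simp add: path_def)
    ultimately show ?thesis by auto
  qed
  obtain x0 where x0: "x0 \<in> shift_space S A" "x0 0 = a"
    using cylinder_nonempty[OF assms(1,11)] by blast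
  interpret bip_extension S A \<phi> r C \<Lambda> G letter J a x0
    by unfold_locales (use J bipJ mix trans x0 assms(11) in auto)
  have per: "{x \<in> cylinder S A [a]. (shift ^^ n) x = x} = periodic a n" for n
    by (auto simp: periodic_def cylinder_def shift_funpow)
  have gper: "{x \<in> cylinder S A [a]. (ext_map G \<psi> ^^ n) (x, \<one>\<^bsub>G\<^esub>) = (x, \<one>\<^bsub>G\<^esub>)} = group_periodic n" for n
    using ext_map_funpow[where \<psi> = \<psi>, OF letter lab]
    by (auto simp: group_periodic_def periodic_def cylinder_def)
  show ?thesis
    by (rule amenable_if_pressure_eq[OF assms(4)])
       (use assms(12) in \<open>simp only: ext_pressure_def pressure_def per gper\<close>)
qed

end
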